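(* Let $L$ be a Dirac structure on $M$ whose null foliation $\mathcal{K}$ is simple, let $Q=M/\mathcal{K}$ be the leaf space with induced Poisson structure $\pi_Q$, and suppose that $L$ is compatible with $r\in\Omega^1(M,TM)$. Then $r$ descends to $r_Q\in\Omega^1(Q,TQ)$, which is compatible with $\pi_Q$. In particular, if $(M,L,r)$ is a Dirac-Nijenhuis manifold, its quotient $Q=M/\mathcal{K}$ (with $(\pi_Q,r_Q)$) is a Poisson-Nijenhuis manifold.
   Context: $\mathbb{T}M=TM\oplus T^*M$ carries the pairing $\langle(X,\alpha),(Y,\beta)\rangle=\beta(X)+\alpha(Y)$ and the Courant-Dorfman bracket $[\![(X,\alpha),(Y,\beta)]\!]=([X,Y],\mathcal{L}_X\beta-i_Yd\alpha)$. A Dirac structure is a subbundle $L\subset\mathbb{T}M$ with $L=L^\perp$ whose sections are closed under the bracket. For $r\in\Omega^1(M,TM)$, viewed as $r:TM\to TM$ with dual $r^*$, set $D^r_X(Y)=[Y,r(X)]-r([Y,X])$, $D^{r,*}_X(\alpha)=\mathcal{L}_X(r^*\alpha)-\mathcal{L}_{r(X)}\alpha$, $\mathbb{D}^r_X(Y,\alpha)=(D^r_X(Y),D^{r,*}_X(\alpha))$. $L$ and $r$ are compatible if $(r,r^* )(L)\subseteq L$ and $\mathbb{D}^r_X(\Gamma(L))\subseteq\Gamma(L)$ for all $X\in\mathfrak{X}(M)$. $r$ is Nijenhuis if $[r(X),r(Y)]-r([r(X),Y]+[X,r(Y)]-r[X,Y])=0$ for all $X,Y$. $(M,L,r)$ is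 Dirac-Nijenhuis if $L$ is Dirac, $r$ is Nijenhuis and they are compatible. The null distribution of $L$ is $K=L\cap TM$. When it has constant rank it is integrable, and its foliation $\mathcal{K}$ is the null foliation. It is simple if the leaf space $Q=M/\mathcal{K}$ is a smooth manifold for which the quotient map $\psi:M\to Q$ is a surjective submersion. In this case $Q$ has a unique Poisson structure $\pi_Q$ such that $\psi:(M,L)\to(Q,\mathrm{graph}(\pi_Q^\sharp))$ is a forward Dirac map, i.e. $(\mathrm{graph}(\pi_Q^\sharp))_{\psi(x)}=\{(T_x\psi(X),\beta): (X,(T_x\psi)^*\beta)\in L_x\}$ for all $x\in M$. $r$ descends to $Q$ if there is a (necessarily unique) $r_Q\in\Omega^1(Q,TQ)$ with $r_Q\circ d\psi=d\psi\circ r$. A bivector field $\pi$ and a $(1,1)$-tensor field $r$ are compatible if $\pi^\sharp\circ r^*=r\circ\pi^\sharp$ (with $\pi^\sharp(\alpha)=i_\alpha\pi$) and $\pi^\sharp(\mathcal{L}_Xr^*(\alpha)-\mathcal{L}_{r(X)}\alpha)-(\mathcal{L}_{\pi^\sharp(\alpha)}r)(X)=0$ for all $X,\alpha$. A Poisson-Nijenhuis structure is a compatible pair $(\pi,r)$ with $\pi$ Poisson and $r$ Nijenhuis. *)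

theory Defs
  imports "HOL-Analysis.Analysis" "HOL-Library.Disjoint_Sets"
begin

section \<open>Model spaces and smooth maps between them\<close>

text \<open>
  Finite-dimensional inner product spaces.  In contrast to \<^class>\<open>euclidean_space\<close> the zero
  space is admitted, so that zero-dimensional manifolds (a discrete leaf space, or leaves that
  are points) are not excluded.
\<close>

class finite_dim_inner = real_inner +
  assumes finite_spanning_set: "\<exists>B. finite B \<and> (\<forall>x. \<exists>a. x = (\<Sum>b\<in>B. a b *\<^sub>R b))"

instance euclidean_space \<subseteq> finite_dim_inner
proof
  show "\<exists>B. finite B \<and> (\<forall>x::'a. \<exists>a. x = (\<Sum>b\<in>B. a b *\<^sub>R b))"
    by (metis euclidean_representation finite_Basis)
qed

primrec Ck_on :: "nat \<Rightarrow> 'a::real_normed_vector set \<Rightarrow> ('a \<Rightarrow> 'b::real_normed_vector) \<Rightarrow> bool" where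
  "Ck_on 0 U f \<longleftrightarrow> continuous_on U f"
| "Ck_on (Suc k) U f \<longleftrightarrow>
     (\<forall>x\<in>U. f differentiable (at x)) \<and> (\<forall>v. Ck_on k U (\<lambda>x. frechet_derivative f (at x) v))"

text \<open>Only used for open sets \<open>U\<close> of finite-dimensional spaces.\<close>

definition smooth_on :: "'a::real_normed_vector set \<Rightarrow> ('a \<Rightarrow> 'b::real_normed_vector) \<Rightarrow> bool" where
  "smooth_on U f \<longleftrightarrow> (\<forall>k. Ck_on k U f)"


section \<open>Smooth manifolds\<close>

text \<open>A chart is a pair of its domain and its coordinate map.\<close>

type_synonym ('p, 'e) chart = "'p set \<times> ('p \<Rightarrow> 'e)"

record ('p, 'e) manifold =
  mtop :: "'p topology"
  atlas :: "('p, 'e) chart set"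

abbreviation carrier :: "('p, 'e) manifold \<Rightarrow> 'p set" where
  "carrier M \<equiv> topspace (mtop M)"

definition chart_inv :: "('p, 'e) chart \<Rightarrow> 'e \<Rightarrow> 'p" where
  "chart_inv c = inv_into (fst c) (snd c)"

definition smooth_manifold :: "('p, 'e::finite_dim_inner) manifold \<Rightarrow> bool" where
  "smooth_manifold M \<longleftrightarrow>
     Hausdorff_space (mtop M) \<and> second_countable (mtop M) \<and>
     (\<Union>c\<in>atlas M. fst c) = carrier M \<and>
     (\<forall>c\<in>atlas M. openin (mtop M) (fst c) \<and> open (snd c ` fst c) \<and>
        homeomorphic_map (subtopology (mtop M) (fst c)) (top_of_set (snd c ` fst c)) (snd c)) \<and>
     (\<forall>c\<in>atlas M. \<forall>d\<in>atlas M. smooth_on (snd c ` (fst c \<inter> fst d)) (snd d \<circ> chart_inv c))"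

definition smooth_map ::
  "('p, 'e::finite_dim_inner) manifold \<Rightarrow> ('q, 'f::finite_dim_inner) manifold \<Rightarrow> ('p \<Rightarrow> 'q) \<Rightarrow> bool" where
  "smooth_map M N f \<longleftrightarrow>
     continuous_map (mtop M) (mtop N) f \<and>
     (\<forall>c\<in>atlas M. \<forall>d\<in>atlas N.
        smooth_on (snd c ` {x \<in> fst c. f x \<in> fst d}) (snd d \<circ> f \<circ> chart_inv c))"

definition smooth_fun :: "('p, 'e::finite_dim_inner) manifold \<Rightarrow> ('p \<Rightarrow> real) \<Rightarrow> bool" where
  "smooth_fun M f \<longleftrightarrow> (\<forall>c\<in>atlas M. smooth_on (snd c ` fst c) (f \<circ> chart_inv c))"


section \<open>Tangent and cotangent vectors\<close>

text \<open>
  A preferred chart is chosen around every point \<open>x\<close>, and it identifies the tangent space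
  at \<open>x\<close> with the model space \<open>'e\<close>: the vector \<open>v\<close> stands for the tangent
  vector whose components in the preferred chart at \<open>x\<close> are \<open>v\<close>.  The cotangent space at
  \<open>x\<close> is accordingly the dual of \<open>'e\<close>.  Sections of tensor bundles are functions on the
  type of points; their values outside the manifold are irrelevant.
\<close>

definition chart_at :: "('p, 'e) manifold \<Rightarrow> 'p \<Rightarrow> ('p, 'e) chart" where
  "chart_at M x = (SOME c. c \<in> atlas M \<and> x \<in> fst c)"

type_synonym 'e covector = "'e \<Rightarrow>\<^sub>L real"
type_synonym ('p, 'e) vfield = "'p \<Rightarrow> 'e"
type_synonym ('p, 'e) oneform = "'p \<Rightarrow> 'e \<Rightarrow>\<^sub>L real"
type_synonym ('p, 'e) tensor11 = "'p \<Rightarrow> 'e \<Rightarrow>\<^sub>L 'e"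

definition tangent_map ::
  "('p, 'e::finite_dim_inner) manifold \<Rightarrow> ('q, 'f::finite_dim_inner) manifold \<Rightarrow>
   ('p \<Rightarrow> 'q) \<Rightarrow> 'p \<Rightarrow> 'e \<Rightarrow>\<^sub>L 'f" where
  "tangent_map M N f x =
     Blinfun (frechet_derivative (snd (chart_at N (f x)) \<circ> f \<circ> chart_inv (chart_at M x))
       (at (snd (chart_at M x) x)))"

definition differential ::
  "('p, 'e::finite_dim_inner) manifold \<Rightarrow> ('p \<Rightarrow> real) \<Rightarrow> ('p, 'e) oneform" where
  "differential M f x =
     Blinfun (frechet_derivative (f \<circ> chart_inv (chart_at M x)) (at (snd (chart_at M x) x)))"

text \<open>
  The isomorphism from the tangent space at \<open>x\<close> to \<open>'e\<close> given by an arbitrary chart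
  \<open>c\<close> around \<open>x\<close>, and its inverse.
\<close>

definition to_chart ::
  "('p, 'e::finite_dim_inner) manifold \<Rightarrow> ('p, 'e) chart \<Rightarrow> 'p \<Rightarrow> 'e \<Rightarrow>\<^sub>L 'e" where
  "to_chart M c x =
     Blinfun (frechet_derivative (snd c \<circ> chart_inv (chart_at M x)) (at (snd (chart_at M x) x)))"

definition from_chart ::
  "('p, 'e::finite_dim_inner) manifold \<Rightarrow> ('p, 'e) chart \<Rightarrow> 'p \<Rightarrow> 'e \<Rightarrow>\<^sub>L 'e" where
  "from_chart M c x =
     Blinfun (frechet_derivative (snd (chart_at M x) \<circ> chart_inv c) (at (snd c x)))"


section \<open>Smooth tensor fields\<close>

text \<open>Coordinate representations, as functions on the image of the chart.\<close>

definition vf_in ::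
  "('p, 'e::finite_dim_inner) manifold \<Rightarrow> ('p, 'e) chart \<Rightarrow> ('p, 'e) vfield \<Rightarrow> 'e \<Rightarrow> 'e" where
  "vf_in M c X y = (let x = chart_inv c y in to_chart M c x (X x))"

definition form_in ::
  "('p, 'e::finite_dim_inner) manifold \<Rightarrow> ('p, 'e) chart \<Rightarrow> ('p, 'e) oneform \<Rightarrow> 'e \<Rightarrow> 'e covector" where
  "form_in M c \<alpha> y = (let x = chart_inv c y in \<alpha> x o\<^sub>L from_chart M c x)"

definition tensor_in ::
  "('p, 'e::finite_dim_inner) manifold \<Rightarrow> ('p, 'e) chart \<Rightarrow> ('p, 'e) tensor11 \<Rightarrow> 'e \<Rightarrow> 'e \<Rightarrow>\<^sub>L 'e" where
  "tensor_in M c r y = (let x = chart_inv c y in to_chart M c x o\<^sub>L r x o\<^sub>L from_chart M c x)"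

definition smooth_vf_on ::
  "('p, 'e::finite_dim_inner) manifold \<Rightarrow> 'p set \<Rightarrow> ('p, 'e) vfield \<Rightarrow> bool" where
  "smooth_vf_on M U X \<longleftrightarrow> (\<forall>c\<in>atlas M. smooth_on (snd c ` (fst c \<inter> U)) (vf_in M c X))"

definition smooth_form_on ::
  "('p, 'e::finite_dim_inner) manifold \<Rightarrow> 'p set \<Rightarrow> ('p, 'e) oneform \<Rightarrow> bool" where
  "smooth_form_on M U \<alpha> \<longleftrightarrow> (\<forall>c\<in>atlas M. smooth_on (snd c ` (fst c \<inter> U)) (form_in M c \<alpha>))"

definition vector_fields :: "('p, 'e::finite_dim_inner) manifold \<Rightarrow> ('p, 'e) vfield set" where
  "vector_fields M = {X. smooth_vf_on M (carrier M) X}"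

definition one_forms :: "('p, 'e::finite_dim_inner) manifold \<Rightarrow> ('p, 'e) oneform set" where
  "one_forms M = {\<alpha>. smooth_form_on M (carrier M) \<alpha>}"

text \<open>The space of smooth \<open>TM\<close>-valued one-forms.\<close>

definition tensor_fields :: "('p, 'e::finite_dim_inner) manifold \<Rightarrow> ('p, 'e) tensor11 set" where
  "tensor_fields M = {r. \<forall>c\<in>atlas M. smooth_on (snd c ` fst c) (tensor_in M c r)}"

definition apply_tensor ::
  "('p, 'e::real_normed_vector) tensor11 \<Rightarrow> ('p, 'e) vfield \<Rightarrow> ('p, 'e) vfield" where
  "apply_tensor r X = (\<lambda>x. r x (X x))"

definition dual_tensor ::
  "('p, 'e::real_normed_vector) tensor11 \<Rightarrow> ('p, 'e) oneform \<Rightarrow> ('p, 'e) oneform" where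
  "dual_tensor r \<alpha> = (\<lambda>x. \<alpha> x o\<^sub>L r x)"


section \<open>Bracket, exterior derivative and Lie derivatives\<close>

text \<open>
  The usual coordinate formulas, evaluated at \<open>x\<close> in the preferred chart at \<open>x\<close>:
  \<open>[X,Y]\<^sup>j = X\<^sup>i \<partial>\<^sub>i Y\<^sup>j - Y\<^sup>i \<partial>\<^sub>i X\<^sup>j\<close>,
  \<open>(d\<alpha>)\<^sub>i\<^sub>j = \<partial>\<^sub>i \<alpha>\<^sub>j - \<partial>\<^sub>j \<alpha>\<^sub>i\<close> and
  \<open>(L\<^sub>X \<alpha>)\<^sub>j = X\<^sup>i \<partial>\<^sub>i \<alpha>\<^sub>j + \<alpha>\<^sub>i \<partial>\<^sub>j X\<^sup>i\<close>.
\<close>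

definition vf_deriv ::
  "('p, 'e::finite_dim_inner) manifold \<Rightarrow> ('p, 'e) vfield \<Rightarrow> 'p \<Rightarrow> 'e \<Rightarrow> 'e" where
  "vf_deriv M X x =
     frechet_derivative (vf_in M (chart_at M x) X) (at (snd (chart_at M x) x))"

definition form_deriv ::
  "('p, 'e::finite_dim_inner) manifold \<Rightarrow> ('p, 'e) oneform \<Rightarrow> 'p \<Rightarrow> 'e \<Rightarrow> 'e covector" where
  "form_deriv M \<alpha> x =
     frechet_derivative (form_in M (chart_at M x) \<alpha>) (at (snd (chart_at M x) x))"

definition lie_bracket ::
  "('p, 'e::finite_dim_inner) manifold \<Rightarrow> ('p, 'e) vfield \<Rightarrow> ('p, 'e) vfield \<Rightarrow> ('p, 'e) vfield" where
  "lie_bracket M X Y x = vf_deriv M Y x (X x) - vf_deriv M X x (Y x)"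

definition ext_deriv ::
  "('p, 'e::finite_dim_inner) manifold \<Rightarrow> ('p, 'e) oneform \<Rightarrow> 'p \<Rightarrow> 'e \<Rightarrow> 'e \<Rightarrow> real" where
  "ext_deriv M \<alpha> x u v = form_deriv M \<alpha> x u v - form_deriv M \<alpha> x v u"

definition interior_d ::
  "('p, 'e::finite_dim_inner) manifold \<Rightarrow> ('p, 'e) vfield \<Rightarrow> ('p, 'e) oneform \<Rightarrow> ('p, 'e) oneform" where
  "interior_d M Y \<alpha> x = Blinfun (ext_deriv M \<alpha> x (Y x))"

definition lie_form ::
  "('p, 'e::finite_dim_inner) manifold \<Rightarrow> ('p, 'e) vfield \<Rightarrow> ('p, 'e) oneform \<Rightarrow> ('p, 'e) oneform" where
  "lie_form M X \<alpha> x = form_deriv M \<alpha> x (X x) + (\<alpha> x o\<^sub>L Blinfun (vf_deriv M X x))"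

text \<open>\<open>(L\<^sub>Y r)(X)\<close> for a (1,1)-tensor field \<open>r\<close>.\<close>

definition lie_tensor ::
  "('p, 'e::finite_dim_inner) manifold \<Rightarrow> ('p, 'e) vfield \<Rightarrow> ('p, 'e) tensor11 \<Rightarrow>
   ('p, 'e) vfield \<Rightarrow> ('p, 'e) vfield" where
  "lie_tensor M Y r X = (\<lambda>x. lie_bracket M Y (apply_tensor r X) x - r x (lie_bracket M Y X x))"

definition nijenhuis :: "('p, 'e::finite_dim_inner) manifold \<Rightarrow> ('p, 'e) tensor11 \<Rightarrow> bool" where
  "nijenhuis M r \<longleftrightarrow>
     (\<forall>X\<in>vector_fields M. \<forall>Y\<in>vector_fields M. \<forall>x\<in>carrier M.
        lie_bracket M (apply_tensor r X) (apply_tensor r Y) x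
        - r x (lie_bracket M (apply_tensor r X) Y x + lie_bracket M X (apply_tensor r Y) x
               - r x (lie_bracket M X Y x)) = 0)"


section \<open>Dirac structures\<close>

type_synonym ('p, 'e) subbundle = "'p \<Rightarrow> ('e \<times> ('e \<Rightarrow>\<^sub>L real)) set"

definition pairing :: "'e::real_normed_vector \<times> 'e covector \<Rightarrow> 'e \<times> 'e covector \<Rightarrow> real" where
  "pairing a b = snd b (fst a) + snd a (fst b)"

definition orthogonal_space ::
  "('e::real_normed_vector \<times> 'e covector) set \<Rightarrow> ('e \<times> 'e covector) set" where
  "orthogonal_space A = {b. \<forall>a\<in>A. pairing a b = 0}"

text \<open>Smooth subbundles of the generalized tangent bundle, described by smooth local frames.\<close>

definition smooth_subbundle ::
  "('p, 'e::finite_dim_inner) manifold \<Rightarrow> ('p, 'e) subbundle \<Rightarrow> bool" where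
  "smooth_subbundle M L \<longleftrightarrow>
     (\<exists>k. \<forall>x\<^sub>0\<in>carrier M. \<exists>U X \<alpha>. openin (mtop M) U \<and> x\<^sub>0 \<in> U \<and>
        (\<forall>i<k. smooth_vf_on M U (X i) \<and> smooth_form_on M U (\<alpha> i)) \<and>
        (\<forall>x\<in>U. inj_on (\<lambda>i::nat. (X i x, \<alpha> i x)) {..<k} \<and>
           independent ((\<lambda>i. (X i x, \<alpha> i x)) ` {..<k}) \<and>
           span ((\<lambda>i. (X i x, \<alpha> i x)) ` {..<k}) = L x))"

definition sections ::
  "('p, 'e::finite_dim_inner) manifold \<Rightarrow> ('p, 'e) subbundle \<Rightarrow>
   (('p, 'e) vfield \<times> ('p, 'e) oneform) set" where
  "sections M L =
     {(X, \<alpha>). X \<in> vector_fields M \<and> \<alpha> \<in> one_forms M \<and> (\<forall>x\<in>carrier M. (X x, \<alpha> x) \<in> L x)}"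

fun courant_dorfman ::
  "('p, 'e::finite_dim_inner) manifold \<Rightarrow> ('p, 'e) vfield \<times> ('p, 'e) oneform \<Rightarrow>
   ('p, 'e) vfield \<times> ('p, 'e) oneform \<Rightarrow> ('p, 'e) vfield \<times> ('p, 'e) oneform" where
  "courant_dorfman M (X, \<alpha>) (Y, \<beta>) =
     (lie_bracket M X Y, \<lambda>x. lie_form M X \<beta> x - interior_d M Y \<alpha> x)"

definition dirac :: "('p, 'e::finite_dim_inner) manifold \<Rightarrow> ('p, 'e) subbundle \<Rightarrow> bool" where
  "dirac M L \<longleftrightarrow>
     smooth_subbundle M L \<and> (\<forall>x\<in>carrier M. L x = orthogonal_space (L x)) \<and>
     (\<forall>s\<in>sections M L. \<forall>t\<in>sections M L. courant_dorfman M s t \<in> sections M L)"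

definition D_vec ::
  "('p, 'e::finite_dim_inner) manifold \<Rightarrow> ('p, 'e) tensor11 \<Rightarrow> ('p, 'e) vfield \<Rightarrow>
   ('p, 'e) vfield \<Rightarrow> ('p, 'e) vfield" where
  "D_vec M r X Y = (\<lambda>x. lie_bracket M Y (apply_tensor r X) x - r x (lie_bracket M Y X x))"

definition D_form ::
  "('p, 'e::finite_dim_inner) manifold \<Rightarrow> ('p, 'e) tensor11 \<Rightarrow> ('p, 'e) vfield \<Rightarrow>
   ('p, 'e) oneform \<Rightarrow> ('p, 'e) oneform" where
  "D_form M r X \<alpha> = (\<lambda>x. lie_form M X (dual_tensor r \<alpha>) x - lie_form M (apply_tensor r X) \<alpha> x)"

definition dirac_compatible ::
  "('p, 'e::finite_dim_inner) manifold \<Rightarrow> ('p, 'e) subbundle \<Rightarrow> ('p, 'e) tensor11 \<Rightarrow> bool" where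
  "dirac_compatible M L r \<longleftrightarrow>
     (\<forall>x\<in>carrier M. \<forall>(v, \<alpha>)\<in>L x. (r x v, \<alpha> o\<^sub>L r x) \<in> L x) \<and>
     (\<forall>X\<in>vector_fields M. \<forall>(Y, \<alpha>)\<in>sections M L. (D_vec M r X Y, D_form M r X \<alpha>) \<in> sections M L)"

definition dirac_nijenhuis ::
  "('p, 'e::finite_dim_inner) manifold \<Rightarrow> ('p, 'e) subbundle \<Rightarrow> ('p, 'e) tensor11 \<Rightarrow> bool" where
  "dirac_nijenhuis M L r \<longleftrightarrow>
     r \<in> tensor_fields M \<and> dirac M L \<and> nijenhuis M r \<and> dirac_compatible M L r"


section \<open>The null foliation and its leaf space\<close>

definition null_distribution :: "('p, 'e::real_normed_vector) subbundle \<Rightarrow> 'p \<Rightarrow> 'e set" where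
  "null_distribution L x = {v. (v, 0) \<in> L x}"

text \<open>
  Connected immersed submanifolds of \<open>M\<close> tangent to the distribution \<open>K\<close>.  The topology of
  \<open>N\<close> may be finer than the one induced from \<open>M\<close>.
\<close>

definition integral_manifold ::
  "('p, 'e::finite_dim_inner) manifold \<Rightarrow> ('p \<Rightarrow> 'e set) \<Rightarrow>
   ('p, 'g::finite_dim_inner) manifold \<Rightarrow> bool" where
  "integral_manifold M K N \<longleftrightarrow>
     smooth_manifold N \<and> connected_space (mtop N) \<and> carrier N \<subseteq> carrier M \<and>
     smooth_map N M (\<lambda>x. x) \<and>
     (\<forall>x\<in>carrier N. inj (tangent_map N M (\<lambda>x. x) x) \<and> range (tangent_map N M (\<lambda>x. x) x) = K x)"

abbreviation leaves :: "('p, 'g) manifold set \<Rightarrow> 'p set set" where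
  "leaves F \<equiv> carrier ` F"

text \<open>
  The foliation integrating \<open>K\<close>: the partition of \<open>M\<close> into connected immersed
  submanifolds tangent to \<open>K\<close>.  The leaves have a common model space \<open>'g\<close>, so \<open>K\<close> has
  constant rank.  Such leaves are automatically maximal: a connected integral manifold
  containing a leaf is a disjoint union of open pieces of leaves.
\<close>

definition foliation_of ::
  "('p, 'e::finite_dim_inner) manifold \<Rightarrow> ('p \<Rightarrow> 'e set) \<Rightarrow>
   ('p, 'g::finite_dim_inner) manifold set \<Rightarrow> bool" where
  "foliation_of M K F \<longleftrightarrow>
     partition_on (carrier M) (leaves F) \<and> (\<forall>N\<in>F. integral_manifold M K N)"

definition leaf_map :: "('p, 'g) manifold set \<Rightarrow> 'p \<Rightarrow> 'p set" where
  "leaf_map F x = (THE S. S \<in> leaves F \<and> x \<in> S)"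

definition surjective_submersion ::
  "('p, 'e::finite_dim_inner) manifold \<Rightarrow> ('q, 'f::finite_dim_inner) manifold \<Rightarrow> ('p \<Rightarrow> 'q) \<Rightarrow> bool" where
  "surjective_submersion M Q \<psi> \<longleftrightarrow>
     smooth_map M Q \<psi> \<and> \<psi> ` carrier M = carrier Q \<and>
     (\<forall>x\<in>carrier M. surj (tangent_map M Q \<psi> x))"

text \<open>
  The foliation \<open>F\<close> is simple, with leaf space \<open>Q\<close>.  A surjective submersion is a topological
  quotient map, so \<open>Q\<close> carries the quotient topology.
\<close>

definition simple_with_leaf_space ::
  "('p, 'e::finite_dim_inner) manifold \<Rightarrow> ('p, 'g::finite_dim_inner) manifold set \<Rightarrow>
   ('p set, 'f::finite_dim_inner) manifold \<Rightarrow> bool" where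
  "simple_with_leaf_space M F Q \<longleftrightarrow>
     smooth_manifold Q \<and> carrier Q = leaves F \<and> surjective_submersion M Q (leaf_map F)"


section \<open>Poisson and Poisson-Nijenhuis structures\<close>

text \<open>A bivector at a point is an alternating bilinear form on the cotangent space.\<close>

type_synonym ('p, 'e) bivector = "'p \<Rightarrow> ('e \<Rightarrow>\<^sub>L real) \<Rightarrow> ('e \<Rightarrow>\<^sub>L real) \<Rightarrow> real"

definition bivector_fields ::
  "('p, 'e::finite_dim_inner) manifold \<Rightarrow> ('p, 'e) bivector set" where
  "bivector_fields M =
     {\<pi>. (\<forall>x\<in>carrier M. bilinear (\<pi> x) \<and> (\<forall>\<alpha>. \<pi> x \<alpha> \<alpha> = 0)) \<and>
         (\<forall>c\<in>atlas M. \<forall>\<alpha> \<beta>. smooth_on (snd c ` fst c)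
            (\<lambda>y. let x = chart_inv c y in \<pi> x (\<alpha> o\<^sub>L to_chart M c x) (\<beta> o\<^sub>L to_chart M c x)))}"

definition poisson_bracket ::
  "('p, 'e::finite_dim_inner) manifold \<Rightarrow> ('p, 'e) bivector \<Rightarrow> ('p \<Rightarrow> real) \<Rightarrow> ('p \<Rightarrow> real) \<Rightarrow> 'p \<Rightarrow> real" where
  "poisson_bracket M \<pi> f g = (\<lambda>x. \<pi> x (differential M f x) (differential M g x))"

definition poisson :: "('p, 'e::finite_dim_inner) manifold \<Rightarrow> ('p, 'e) bivector \<Rightarrow> bool" where
  "poisson M \<pi> \<longleftrightarrow> \<pi> \<in> bivector_fields M \<and>
     (\<forall>f g h. smooth_fun M f \<and> smooth_fun M g \<and> smooth_fun M h \<longrightarrow>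
        (\<forall>x\<in>carrier M.
           poisson_bracket M \<pi> f (poisson_bracket M \<pi> g h) x
           + poisson_bracket M \<pi> g (poisson_bracket M \<pi> h f) x
           + poisson_bracket M \<pi> h (poisson_bracket M \<pi> f g) x = 0))"

text \<open>The vector \<open>i\<^sub>\<alpha> \<pi>\<close>, characterized by \<open>\<beta>(i\<^sub>\<alpha> \<pi>) = \<pi>(\<alpha>, \<beta>)\<close>.\<close>

definition sharp ::
  "('p, 'e::real_normed_vector) bivector \<Rightarrow> 'p \<Rightarrow> 'e covector \<Rightarrow> 'e" where
  "sharp \<pi> x \<alpha> = (THE v. \<forall>\<beta>. blinfun_apply \<beta> v = \<pi> x \<alpha> \<beta>)"

definition graph_sharp :: "('p, 'e::real_normed_vector) bivector \<Rightarrow> ('p, 'e) subbundle" where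
  "graph_sharp \<pi> x = {(sharp \<pi> x \<alpha>, \<alpha>) | \<alpha>. True}"

definition forward_dirac ::
  "('p, 'e::finite_dim_inner) manifold \<Rightarrow> ('p, 'e) subbundle \<Rightarrow>
   ('q, 'f::finite_dim_inner) manifold \<Rightarrow> ('q, 'f) subbundle \<Rightarrow> ('p \<Rightarrow> 'q) \<Rightarrow> bool" where
  "forward_dirac M L Q L' \<psi> \<longleftrightarrow>
     (\<forall>x\<in>carrier M. L' (\<psi> x) =
        {(tangent_map M Q \<psi> x v, \<beta>) | v \<beta>. (v, \<beta> o\<^sub>L tangent_map M Q \<psi> x) \<in> L x})"

definition poisson_compatible ::
  "('p, 'e::finite_dim_inner) manifold \<Rightarrow> ('p, 'e) bivector \<Rightarrow> ('p, 'e) tensor11 \<Rightarrow> bool" where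
  "poisson_compatible M \<pi> r \<longleftrightarrow>
     (\<forall>x\<in>carrier M. \<forall>\<alpha>. sharp \<pi> x (\<alpha> o\<^sub>L r x) = r x (sharp \<pi> x \<alpha>)) \<and>
     (\<forall>X\<in>vector_fields M. \<forall>\<alpha>\<in>one_forms M. \<forall>x\<in>carrier M.
        sharp \<pi> x (lie_form M X (dual_tensor r \<alpha>) x - lie_form M (apply_tensor r X) \<alpha> x)
        - lie_tensor M (\<lambda>y. sharp \<pi> y (\<alpha> y)) r X x = 0)"

definition poisson_nijenhuis ::
  "('p, 'e::finite_dim_inner) manifold \<Rightarrow> ('p, 'e) bivector \<Rightarrow> ('p, 'e) tensor11 \<Rightarrow> bool" where
  "poisson_nijenhuis M \<pi> r \<longleftrightarrow>
     poisson M \<pi> \<and> r \<in> tensor_fields M \<and> nijenhuis M r \<and> poisson_compatible M \<pi> r"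


section \<open>Descent of (1,1)-tensor fields\<close>

definition descends_to ::
  "('p, 'e::finite_dim_inner) manifold \<Rightarrow> ('q, 'f::finite_dim_inner) manifold \<Rightarrow> ('p \<Rightarrow> 'q) \<Rightarrow>
   ('p, 'e) tensor11 \<Rightarrow> ('q, 'f) tensor11 \<Rightarrow> bool" where
  "descends_to M Q \<psi> r r' \<longleftrightarrow>
     r' \<in> tensor_fields Q \<and>
     (\<forall>x\<in>carrier M. r' (\<psi> x) o\<^sub>L tangent_map M Q \<psi> x = tangent_map M Q \<psi> x o\<^sub>L r x)"

end

theory Submission
  imports Defs "HOL-Computational_Algebra.Polynomial"
begin

text \<open>
  The kernel of \<open>d\<psi>\<close> is the null distribution \<open>K\<close>, which \<open>r\<close> preserves; hence at every point
  \<open>x\<close> there is an endomorphism \<open>B(x)\<close> with \<open>B(x) d\<psi> = d\<psi> r\<close>. Sections \<open>(Y, 0)\<close> of \<open>L\<close> and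
  compatibility show that \<open>B\<close> has no derivative along \<open>K\<close>, so \<open>B\<close> is constant on the connected
  leaves and descends to \<open>r\<^sub>Q\<close>, which is smooth because \<open>\<psi>\<close> has smooth local sections.
  If \<open>Y\<close> lifts \<open>\<pi>\<^sub>Q\<^sup>\<sharp>\<alpha>\<close>, then \<open>(Y, \<psi>\<^sup>*\<alpha>)\<close> is a section of \<open>L\<close>, since by the forward
  Dirac condition it differs from an element of \<open>L\<close> by an element of \<open>K\<close>. Compatibility of \<open>L\<close>
  with \<open>r\<close> applied to such sections projects to compatibility of \<open>\<pi>\<^sub>Q\<close> with \<open>r\<^sub>Q\<close>, and brackets of
  lifted vector fields project to brackets on \<open>Q\<close>, which settles the Nijenhuis condition.
  All lifts exist near a given point and are made global by a bump function.
\<close>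


text \<open>The delicate half of the kernel statement is that the kernel of \<open>T x\<close> is no
  larger than \<open>K x\<close>: leaves are only immersed and may carry a finer topology than that
  of \<open>M\<close>, so countability of the leaf topology has to supply the contradiction. A
  second obstacle is that compatibility speaks of global sections of \<open>L\<close>. A lift and a
  pulled-back form are therefore multiplied by the same cutoff, which keeps the pair in the linear
  space \<open>L x\<close> at every point of \<open>M\<close>. A third is the encoding of tangent
  vectors: the preferred chart may jump from point to point, so \<open>T x\<close> and
  \<open>B x\<close> need not vary continuously, and every differentiation takes place in fixed
  charts. Along a fibre the preferred chart of \<open>Q\<close> does not change, so constancy of
  \<open>B\<close> is plain equality of operators. Before \<open>B\<close> is known to descend,
  \<open>r X\<close> projects only to a field along \<psi>; hence the bracket formula is proved for
  pushforwards that need not come from a field on \<open>Q\<close>.\<close>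

section \<open>Finite-dimensional inner product spaces\<close>

text \<open>Gram-Schmidt, one vector at a time: a zero residual leaves \<open>B\<close> as it is, so
  \<open>S\<close> may be linearly dependent. The expansion formula records that \<open>S\<close>
  lies in the span of \<open>B\<close>.\<close>

lemma orthonormal_expansion_exists:
  fixes S :: "'a::real_inner set"
  assumes "finite S"
  shows "\<exists>B. finite B \<and> (\<forall>b\<in>B. \<forall>b'\<in>B. b \<bullet> b' = (if b = b' then 1 else 0)) \<and>
             (\<forall>x\<in>S. (\<Sum>b\<in>B. (x \<bullet> b) *\<^sub>R b) = x)"
  using assms
proof induction
  case empty
  show ?case by (rule exI[of _ "{}"]) simp
next
  case (insert a S)
  then obtain B where B: "finite B" "\<And>b b'. b \<in> B \<Longrightarrow> b' \<in> B \<Longrightarrow> b \<bullet> b' = (if b = b' then 1 else 0)"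
    "\<And>x. x \<in> S \<Longrightarrow> (\<Sum>b\<in>B. (x \<bullet> b) *\<^sub>R b) = x" by metis
  define a' where "a' = a - (\<Sum>b\<in>B. (a \<bullet> b) *\<^sub>R b)"
  have orth: "a' \<bullet> c = 0" if "c \<in> B" for c
  proof -
    have "(\<Sum>b\<in>B. (a \<bullet> b) *\<^sub>R b) \<bullet> c = (\<Sum>b\<in>B. (a \<bullet> b) * (b \<bullet> c))"
      by (simp add: inner_sum_left)
    also have "\<dots> = (\<Sum>b\<in>B. if b = c then a \<bullet> b else 0)"
      by (rule sum.cong) (auto simp: B(2)[OF _ that])
    also have "\<dots> = a \<bullet> c" using B(1) that by simp
    finally show ?thesis by (simp add: a'_def inner_diff_left)
  qed
  show ?case
  proof (cases "a' = 0")
    case True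
    then show ?thesis using B by (intro exI[of _ B]) (auto simp: a'_def)
  next
    case False
    define e where "e = a' /\<^sub>R norm a'"
    have ee: "e \<bullet> e = 1" using False by (simp add: e_def dot_square_norm power2_eq_square)
    have eb: "e \<bullet> b = 0" "b \<bullet> e = 0" if "b \<in> B" for b
      using orth[OF that] by (auto simp: e_def inner_commute)
    have enB: "e \<notin> B" using ee eb by force
    \<comment> \<open>Old vectors lie in the span of \<open>B\<close>, hence are orthogonal to
      \<open>e\<close>, and the new summand vanishes on them.\<close>
    have "(\<Sum>b\<in>insert e B. (x \<bullet> b) *\<^sub>R b) = x" if "x \<in> S" for x
    proof -
      have "x \<bullet> e = (\<Sum>b\<in>B. (x \<bullet> b) *\<^sub>R b) \<bullet> e" using B(3)[OF that] by simp
      also have "\<dots> = 0" using eb by (simp add: inner_sum_left)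
      finally show ?thesis using B(1,3) enB that by simp
    qed
    moreover have "(\<Sum>b\<in>insert e B. (a \<bullet> b) *\<^sub>R b) = a"
    proof -
      have "a = a' + (\<Sum>b\<in>B. (a \<bullet> b) *\<^sub>R b)" by (simp add: a'_def)
      then have "a \<bullet> e = a' \<bullet> e + (\<Sum>b\<in>B. (a \<bullet> b) *\<^sub>R b) \<bullet> e" by (metis inner_add_left)
      also have "\<dots> = norm a'"
        using eb False by (simp add: inner_sum_left e_def dot_square_norm power2_eq_square)
      finally have "(a \<bullet> e) *\<^sub>R e = a'" using False by (simp add: e_def)
      then show ?thesis using B(1) enB by (simp add: a'_def)
    qed
    ultimately show ?thesis
      using B ee eb enB by (intro exI[of _ "insert e B"]) auto
  qed
qed

text \<open>The counterpart of \<open>Basis\<close>; it is empty for the zero space.\<close>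

definition fbasis :: "'a::finite_dim_inner set" where
  "fbasis = (SOME B. finite B \<and> (\<forall>b\<in>B. \<forall>b'\<in>B. b \<bullet> b' = (if b = b' then 1 else 0)) \<and>
             (\<forall>x. (\<Sum>b\<in>B. (x \<bullet> b) *\<^sub>R b) = x))"

lemma fbasis:
  "finite (fbasis :: 'a::finite_dim_inner set) \<and>
   (\<forall>b\<in>fbasis. \<forall>b'\<in>fbasis. (b::'a) \<bullet> b' = (if b = b' then 1 else 0)) \<and>
   (\<forall>x::'a. (\<Sum>b\<in>fbasis. (x \<bullet> b) *\<^sub>R b) = x)"
proof -
  obtain S :: "'a set" where S: "finite S" "\<And>x. \<exists>a. x = (\<Sum>b\<in>S. a b *\<^sub>R b)"
    using finite_spanning_set by metis
  obtain B :: "'a set" where B: "finite B" "\<forall>b\<in>B. \<forall>b'\<in>B. b \<bullet> b' = (if b = b' then 1 else 0)"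
    "\<And>x. x \<in> S \<Longrightarrow> (\<Sum>b\<in>B. (x \<bullet> b) *\<^sub>R b) = x"
    using orthonormal_expansion_exists[OF S(1)] by metis
  have "(\<Sum>b\<in>B. (x \<bullet> b) *\<^sub>R b) = x" for x
  proof -
    obtain a where a: "x = (\<Sum>s\<in>S. a s *\<^sub>R s)" using S(2) by blast
    have "(\<Sum>b\<in>B. (x \<bullet> b) *\<^sub>R b) = (\<Sum>b\<in>B. \<Sum>s\<in>S. (a s * (s \<bullet> b)) *\<^sub>R b)"
      unfolding a by (simp add: inner_sum_left scaleR_sum_left)
    also have "\<dots> = (\<Sum>s\<in>S. a s *\<^sub>R (\<Sum>b\<in>B. (s \<bullet> b) *\<^sub>R b))"
      by (subst sum.swap) (simp add: scaleR_sum_right)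
    also have "\<dots> = x" unfolding a using B(3) by simp
    finally show ?thesis .
  qed
  then have "\<exists>B::'a set. finite B \<and> (\<forall>b\<in>B. \<forall>b'\<in>B. b \<bullet> b' = (if b = b' then 1 else 0)) \<and>
             (\<forall>x. (\<Sum>b\<in>B. (x \<bullet> b) *\<^sub>R b) = x)" using B by blast
  then show ?thesis unfolding fbasis_def by (rule someI_ex)
qed

lemma finite_fbasis [simp]: "finite fbasis"
  and fbasis_orthonormal: "b \<in> fbasis \<Longrightarrow> b' \<in> fbasis \<Longrightarrow> b \<bullet> b' = (if b = b' then 1 else 0)"
  and fbasis_expansion: "(\<Sum>b\<in>fbasis. (x \<bullet> b) *\<^sub>R b) = x"
  using fbasis by blast+

lemma linear_fbasis_expansion:
  fixes f :: "'a::finite_dim_inner \<Rightarrow> 'b::real_vector"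
  assumes "linear f"
  shows "f x = (\<Sum>b\<in>fbasis. (x \<bullet> b) *\<^sub>R f b)"
  by (subst fbasis_expansion[of x, symmetric]) (simp add: linear_sum[OF assms] linear_scale[OF assms])

lemma linear_imp_bounded_linear:
  fixes f :: "'a::finite_dim_inner \<Rightarrow> 'b::real_normed_vector"
  assumes "linear f"
  shows "bounded_linear f"
proof -
  have "bounded_linear (\<lambda>x. \<Sum>b\<in>fbasis. (x \<bullet> b) *\<^sub>R f b)"
    by (intro bounded_linear_sum bounded_linear_scaleR_const bounded_linear_inner_left)
  then show ?thesis using linear_fbasis_expansion[OF assms] by (metis (no_types, lifting) ext)
qed

text \<open>This makes the model spaces complete, as the fixed point arguments require, and their
  closed balls compact, as the cutoff functions require.\<close>

instance finite_dim_inner \<subseteq> heine_borel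
proof
  fix f :: "nat \<Rightarrow> 'a"
  assume f: "bounded (range f)"
  define unproj :: "('a \<Rightarrow> real) \<Rightarrow> 'a" where "unproj = (\<lambda>e. \<Sum>b\<in>fbasis. e b *\<^sub>R b)"
  have pu: "unproj e \<bullet> k = e k" if "k \<in> fbasis" for e k
  proof -
    have "unproj e \<bullet> k = (\<Sum>b\<in>fbasis. e b * (b \<bullet> k))" by (simp add: unproj_def inner_sum_left)
    also have "\<dots> = (\<Sum>b\<in>fbasis. if b = k then e b else 0)"
      by (rule sum.cong) (auto simp: fbasis_orthonormal[OF _ that])
    finally show ?thesis using that by simp
  qed
  have unproj_expansion: "unproj (\<lambda>k. x \<bullet> k) = x" for x
    by (simp add: unproj_def fbasis_expansion)
  have "\<forall>\<delta>\<subseteq>fbasis. \<exists>l::'a. \<exists>r::nat\<Rightarrow>nat.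
    strict_mono r \<and> (\<forall>\<epsilon>>0. eventually (\<lambda>n. \<forall>i\<in>\<delta>. dist (f (r n) \<bullet> i) (l \<bullet> i) < \<epsilon>) sequentially)"
    by (rule compact_lemma_general[where unproj = unproj])
      (auto simp: pu unproj_expansion intro!: bounded_linear_image[OF f] bounded_linear_inner_left)
  from this[THEN spec, of fbasis] obtain l r where lr: "strict_mono r"
    "\<And>\<epsilon>. \<epsilon> > 0 \<Longrightarrow> eventually (\<lambda>n. \<forall>i\<in>fbasis. dist (f (r n) \<bullet> i) (l \<bullet> i) < \<epsilon>) sequentially"
    by auto
  have "(\<lambda>n. f (r n) \<bullet> i) \<longlonglongrightarrow> l \<bullet> i" if "i \<in> fbasis" for i
    unfolding tendsto_iff
  proof (intro allI impI)
    fix \<epsilon> :: real assume "\<epsilon> > 0"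
    from lr(2)[OF this] show "eventually (\<lambda>n. dist (f (r n) \<bullet> i) (l \<bullet> i) < \<epsilon>) sequentially"
      by eventually_elim (use that in blast)
  qed
  then have "(\<lambda>n. \<Sum>i\<in>fbasis. (f (r n) \<bullet> i) *\<^sub>R i) \<longlonglongrightarrow> (\<Sum>i\<in>fbasis. (l \<bullet> i) *\<^sub>R i)"
    by (intro tendsto_sum tendsto_scaleR tendsto_const)
  then have "(f \<circ> r) \<longlonglongrightarrow> l" by (simp add: fbasis_expansion o_def)
  then show "\<exists>l r. strict_mono (r::nat\<Rightarrow>nat) \<and> (f \<circ> r) \<longlonglongrightarrow> l" using lr(1) by blast
qed

section \<open>Calculus of smooth maps\<close>

text \<open>The derivative is taken as an element of the normed space of operators, so that
  \<open>fderiv f\<close> can itself be continuous, smooth and differentiated again.\<close>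

definition fderiv :: "('a::real_normed_vector \<Rightarrow> 'b::real_normed_vector) \<Rightarrow> 'a \<Rightarrow> 'a \<Rightarrow>\<^sub>L 'b" where
  "fderiv f x = Blinfun (frechet_derivative f (at x))"

lemma fderiv_works:
  assumes "f differentiable (at x)"
  shows "(f has_derivative blinfun_apply (fderiv f x)) (at x)"
  by (metis assms bounded_linear_Blinfun_apply fderiv_def frechet_derivative_works
      has_derivative_bounded_linear)

lemma fderiv_apply:
  "f differentiable (at x) \<Longrightarrow> blinfun_apply (fderiv f x) = frechet_derivative f (at x)"
  by (metis fderiv_works frechet_derivative_at)

lemma fderiv_unique: "(f has_derivative f') (at x) \<Longrightarrow> blinfun_apply (fderiv f x) = f'"
  by (metis differentiableI fderiv_apply frechet_derivative_at)

text \<open>Both functions have the same derivatives at \<open>x\<close>, and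
  \<open>frechet_derivative\<close> chooses among these; so the equality holds even where no
  derivative exists.\<close>

lemma frechet_derivative_cong_open:
  assumes "open U" "x \<in> U" "\<And>y. y \<in> U \<Longrightarrow> f y = g y"
  shows "frechet_derivative f (at x) = frechet_derivative g (at x)"
proof -
  have "(f has_derivative D) (at x) \<longleftrightarrow> (g has_derivative D) (at x)" for D
    using has_derivative_transform_within_open[OF _ assms(1,2)] assms(3) by metis
  then show ?thesis unfolding frechet_derivative_def by simp
qed

lemma fderiv_cong_open:
  assumes "open U" "x \<in> U" "\<And>y. y \<in> U \<Longrightarrow> f y = g y"
  shows "fderiv f x = fderiv g x"
  unfolding fderiv_def using frechet_derivative_cong_open[OF assms] by simp

lemma differentiable_cong_open:
  assumes "open U" "x \<in> U" "\<And>y. y \<in> U \<Longrightarrow> f y = g y"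
  shows "f differentiable (at x) \<longleftrightarrow> g differentiable (at x)"
  using has_derivative_transform_within_open[OF _ assms(1,2)] assms(3)
  unfolding differentiable_def by metis

section \<open>Calculus of k times differentiable maps\<close>

lemma Ck_on_cong:
  assumes "open U" "\<And>y. y \<in> U \<Longrightarrow> f y = g y" "Ck_on k U f"
  shows "Ck_on k U g"
  using assms(2,3)
proof (induction k arbitrary: f g)
  case 0
  then show ?case by (auto cong: continuous_on_cong)
next
  case (Suc k)
  have "\<forall>x\<in>U. g differentiable (at x)"
    using Suc.prems differentiable_cong_open[OF assms(1)] by (metis Ck_on.simps(2))
  moreover have "Ck_on k U (\<lambda>x. frechet_derivative g (at x) v)" for v
  proof (rule Suc.IH[where f = "\<lambda>x. frechet_derivative f (at x) v"])
    show "frechet_derivative f (at y) v = frechet_derivative g (at y) v" if "y \<in> U" for y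
      using frechet_derivative_cong_open[OF assms(1) that Suc.prems(1)] by simp
  qed (use Suc.prems(2) in simp)
  ultimately show ?case by simp
qed

lemma Ck_on_subset: "Ck_on k U f \<Longrightarrow> V \<subseteq> U \<Longrightarrow> Ck_on k V f"
  by (induction k arbitrary: f) (auto intro: continuous_on_subset)

lemma Ck_on_differentiable: "Ck_on (Suc k) U f \<Longrightarrow> x \<in> U \<Longrightarrow> f differentiable (at x)"
  by simp

lemma Ck_on_Suc: "Ck_on (Suc k) U f \<Longrightarrow> Ck_on k U f"
proof (induction k arbitrary: f)
  case 0
  then show ?case
    by (auto intro!: continuous_at_imp_continuous_on differentiable_imp_continuous_within)
next
  case (Suc k)
  then show ?case by (metis Ck_on.simps(2))
qed

lemma Ck_on_continuous: "Ck_on k U f \<Longrightarrow> continuous_on U f"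
proof (induction k)
  case (Suc k)
  then show ?case by (blast dest: Ck_on_Suc)
qed simp

text \<open>\<open>Ck_on\<close> asks for derivatives at points of the full space, not within the
  set, so it can be tested on neighbourhoods.\<close>

lemma Ck_on_locally:
  assumes "\<And>x. x \<in> U \<Longrightarrow> \<exists>V. open V \<and> x \<in> V \<and> Ck_on k V f"
  shows "Ck_on k U f"
  using assms
proof (induction k arbitrary: f)
  case 0
  then show ?case
    by (metis (mono_tags) Ck_on.simps(1) continuous_at_imp_continuous_on continuous_on_eq_continuous_at)
next
  case (Suc k)
  have "f differentiable (at x)" if "x \<in> U" for x
    using Suc.prems[OF that] Ck_on_differentiable by blast
  moreover have "Ck_on k U (\<lambda>x. frechet_derivative f (at x) v)" for v
  proof (rule Suc.IH)
    fix x assume "x \<in> U"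
    then obtain V where "open V" "x \<in> V" "Ck_on (Suc k) V f" using Suc.prems by blast
    then show "\<exists>V. open V \<and> x \<in> V \<and> Ck_on k V (\<lambda>x. frechet_derivative f (at x) v)"
      by (intro exI[of _ V]) simp
  qed
  ultimately show ?case by simp
qed

text \<open>Lets an induction on k work with an explicit formula for the derivative that agrees with
  \<open>frechet_derivative\<close> only on \<open>U\<close>.\<close>

lemma Ck_on_SucI:
  assumes "open U" "\<And>x. x \<in> U \<Longrightarrow> (f has_derivative f' x) (at x)" "\<And>v. Ck_on k U (\<lambda>x. f' x v)"
  shows "Ck_on (Suc k) U f"
proof -
  have "Ck_on k U (\<lambda>x. frechet_derivative f (at x) v)" for v
  proof (rule Ck_on_cong[OF assms(1) _ assms(3)])
    show "f' y v = frechet_derivative f (at y) v" if "y \<in> U" for y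
      using frechet_derivative_at[OF assms(2)[OF that]] by simp
  qed
  moreover have "\<forall>x\<in>U. f differentiable (at x)"
    using assms(2) unfolding differentiable_def by blast
  ultimately show ?thesis by simp
qed

lemma Ck_on_SucD:
  assumes "Ck_on (Suc k) U f" "x \<in> U"
  shows "(f has_derivative frechet_derivative f (at x)) (at x)"
  using assms frechet_derivative_works by (metis Ck_on.simps(2))

lemma Ck_on_const: "Ck_on k U (\<lambda>x. c)"
  by (induction k arbitrary: c) simp_all

lemma Ck_on_bounded_linear:
  assumes "bounded_linear T" "open U" "Ck_on k U f"
  shows "Ck_on k U (\<lambda>x. T (f x))"
  using assms(3)
proof (induction k arbitrary: f)
  case 0
  then show ?case by (auto intro: bounded_linear.continuous_on[OF assms(1)])
next
  case (Suc k)
  show ?case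
  proof (rule Ck_on_SucI[OF assms(2)])
    show "((\<lambda>x. T (f x)) has_derivative (\<lambda>v. T (frechet_derivative f (at x) v))) (at x)"
      if "x \<in> U" for x
      using bounded_linear.has_derivative[OF assms(1) Ck_on_SucD[OF Suc.prems that]] .
  qed (use Suc in auto)
qed

lemma Ck_on_add:
  assumes "open U" "Ck_on k U f" "Ck_on k U g"
  shows "Ck_on k U (\<lambda>x. f x + g x)"
  using assms(2,3)
proof (induction k arbitrary: f g)
  case 0
  then show ?case by (auto intro: continuous_intros)
next
  case (Suc k)
  show ?case
  proof (rule Ck_on_SucI[OF assms(1)])
    show "((\<lambda>x. f x + g x) has_derivative
      (\<lambda>v. frechet_derivative f (at x) v + frechet_derivative g (at x) v)) (at x)" if "x \<in> U" for x
      using has_derivative_add[OF Ck_on_SucD[OF Suc.prems(1) that] Ck_on_SucD[OF Suc.prems(2) that]] .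
  qed (use Suc in auto)
qed

lemma Ck_on_sum:
  assumes "open U" "\<And>i. i \<in> I \<Longrightarrow> Ck_on k U (f i)"
  shows "Ck_on k U (\<lambda>x. \<Sum>i\<in>I. f i x)"
  using assms(2)
proof (induction I rule: infinite_finite_induct)
  case (insert i I)
  then show ?case using Ck_on_add[OF assms(1), of k "f i" "\<lambda>x. \<Sum>i\<in>I. f i x"] by simp
qed (simp_all add: Ck_on_const)

lemma Ck_on_bilinear:
  assumes "bounded_bilinear pr" "open U" "Ck_on k U f" "Ck_on k U g"
  shows "Ck_on k U (\<lambda>x. pr (f x) (g x))"
  using assms(3,4)
proof (induction k arbitrary: f g)
  case 0
  then show ?case by (auto intro: bounded_bilinear.continuous_on[OF assms(1)])
next
  case (Suc k)
  show ?case
  proof (rule Ck_on_SucI[OF assms(2)])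
    show "((\<lambda>x. pr (f x) (g x)) has_derivative
      (\<lambda>v. pr (f x) (frechet_derivative g (at x) v) + pr (frechet_derivative f (at x) v) (g x))) (at x)"
      if "x \<in> U" for x
      using bounded_bilinear.FDERIV[OF assms(1) Ck_on_SucD[OF Suc.prems(1) that] Ck_on_SucD[OF Suc.prems(2) that]] .
  next
    fix v
    have "Ck_on k U f" "Ck_on k U g" using Suc.prems by (blast dest: Ck_on_Suc)+
    then show "Ck_on k U (\<lambda>x. pr (f x) (frechet_derivative g (at x) v) + pr (frechet_derivative f (at x) v) (g x))"
      using Suc.prems by (intro Ck_on_add[OF assms(2)] Suc.IH) auto
  qed
qed

text \<open>In the chain rule the direction in which \<open>g\<close> is differentiated moves with
  the point, whereas \<open>Ck_on\<close> controls derivatives in fixed directions only. Expanding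
  that direction in \<open>fbasis\<close> gives a finite sum of products to which the induction
  hypothesis applies.\<close>

lemma Ck_on_compose:
  fixes f :: "'a::real_normed_vector \<Rightarrow> 'b::finite_dim_inner"
  assumes "open U" "open V" "f ` U \<subseteq> V" "Ck_on k U f" "Ck_on k V g"
  shows "Ck_on k U (\<lambda>x. g (f x))"
  using assms(4,5)
proof (induction k arbitrary: g)
  case 0
  then show ?case using assms(3) by (auto intro: continuous_on_compose2)
next
  case (Suc k)
  let ?D = "\<lambda>x. \<lambda>v. \<Sum>b\<in>fbasis. (frechet_derivative f (at x) v \<bullet> b) *\<^sub>R frechet_derivative g (at (f x)) b"
  show ?case
  proof (rule Ck_on_SucI[OF assms(1)])
    show "((\<lambda>x. g (f x)) has_derivative ?D x) (at x)" if "x \<in> U" for x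
    proof -
      have g: "(g has_derivative frechet_derivative g (at (f x))) (at (f x))"
        using Suc.prems(2) assms(3) that Ck_on_SucD by blast
      have "((\<lambda>x. g (f x)) has_derivative (\<lambda>v. frechet_derivative g (at (f x)) (frechet_derivative f (at x) v))) (at x)"
        using has_derivative_compose[OF Ck_on_SucD[OF Suc.prems(1) that] g] .
      moreover have "?D x = (\<lambda>v. frechet_derivative g (at (f x)) (frechet_derivative f (at x) v))"
        by (rule ext) (rule linear_fbasis_expansion[OF has_derivative_linear[OF g], symmetric])
      ultimately show ?thesis by simp
    qed
  next
    fix v
    have "Ck_on k U (\<lambda>x. frechet_derivative g (at (f x)) b)" for b
      using Suc.IH[of "\<lambda>y. frechet_derivative g (at y) b"] Ck_on_Suc[OF Suc.prems(1)] Suc.prems(2) by auto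
    moreover have "Ck_on k U (\<lambda>x. frechet_derivative f (at x) v \<bullet> b)" for b
      using Suc.prems by (intro Ck_on_bounded_linear[OF bounded_linear_inner_left assms(1)]) simp
    ultimately show "Ck_on k U (\<lambda>x. ?D x v)"
      by (intro Ck_on_sum[OF assms(1)] Ck_on_bilinear[OF bounded_bilinear_scaleR assms(1)])
  qed
qed

lemma blinfun_fbasis_expansion:
  fixes T :: "'a::finite_dim_inner \<Rightarrow>\<^sub>L 'b::real_normed_vector"
  shows "T = (\<Sum>b\<in>fbasis. blinfun_scaleR_left (T b) o\<^sub>L blinfun_inner_left b)"
proof (rule blinfun_eqI)
  fix x
  show "T x = (\<Sum>b\<in>fbasis. blinfun_scaleR_left (T b) o\<^sub>L blinfun_inner_left b) x"
    using linear_fbasis_expansion[OF bounded_linear.linear[OF blinfun.bounded_linear_right], of T x]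
    by (simp add: blinfun.sum_left)
qed

text \<open>An operator on a finite-dimensional space is a finite sum of terms, each depending
  linearly and continuously on one of its values. Regularity of the values therefore gives
  regularity in the operator norm.\<close>

lemma Ck_on_blinfunI:
  fixes f :: "'c::real_normed_vector \<Rightarrow> 'a::finite_dim_inner \<Rightarrow>\<^sub>L 'b::real_normed_vector"
  assumes "open U" "\<And>v. Ck_on k U (\<lambda>x. f x v)"
  shows "Ck_on k U f"
proof -
  have "bounded_linear (\<lambda>w::'b. blinfun_scaleR_left w o\<^sub>L blinfun_inner_left b)" for b :: 'a
    by (intro bounded_linear_intros)
  then have "Ck_on k U (\<lambda>x. \<Sum>b\<in>fbasis. blinfun_scaleR_left (f x b) o\<^sub>L blinfun_inner_left b)"
    using assms by (intro Ck_on_sum) (auto intro: Ck_on_bounded_linear)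
  then show ?thesis
    by (rule Ck_on_cong[OF assms(1), rotated]) (simp add: blinfun_fbasis_expansion[symmetric])
qed

text \<open>Everything rests on the identity \<open>diff\<close>. It gives continuity of
  \<open>G\<close>, then the derivative \<open>- G g' G\<close>, which is again built from
  \<open>G\<close> and the derivative of \<open>g\<close>, so that an induction on k closes.\<close>

lemma Ck_on_blinfun_inverse:
  fixes g :: "'c::real_normed_vector \<Rightarrow> 'a::real_normed_vector \<Rightarrow>\<^sub>L 'a"
  assumes U: "open U" and g: "Ck_on k U g"
    and inv: "\<And>x. x \<in> U \<Longrightarrow> G x o\<^sub>L g x = id_blinfun" "\<And>x. x \<in> U \<Longrightarrow> g x o\<^sub>L G x = id_blinfun"
  shows "Ck_on k U G"
proof -
  have diff: "G y - G x = - (G y o\<^sub>L ((g y - g x) o\<^sub>L G x))" if "x \<in> U" "y \<in> U" for x y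
  proof -
    have "G y o\<^sub>L ((g y - g x) o\<^sub>L G x) = ((G y o\<^sub>L g y) o\<^sub>L G x) - (G y o\<^sub>L (g x o\<^sub>L G x))"
      by (rule blinfun_eqI) (simp add: blinfun.diff_left blinfun.diff_right)
    also have "\<dots> = G x - G y"
      unfolding inv(1)[OF that(2)] inv(2)[OF that(1)] by (rule blinfun_eqI) (simp add: blinfun.diff_left)
    finally show ?thesis by simp
  qed
  have cont: "continuous_on U G"
  proof -
    have "isCont G x" if x: "x \<in> U" for x
    proof -
      have gx: "isCont g x" using Ck_on_continuous[OF g] U x continuous_on_eq_continuous_at by blast
      define h where "h = (\<lambda>y. norm (g y - g x) * norm (G x))"
      have h0: "(h \<longlongrightarrow> 0) (at x)"
      proof -
        have "(h \<longlongrightarrow> norm (g x - g x) * norm (G x)) (at x)"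
          unfolding h_def by (intro tendsto_intros gx[unfolded isCont_def])
        then show ?thesis by simp
      qed
      \<comment> \<open>Once \<open>h y\<close> is below 1/2, the estimate for the difference can be
        absorbed and bounds the norm of \<open>G y\<close> by twice that of \<open>G x\<close>; this
        replaces an a priori local bound on \<open>G\<close>.\<close>
      have ev: "eventually (\<lambda>y. norm (G y - G x) \<le> 2 * norm (G x) * h y) (at x)"
      proof -
        have 1: "eventually (\<lambda>y. h y < 1/2) (at x)" using order_tendstoD(2)[OF h0, of "1/2"] by simp
        have 2: "eventually (\<lambda>y. y \<in> U) (at x)" using U x eventually_at_topological by blast
        show ?thesis using 1 2
        proof eventually_elim
          case (elim y)
          have *: "norm (G y - G x) \<le> norm (G y) * h y"
          proof -
            have "norm (G y - G x) \<le> norm (G y) * norm ((g y - g x) o\<^sub>L G x)"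
              by (simp add: diff[OF x elim(2)] norm_blinfun_compose)
            also have "\<dots> \<le> norm (G y) * h y"
              unfolding h_def by (intro mult_left_mono norm_blinfun_compose) simp
            finally show ?thesis .
          qed
          have "norm (G y) \<le> norm (G x) + norm (G y - G x)" by (metis add.commute diff_add_cancel norm_triangle_ineq)
          moreover have "norm (G y) * h y \<le> norm (G y) * (1/2)"
            using elim by (intro mult_left_mono) auto
          ultimately have "norm (G y) \<le> 2 * norm (G x)" using * by linarith
          moreover have "h y \<ge> 0" by (simp add: h_def)
          ultimately show ?case using * by (meson mult_right_mono order_trans)
        qed
      qed
      have "((\<lambda>y. 2 * norm (G x) * h y) \<longlongrightarrow> 2 * norm (G x) * 0) (at x)"
        by (intro tendsto_intros h0)
      then have "((\<lambda>y. G y - G x) \<longlongrightarrow> 0) (at x)"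
        using Lim_null_comparison[OF ev] by simp
      then show ?thesis by (simp add: isCont_def Lim_null[of G])
    qed
    then show ?thesis by (simp add: continuous_at_imp_continuous_on)
  qed
  have der: "(G has_derivative (\<lambda>v. - (G x o\<^sub>L (frechet_derivative g (at x) v o\<^sub>L G x)))) (at x)"
    if x: "x \<in> U" and gx: "g differentiable (at x)" for x
  proof -
    let ?g' = "frechet_derivative g (at x)"
    have g': "(g has_derivative ?g') (at x)" using gx frechet_derivative_works by blast
    define E where "E = (\<lambda>y. (g y - g x - ?g' (y - x)) /\<^sub>R norm (y - x))"
    have E0: "(E \<longlongrightarrow> 0) (at x)" using g' by (simp add: has_derivative_at_within E_def)
    have bl: "bounded_linear ?g'" using g' has_derivative_bounded_linear by blast
    then obtain C where C: "\<And>v. norm (?g' v) \<le> norm v * C" using bounded_linear.bounded by blast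
    \<comment> \<open>By \<open>diff\<close>, the error of the linear approximation splits in two:
      \<open>R\<close> stems from the remainder \<open>E\<close> of \<open>g\<close>, and
      \<open>F\<close> from replacing \<open>G y\<close> by \<open>G x\<close> in front of the
      linear term.\<close>
    define R where "R = (\<lambda>y. - (G y o\<^sub>L (E y o\<^sub>L G x)))"
    define F where "F = (\<lambda>y. - ((G y - G x) o\<^sub>L ((?g' (y - x) /\<^sub>R norm (y - x)) o\<^sub>L G x)))"
    have cG: "(G \<longlongrightarrow> G x) (at x)" using cont U x continuous_on_eq_continuous_at isCont_def by blast
    have "(R \<longlongrightarrow> - (G x o\<^sub>L (0 o\<^sub>L G x))) (at x)"
      unfolding R_def by (intro tendsto_intros cG E0 bounded_bilinear.tendsto[OF bounded_bilinear_blinfun_compose])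
    then have R0: "(R \<longlongrightarrow> 0) (at x)" by (simp add: bounded_bilinear.zero_left bounded_bilinear.zero_right bounded_bilinear_blinfun_compose)
    have F0: "(F \<longlongrightarrow> 0) (at x)"
    proof (rule Lim_null_comparison)
      show "eventually (\<lambda>y. norm (F y) \<le> norm (G y - G x) * (\<bar>C\<bar> * norm (G x))) (at x)"
      proof (rule always_eventually, rule allI)
        fix y
        have "norm (?g' (y - x) /\<^sub>R norm (y - x)) \<le> \<bar>C\<bar>"
        proof (cases "y = x")
          case True
          then show ?thesis by simp
        next
          case False
          have "norm (?g' (y - x)) \<le> norm (y - x) * \<bar>C\<bar>"
            by (meson C abs_ge_self mult_left_mono norm_ge_zero order_trans)
          then show ?thesis using False by (simp add: divide_simps mult.commute)
        qed
        then have "norm ((?g' (y - x) /\<^sub>R norm (y - x)) o\<^sub>L G x) \<le> \<bar>C\<bar> * norm (G x)"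
          by (meson mult_right_mono norm_blinfun_compose norm_ge_zero order_trans)
        then show "norm (F y) \<le> norm (G y - G x) * (\<bar>C\<bar> * norm (G x))"
          unfolding F_def norm_minus_cancel
          by (meson mult_left_mono norm_blinfun_compose norm_ge_zero order_trans)
      qed
      have "((\<lambda>y. norm (G y - G x) * (\<bar>C\<bar> * norm (G x))) \<longlongrightarrow> norm (G x - G x) * (\<bar>C\<bar> * norm (G x))) (at x)"
        by (intro tendsto_intros cG)
      then show "((\<lambda>y. norm (G y - G x) * (\<bar>C\<bar> * norm (G x))) \<longlongrightarrow> 0) (at x)" by simp
    qed
    have "((\<lambda>y. (G y - G x - (- (G x o\<^sub>L (?g' (y - x) o\<^sub>L G x)))) /\<^sub>R norm (y - x)) \<longlongrightarrow> 0) (at x)"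
    proof (rule Lim_transform_eventually)
      show "((\<lambda>y. R y + F y) \<longlongrightarrow> 0) (at x)" using tendsto_add[OF R0 F0] by simp
      have "eventually (\<lambda>y. y \<in> U) (at x)" using U x eventually_at_topological by blast
      then show "eventually (\<lambda>y. R y + F y =
        (G y - G x - (- (G x o\<^sub>L (?g' (y - x) o\<^sub>L G x)))) /\<^sub>R norm (y - x)) (at x)"
      proof eventually_elim
        case (elim y)
        show ?case unfolding R_def F_def E_def
          by (subst (2) diff[OF x elim], rule blinfun_eqI)
            (simp add: blinfun.bilinear_simps algebra_simps)
      qed
    qed
    moreover have "bounded_linear (\<lambda>v. - (G x o\<^sub>L (?g' v o\<^sub>L G x)))"
      using bl by (intro bounded_linear_minus
          bounded_linear_compose[OF bounded_bilinear.bounded_linear_right[OF bounded_bilinear_blinfun_compose]]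
          bounded_linear_compose[OF bounded_bilinear.bounded_linear_left[OF bounded_bilinear_blinfun_compose]])
    ultimately show ?thesis by (simp add: has_derivative_at_within)
  qed
  show ?thesis using g
  proof (induction k)
    case 0
    then show ?case using cont by simp
  next
    case (Suc k)
    show ?case
    proof (rule Ck_on_SucI[OF U])
      show "(G has_derivative (\<lambda>v. - (G x o\<^sub>L (frechet_derivative g (at x) v o\<^sub>L G x)))) (at x)" if "x \<in> U" for x
        using der[OF that] Suc.prems that by simp
      have "Ck_on k U G" using Suc Ck_on_Suc by blast
      then show "Ck_on k U (\<lambda>x. - (G x o\<^sub>L (frechet_derivative g (at x) v o\<^sub>L G x)))" for v
        using Suc.prems
        by (intro Ck_on_bounded_linear[OF bounded_linear_minus[OF bounded_linear_ident] U]
            Ck_on_bilinear[OF bounded_bilinear_blinfun_compose U]) auto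
    qed
  qed
qed


section \<open>Closure properties of smooth maps\<close>

lemma smooth_on_cong: "open U \<Longrightarrow> (\<And>y. y \<in> U \<Longrightarrow> f y = g y) \<Longrightarrow> smooth_on U f \<Longrightarrow> smooth_on U g"
  unfolding smooth_on_def using Ck_on_cong[of U f g] by blast

lemma smooth_on_subset: "smooth_on U f \<Longrightarrow> V \<subseteq> U \<Longrightarrow> smooth_on V f"
  unfolding smooth_on_def using Ck_on_subset by blast

lemma smooth_on_continuous: "smooth_on U f \<Longrightarrow> continuous_on U f"
  unfolding smooth_on_def using Ck_on_continuous by blast

lemma smooth_on_differentiable: "smooth_on U f \<Longrightarrow> x \<in> U \<Longrightarrow> f differentiable (at x)"
  unfolding smooth_on_def using Ck_on_differentiable by blast

lemma smooth_on_locally: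
  assumes "\<And>x. x \<in> U \<Longrightarrow> \<exists>V. open V \<and> x \<in> V \<and> smooth_on V f"
  shows "smooth_on U f"
  unfolding smooth_on_def
proof (intro allI Ck_on_locally)
  fix k x assume "x \<in> U"
  with assms show "\<exists>V. open V \<and> x \<in> V \<and> Ck_on k V f" unfolding smooth_on_def by blast
qed

lemma smooth_on_const: "smooth_on U (\<lambda>x. c)"
  unfolding smooth_on_def by (simp add: Ck_on_const)

lemma smooth_on_bounded_linear:
  "bounded_linear T \<Longrightarrow> open U \<Longrightarrow> smooth_on U f \<Longrightarrow> smooth_on U (\<lambda>x. T (f x))"
  unfolding smooth_on_def by (simp add: Ck_on_bounded_linear)

lemma smooth_on_ident: "open U \<Longrightarrow> smooth_on U (\<lambda>x. x)"
  unfolding smooth_on_def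
proof
  fix k assume U: "open U"
  show "Ck_on k U (\<lambda>x. x)"
  proof (cases k)
    case (Suc j)
    show ?thesis unfolding Suc
      by (rule Ck_on_SucI[OF U, where f' = "\<lambda>x v. v"]) (simp_all add: Ck_on_const)
  qed (simp add: continuous_on_id)
qed

lemma smooth_on_add:
  "open U \<Longrightarrow> smooth_on U f \<Longrightarrow> smooth_on U g \<Longrightarrow> smooth_on U (\<lambda>x. f x + g x)"
  unfolding smooth_on_def by (simp add: Ck_on_add)

lemma smooth_on_sum:
  "open U \<Longrightarrow> (\<And>i. i \<in> I \<Longrightarrow> smooth_on U (f i)) \<Longrightarrow> smooth_on U (\<lambda>x. \<Sum>i\<in>I. f i x)"
  unfolding smooth_on_def by (simp add: Ck_on_sum)

lemma smooth_on_bilinear: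
  "bounded_bilinear pr \<Longrightarrow> open U \<Longrightarrow> smooth_on U f \<Longrightarrow> smooth_on U g \<Longrightarrow>
    smooth_on U (\<lambda>x. pr (f x) (g x))"
  unfolding smooth_on_def by (simp add: Ck_on_bilinear)

lemmas smooth_on_scaleR = smooth_on_bilinear[OF bounded_bilinear_scaleR]
lemmas smooth_on_blinfun_apply = smooth_on_bilinear[OF bounded_bilinear_blinfun_apply]
lemmas smooth_on_blinfun_compose = smooth_on_bilinear[OF bounded_bilinear_blinfun_compose]

lemma smooth_on_diff:
  assumes "open U" "smooth_on U f" "smooth_on U g"
  shows "smooth_on U (\<lambda>x. f x - g x)"
  using smooth_on_add[OF assms(1,2) smooth_on_bounded_linear[OF bounded_linear_minus[OF bounded_linear_ident] assms(1,3)]]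
  by simp

lemma smooth_on_compose:
  fixes f :: "'a::real_normed_vector \<Rightarrow> 'b::finite_dim_inner"
  assumes "open U" "open V" "f ` U \<subseteq> V" "smooth_on U f" "smooth_on V g"
  shows "smooth_on U (\<lambda>x. g (f x))"
  unfolding smooth_on_def
proof
  show "Ck_on k U (\<lambda>x. g (f x))" for k
    by (rule Ck_on_compose[OF assms(1-3)]) (use assms(4,5) in \<open>simp_all add: smooth_on_def\<close>)
qed

lemma smooth_on_frechet_derivative:
  "smooth_on U f \<Longrightarrow> smooth_on U (\<lambda>x. frechet_derivative f (at x) v)"
  unfolding smooth_on_def by (metis Ck_on.simps(2))

lemma smooth_on_blinfunI:
  fixes f :: "'c::real_normed_vector \<Rightarrow> 'a::finite_dim_inner \<Rightarrow>\<^sub>L 'b::real_normed_vector"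
  assumes "open U" "\<And>v. smooth_on U (\<lambda>x. f x v)"
  shows "smooth_on U f"
  unfolding smooth_on_def
proof
  show "Ck_on k U f" for k
    using assms(2) by (intro Ck_on_blinfunI[OF assms(1)]) (simp add: smooth_on_def)
qed

lemma smooth_on_fderiv:
  fixes f :: "'a::finite_dim_inner \<Rightarrow> 'b::real_normed_vector"
  assumes U: "open U" and f: "smooth_on U f"
  shows "smooth_on U (fderiv f)"
proof (rule smooth_on_blinfunI[OF U])
  fix v
  show "smooth_on U (\<lambda>x. fderiv f x v)"
    by (rule smooth_on_cong[OF U _ smooth_on_frechet_derivative[OF f, of v]])
      (simp add: fderiv_apply[OF smooth_on_differentiable[OF f]])
qed

lemma smooth_on_blinfun_inverse:
  fixes g :: "'c::real_normed_vector \<Rightarrow> 'a::real_normed_vector \<Rightarrow>\<^sub>L 'a"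
  assumes "open U" "smooth_on U g"
    and "\<And>x. x \<in> U \<Longrightarrow> G x o\<^sub>L g x = id_blinfun" "\<And>x. x \<in> U \<Longrightarrow> g x o\<^sub>L G x = id_blinfun"
  shows "smooth_on U G"
  unfolding smooth_on_def
proof
  show "Ck_on k U G" for k
    by (rule Ck_on_blinfun_inverse[OF assms(1) _ assms(3,4)]) (use assms(2) in \<open>simp add: smooth_on_def\<close>)
qed

section \<open>Symmetry of the second derivative\<close>

text \<open>The mean value inequality in s, on the interval from 0 to t, for the increment of
  \<open>f\<close> along t w at the point x + s v, corrected by its expected value s t A w. The
  derivative of this function is small because the directional derivative of \<open>f\<close> along
  v is nearly affine close to \<open>x\<close>.\<close>

lemma second_difference_estimate:
  fixes f :: "'a::real_normed_vector \<Rightarrow> 'b::real_normed_vector"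
  assumes U: "open U" "x \<in> U" and f: "\<And>y. y \<in> U \<Longrightarrow> f differentiable (at y)"
    and A: "((\<lambda>y. frechet_derivative f (at y) v) has_derivative A) (at x)"
    and \<epsilon>: "\<epsilon> > 0"
  shows "\<exists>\<delta>>0. \<forall>t. 0 < t \<and> t < \<delta> \<longrightarrow>
    norm (f (x + t *\<^sub>R v + t *\<^sub>R w) - f (x + t *\<^sub>R v) - f (x + t *\<^sub>R w) + f x - t\<^sup>2 *\<^sub>R A w) \<le> \<epsilon> * t\<^sup>2"
proof -
  let ?g = "\<lambda>y. frechet_derivative f (at y) v"
  \<comment> \<open>For s between 0 and t the norms of s v + t w and of s v add up to at most t
    times \<open>c\<close>; the summand 1 keeps \<open>c\<close> positive.\<close>
  define c where "c = 2 * norm v + norm w + 1"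
  have c: "c > 0" unfolding c_def by (simp add: add_nonneg_pos)
  have "\<epsilon> / c > 0" using \<epsilon> c by simp
  then obtain d1 where d1: "d1 > 0"
    "\<And>y. norm (y - x) < d1 \<Longrightarrow> norm (?g y - ?g x - A (y - x)) \<le> \<epsilon> / c * norm (y - x)"
    using A unfolding has_derivative_at_alt by blast
  obtain d2 where d2: "d2 > 0" "ball x d2 \<subseteq> U" using U open_contains_ball by blast
  interpret A: bounded_linear A using A has_derivative_bounded_linear by blast
  define \<delta> where "\<delta> = min d1 d2 / c"
  have \<delta>: "\<delta> > 0" using d1 d2 c by (simp add: \<delta>_def)
  show ?thesis
  proof (intro exI[of _ \<delta>] conjI allI impI \<delta>)
    fix t :: real assume t: "0 < t \<and> t < \<delta>"
    have tc: "t * c < d1" "t * c < d2" using t c by (auto simp: \<delta>_def field_simps)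
    have dist_add: "dist x (x + a) = norm a" for a by (simp add: dist_norm)
    have small: "norm (s *\<^sub>R v) \<le> t * norm v" "norm (s *\<^sub>R v + t *\<^sub>R w) \<le> t * (norm v + norm w)"
      if "s \<in> {0..t}" for s
    proof -
      show 1: "norm (s *\<^sub>R v) \<le> t * norm v" using that by (simp add: mult_right_mono)
      show "norm (s *\<^sub>R v + t *\<^sub>R w) \<le> t * (norm v + norm w)"
        using norm_triangle_ineq[of "s *\<^sub>R v" "t *\<^sub>R w"] 1 t by (simp add: algebra_simps)
    qed
    have lt: "t * norm v < t * c" "t * (norm v + norm w) < t * c"
      using t by (auto simp: c_def add_nonneg_pos)
    have near: "norm (s *\<^sub>R v) < d1" "norm (s *\<^sub>R v + t *\<^sub>R w) < d1"
      "x + s *\<^sub>R v \<in> U" "x + s *\<^sub>R v + t *\<^sub>R w \<in> U" if "s \<in> {0..t}" for s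
    proof -
      show "norm (s *\<^sub>R v) < d1" "norm (s *\<^sub>R v + t *\<^sub>R w) < d1" using small[OF that] lt tc by linarith+
      have "norm (s *\<^sub>R v) < d2" "norm (s *\<^sub>R v + t *\<^sub>R w) < d2" using small[OF that] lt tc by linarith+
      then have "x + s *\<^sub>R v \<in> ball x d2" "x + (s *\<^sub>R v + t *\<^sub>R w) \<in> ball x d2"
        by (simp_all only: mem_ball dist_add)
      then show "x + s *\<^sub>R v \<in> U" "x + s *\<^sub>R v + t *\<^sub>R w \<in> U" using d2 by (auto simp: add.assoc)
    qed
    define u where "u = (\<lambda>s. f (x + s *\<^sub>R v + t *\<^sub>R w) - f (x + s *\<^sub>R v) - s *\<^sub>R t *\<^sub>R A w)"
    define u' where "u' = (\<lambda>s. ?g (x + s *\<^sub>R v + t *\<^sub>R w) - ?g (x + s *\<^sub>R v) - t *\<^sub>R A w)"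
    have der: "(u has_derivative (\<lambda>h. h *\<^sub>R u' s)) (at s within {0..t})" if s: "s \<in> {0..t}" for s
    proof -
      have *: "((\<lambda>s. f (p + s *\<^sub>R v)) has_derivative (\<lambda>h. h *\<^sub>R ?g (p + s *\<^sub>R v))) (at s within {0..t})"
        if "p + s *\<^sub>R v \<in> U" for p
      proof -
        have D: "(f has_derivative frechet_derivative f (at (p + s *\<^sub>R v))) (at (p + s *\<^sub>R v))"
          using f[OF that] frechet_derivative_works by blast
        have "((\<lambda>s. p + s *\<^sub>R v) has_derivative (\<lambda>h. h *\<^sub>R v)) (at s within {0..t})"
          by (auto intro!: derivative_eq_intros)
        from has_derivative_compose[OF this D] show ?thesis
          by (simp add: linear_scale[OF has_derivative_linear[OF D]])
      qed
      have 1: "((\<lambda>s. f (x + s *\<^sub>R v + t *\<^sub>R w)) has_derivative (\<lambda>h. h *\<^sub>R ?g (x + s *\<^sub>R v + t *\<^sub>R w))) (at s within {0..t})"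
        using *[of "x + t *\<^sub>R w"] near(4)[OF s] by (simp add: algebra_simps)
      show ?thesis unfolding u_def u'_def
        using has_derivative_diff[OF has_derivative_diff[OF 1 *[of x, OF near(3)[OF s]]]
            has_derivative_scaleR_left[OF has_derivative_ident, of "t *\<^sub>R A w"]]
        by (simp add: algebra_simps)
    qed
    have bound: "onorm (\<lambda>h. h *\<^sub>R u' s) \<le> \<epsilon> * t" if s: "s \<in> {0..t}" for s
    proof -
      have "u' s = (?g (x + s *\<^sub>R v + t *\<^sub>R w) - ?g x - A (s *\<^sub>R v + t *\<^sub>R w)) - (?g (x + s *\<^sub>R v) - ?g x - A (s *\<^sub>R v))"
        by (simp add: u'_def A.add A.scaleR)
      have "norm (u' s) \<le> \<epsilon> / c * norm (s *\<^sub>R v + t *\<^sub>R w) + \<epsilon> / c * norm (s *\<^sub>R v)"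
      proof -
        have "norm (?g (x + s *\<^sub>R v + t *\<^sub>R w) - ?g x - A (s *\<^sub>R v + t *\<^sub>R w)) \<le> \<epsilon> / c * norm (s *\<^sub>R v + t *\<^sub>R w)"
          using d1(2)[of "x + (s *\<^sub>R v + t *\<^sub>R w)"] near(2)[OF s] by (simp only: add_diff_cancel_left' add.assoc)
        moreover have "norm (?g (x + s *\<^sub>R v) - ?g x - A (s *\<^sub>R v)) \<le> \<epsilon> / c * norm (s *\<^sub>R v)"
          using d1(2)[of "x + s *\<^sub>R v"] near(1)[OF s] by (simp only: add_diff_cancel_left')
        ultimately show ?thesis
          unfolding \<open>u' s = _\<close> by (rule order_trans[OF norm_triangle_ineq4 add_mono])
      qed
      also have "\<dots> = \<epsilon> / c * (norm (s *\<^sub>R v + t *\<^sub>R w) + norm (s *\<^sub>R v))" by (simp only: distrib_left)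
      also have "\<dots> \<le> \<epsilon> / c * (t * c)"
      proof (rule mult_left_mono)
        have "t * c = t * (norm v + norm w) + t * norm v + t" by (simp add: c_def algebra_simps)
        then show "norm (s *\<^sub>R v + t *\<^sub>R w) + norm (s *\<^sub>R v) \<le> t * c" using small[OF s] t by linarith
      qed (use \<epsilon> c in simp)
      also have "\<dots> = \<epsilon> * t" using c by simp
      finally have "norm (u' s) \<le> \<epsilon> * t" .
      then have "norm (h *\<^sub>R u' s) \<le> \<epsilon> * t * norm h" for h
        using mult_left_mono[of "norm (u' s)" "\<epsilon> * t" "norm h"] by (simp add: mult.commute)
      then show ?thesis using t \<epsilon> by (intro onorm_bound) auto
    qed
    have "norm (u t - u 0) \<le> \<epsilon> * t * norm (t - 0)"
      by (rule differentiable_bound[OF _ der bound]) (use t in auto)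
    then show "norm (f (x + t *\<^sub>R v + t *\<^sub>R w) - f (x + t *\<^sub>R v) - f (x + t *\<^sub>R w) + f x - t\<^sup>2 *\<^sub>R A w) \<le> \<epsilon> * t\<^sup>2"
      using t by (simp add: u_def power2_eq_square algebra_simps)
  qed
qed

text \<open>The second difference along v and w is symmetric in the two vectors, and divided by the
  square of t it is close to either mixed derivative.\<close>

lemma second_derivative_symmetric:
  fixes f :: "'a::real_normed_vector \<Rightarrow> 'b::real_normed_vector"
  assumes U: "open U" "x \<in> U" and f: "smooth_on U f"
  shows "frechet_derivative (\<lambda>y. frechet_derivative f (at y) v) (at x) w =
         frechet_derivative (\<lambda>y. frechet_derivative f (at y) w) (at x) v"
proof -
  let ?A = "frechet_derivative (\<lambda>y. frechet_derivative f (at y) v) (at x)"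
  let ?B = "frechet_derivative (\<lambda>y. frechet_derivative f (at y) w) (at x)"
  have fd: "f differentiable (at y)" if "y \<in> U" for y using f that by (rule smooth_on_differentiable)
  have d: "((\<lambda>y. frechet_derivative f (at y) z) has_derivative
      frechet_derivative (\<lambda>y. frechet_derivative f (at y) z) (at x)) (at x)" for z
    using smooth_on_differentiable[OF smooth_on_frechet_derivative[OF f] U(2)] frechet_derivative_works by blast
  have "norm (?A w - ?B v) \<le> \<epsilon>" if "\<epsilon> > 0" for \<epsilon>
  proof -
    have e: "\<epsilon> / 2 > 0" using that by simp
    obtain d1 where d1: "d1 > 0" "\<forall>t. 0 < t \<and> t < d1 \<longrightarrow>
      norm (f (x + t *\<^sub>R v + t *\<^sub>R w) - f (x + t *\<^sub>R v) - f (x + t *\<^sub>R w) + f x - t\<^sup>2 *\<^sub>R ?A w) \<le> \<epsilon> / 2 * t\<^sup>2"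
      using second_difference_estimate[OF U fd d e] by blast
    obtain d2 where d2: "d2 > 0" "\<forall>t. 0 < t \<and> t < d2 \<longrightarrow>
      norm (f (x + t *\<^sub>R w + t *\<^sub>R v) - f (x + t *\<^sub>R w) - f (x + t *\<^sub>R v) + f x - t\<^sup>2 *\<^sub>R ?B v) \<le> \<epsilon> / 2 * t\<^sup>2"
      using second_difference_estimate[OF U fd d e] by blast
    define t where "t = min d1 d2 / 2"
    have t: "0 < t" "t < d1" "t < d2" using d1 d2 by (auto simp: t_def)
    let ?D = "f (x + t *\<^sub>R v + t *\<^sub>R w) - f (x + t *\<^sub>R v) - f (x + t *\<^sub>R w) + f x"
    have D: "f (x + t *\<^sub>R w + t *\<^sub>R v) - f (x + t *\<^sub>R w) - f (x + t *\<^sub>R v) + f x = ?D"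
      by (simp add: algebra_simps)
    have "t\<^sup>2 * norm (?A w - ?B v) = norm (t\<^sup>2 *\<^sub>R (?A w - ?B v))" by simp
    also have "\<dots> = norm ((?D - t\<^sup>2 *\<^sub>R ?B v) - (?D - t\<^sup>2 *\<^sub>R ?A w))"
      by (simp add: algebra_simps)
    also have "\<dots> \<le> norm (?D - t\<^sup>2 *\<^sub>R ?B v) + norm (?D - t\<^sup>2 *\<^sub>R ?A w)" by (rule norm_triangle_ineq4)
    also have "\<dots> \<le> \<epsilon> / 2 * t\<^sup>2 + \<epsilon> / 2 * t\<^sup>2"
      using d1(2)[rule_format, of t] d2(2)[rule_format, of t, unfolded D] t by linarith
    finally have "t\<^sup>2 * norm (?A w - ?B v) \<le> t\<^sup>2 * \<epsilon>" by (simp add: algebra_simps)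
    then show ?thesis using t by simp
  qed
  then have "norm (?A w - ?B v) \<le> 0 + \<epsilon>" if "\<epsilon> > 0" for \<epsilon> using that by simp
  from field_le_epsilon[OF this] have "norm (?A w - ?B v) \<le> 0" .
  then show ?thesis by simp
qed


section \<open>Local inverses and submersions\<close>

text \<open>Solving T x = y amounts to finding a fixed point of the contraction that sends x to y -
  (T - id) x. The inverse is linear, hence bounded in finite dimension.\<close>

lemma blinfun_near_id_invertible:
  fixes T :: "'a::finite_dim_inner \<Rightarrow>\<^sub>L 'a"
  assumes T: "norm (T - id_blinfun) < 1"
  shows "\<exists>S. T o\<^sub>L S = id_blinfun \<and> S o\<^sub>L T = id_blinfun"
proof -
  have ex1: "\<exists>!x. T x = y" for y
  proof -
    have "\<exists>!x\<in>UNIV. y - (T - id_blinfun) x = x"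
    proof (rule Banach_fix)
      show "dist (y - (T - id_blinfun) x) (y - (T - id_blinfun) x') \<le> norm (T - id_blinfun) * dist x x'" for x x'
      proof -
        have "dist (y - (T - id_blinfun) x) (y - (T - id_blinfun) x') = norm ((T - id_blinfun) (x' - x))"
          by (simp add: dist_norm blinfun.diff_right blinfun.diff_left algebra_simps)
        also have "\<dots> \<le> norm (T - id_blinfun) * norm (x' - x)" by (rule norm_blinfun)
        finally show ?thesis by (simp add: dist_norm norm_minus_commute)
      qed
    qed (use T in auto)
    moreover have "y - (T - id_blinfun) x = x \<longleftrightarrow> T x = y" for x
      by (auto simp: blinfun.diff_left algebra_simps)
    ultimately show ?thesis by simp
  qed
  define S where "S = (\<lambda>y. THE x. T x = y)"
  have TS: "T (S y) = y" for y unfolding S_def using theI'[OF ex1] .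
  have ST: "S (T x) = x" for x using ex1[of "T x"] TS[of "T x"] by metis
  have "linear S"
  proof
    show "S (x + y) = S x + S y" for x y using ST[of "S x + S y"] by (simp add: blinfun.add_right TS)
    show "S (r *\<^sub>R x) = r *\<^sub>R S x" for r x using ST[of "r *\<^sub>R S x"] by (simp add: blinfun.scaleR_right TS)
  qed
  then have "bounded_linear S" by (rule linear_imp_bounded_linear)
  then have "blinfun_apply (Blinfun S) = S" by (rule bounded_linear_Blinfun_apply)
  then show ?thesis using TS ST by (intro exI[of _ "Blinfun S"]) (auto intro!: blinfun_eqI)
qed

text \<open>The inverse function theorem, normalised to the identity as derivative;
  \<open>submersion_straightening\<close> arranges this normalisation. On a small ball
  \<open>F\<close> is the identity plus a map \<open>w\<close> with Lipschitz constant 1/2, and F x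
  = y is a fixed point equation for the map that sends x to y - w x.\<close>

lemma smooth_local_inverse:
  fixes F :: "'a::finite_dim_inner \<Rightarrow> 'a"
  assumes U: "open U" "x0 \<in> U" and F: "smooth_on U F" and F': "fderiv F x0 = id_blinfun"
  shows "\<exists>V G. open V \<and> F x0 \<in> V \<and> smooth_on V G \<and> G ` V \<subseteq> U \<and> (\<forall>y\<in>V. F (G y) = y) \<and> G (F x0) = x0"
proof -
  have DF: "(F has_derivative fderiv F x) (at x)" if "x \<in> U" for x
    using fderiv_works smooth_on_differentiable[OF F that] .
  have "continuous_on U (fderiv F)" using smooth_on_continuous[OF smooth_on_fderiv[OF U(1) F]] .
  then have "open (U \<inter> (\<lambda>x. fderiv F x - id_blinfun) -` ball 0 (1/2))"
    using U(1) by (intro continuous_open_preimage continuous_intros) auto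
  moreover have "x0 \<in> U \<inter> (\<lambda>x. fderiv F x - id_blinfun) -` ball 0 (1/2)" using U F' by simp
  ultimately obtain \<delta> where \<delta>: "\<delta> > 0"
    "cball x0 \<delta> \<subseteq> U \<inter> (\<lambda>x. fderiv F x - id_blinfun) -` ball 0 (1/2)"
    using open_contains_cball by blast
  let ?C = "cball x0 \<delta>"
  have CU: "?C \<subseteq> U" and half: "\<And>x. x \<in> ?C \<Longrightarrow> norm (fderiv F x - id_blinfun) < 1/2" using \<delta> by auto
  define w where "w = (\<lambda>x. F x - x)"
  have lip: "norm (w x - w x') \<le> 1/2 * norm (x - x')" if "x \<in> ?C" "x' \<in> ?C" for x x'
  proof (rule differentiable_bound[OF convex_cball _ _ that])
    fix z assume z: "z \<in> ?C"
    show "(w has_derivative (fderiv F z - id_blinfun)) (at z within ?C)"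
    proof -
      have "blinfun_apply (fderiv F z - id_blinfun) = (\<lambda>v. fderiv F z v - v)"
        by (rule ext) (simp add: blinfun.diff_left)
      then show ?thesis
        using has_derivative_at_withinI[OF has_derivative_diff[OF DF has_derivative_ident]] z CU
        by (auto simp: w_def)
    qed
    show "onorm (fderiv F z - id_blinfun) \<le> 1/2"
      using half[OF z] by (simp add: norm_blinfun.rep_eq)
  qed
  \<comment> \<open>The Lipschitz bound on \<open>w\<close> uses up half of the radius of
    \<open>?C\<close>; the other half is left for the distance of y from \<open>F x0\<close>, so
    that the fixed point map sends \<open>?C\<close> to itself.\<close>
  let ?V = "ball (F x0) (\<delta>/2)"
  have ex1: "\<exists>!x\<in>?C. F x = y" if y: "y \<in> ?V" for y
  proof -
    have "\<exists>!x\<in>?C. y - w x = x"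
    proof (rule Banach_fix)
      show "complete ?C" by (simp add: complete_eq_closed)
      show "?C \<noteq> {}" using \<delta> by simp
      show "(\<lambda>x. y - w x) ` ?C \<subseteq> ?C"
      proof (rule image_subsetI)
        fix x assume x: "x \<in> ?C"
        have "norm (w x0 - w x) \<le> 1/2 * norm (x0 - x)" using lip x \<delta>(1) by simp
        also have "\<dots> \<le> \<delta>/2" using x by (simp add: dist_norm)
        finally have 1: "norm (w x0 - w x) \<le> \<delta>/2" .
        have "y - w x - x0 = (y - F x0) + (w x0 - w x)" by (simp add: w_def)
        then have "norm (y - w x - x0) \<le> norm (y - F x0) + norm (w x0 - w x)" by (metis norm_triangle_ineq)
        also have "\<dots> \<le> \<delta>" using 1 y by (simp add: dist_norm norm_minus_commute)
        finally show "y - w x \<in> ?C" by (simp add: dist_norm norm_minus_commute)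
      qed
      show "dist (y - w x) (y - w x') \<le> 1/2 * dist x x'" if "x \<in> ?C" "x' \<in> ?C" for x x'
        using lip[OF that] by (simp add: dist_norm norm_minus_commute)
    qed auto
    moreover have "y - w x = x \<longleftrightarrow> F x = y" for x by (auto simp: w_def algebra_simps)
    ultimately show ?thesis by simp
  qed
  define G where "G = (\<lambda>y. THE x. x \<in> ?C \<and> F x = y)"
  have G: "G y \<in> ?C" "F (G y) = y" if "y \<in> ?V" for y
    unfolding G_def using theI'[OF ex1[OF that]] by auto
  have Guniq: "G (F x) = x" if "x \<in> ?C" "F x \<in> ?V" for x
    using ex1[OF that(2)] G[OF that(2)] that by blast
  have lipG: "norm (G y - G y') \<le> 2 * norm (y - y')" if "y \<in> ?V" "y' \<in> ?V" for y y'
  proof -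
    have "G y - G y' = (y - y') - (w (G y) - w (G y'))" using G that by (simp add: w_def)
    then have "norm (G y - G y') \<le> norm (y - y') + norm (w (G y) - w (G y'))" by (metis norm_triangle_ineq4)
    then show ?thesis using lip[of "G y" "G y'"] G that by auto
  qed
  have "2-lipschitz_on ?V G"
    using lipG by (intro lipschitz_onI) (auto simp: dist_norm)
  then have contG: "continuous_on ?V G" by (rule lipschitz_on_continuous_on)
  have "\<forall>y\<in>?V. \<exists>S. fderiv F (G y) o\<^sub>L S = id_blinfun \<and> S o\<^sub>L fderiv F (G y) = id_blinfun"
  proof
    fix y assume "y \<in> ?V"
    then show "\<exists>S. fderiv F (G y) o\<^sub>L S = id_blinfun \<and> S o\<^sub>L fderiv F (G y) = id_blinfun"
      using half[OF G(1), of y] by (intro blinfun_near_id_invertible) simp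
  qed
  then obtain S where S: "\<And>y. y \<in> ?V \<Longrightarrow> fderiv F (G y) o\<^sub>L S y = id_blinfun"
    "\<And>y. y \<in> ?V \<Longrightarrow> S y o\<^sub>L fderiv F (G y) = id_blinfun" by metis
  have DG: "(G has_derivative S y) (at y)" if y: "y \<in> ?V" for y
  proof (rule has_derivative_inverse_basic[where f = F and T = ?V])
    show "(F has_derivative fderiv F (G y)) (at (G y))" using DF G(1)[OF y] CU by blast
    show "blinfun_apply (S y) \<circ> blinfun_apply (fderiv F (G y)) = id"
    proof
      show "(blinfun_apply (S y) \<circ> blinfun_apply (fderiv F (G y))) v = id v" for v
        using S(2)[OF y] by (metis blinfun_apply_blinfun_compose blinfun_apply_id_blinfun comp_apply id_apply)
    qed
    show "continuous (at y) G" using contG y continuous_on_eq_continuous_at open_ball by blast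
  qed (use y G(2) blinfun.bounded_linear_right in auto)
  have GU: "G ` ?V \<subseteq> U" using G(1) CU by blast
  \<comment> \<open>Bootstrapping: the derivative \<open>S\<close> of \<open>G\<close> inverts the
    derivative of \<open>F\<close> along \<open>G\<close>, so it is as regular as \<open>G\<close>
    is already known to be.\<close>
  have "Ck_on k ?V G" for k
  proof (induction k)
    case 0
    show ?case using contG by simp
  next
    case (Suc k)
    show ?case
    proof (rule Ck_on_SucI[OF open_ball DG])
      have "Ck_on k ?V (\<lambda>y. fderiv F (G y))"
        using Ck_on_compose[OF open_ball U(1) GU Suc, of "fderiv F"] smooth_on_fderiv[OF U(1) F]
        by (simp add: smooth_on_def)
      from Ck_on_blinfun_inverse[where G = S, OF open_ball this S(2) S(1)]
      have "Ck_on k ?V S" by blast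
      then show "Ck_on k ?V (\<lambda>y. S y v)" for v
        by (intro Ck_on_bilinear[OF bounded_bilinear_blinfun_apply open_ball] Ck_on_const)
    qed
  qed
  then have "smooth_on ?V G" by (simp add: smooth_on_def)
  moreover have "G (F x0) = x0" using \<delta>(1) by (intro Guniq) auto
  ultimately show ?thesis using GU G(2) \<delta>(1) by (intro exI[of _ ?V] exI[of _ G]) auto
qed

section \<open>Submersions in coordinates, and isolated zeros\<close>

lemma surj_blinfun_right_inverse:
  fixes T :: "'a::real_normed_vector \<Rightarrow>\<^sub>L 'b::finite_dim_inner"
  assumes "surj T"
  shows "\<exists>S. T o\<^sub>L S = id_blinfun"
proof -
  obtain S where S: "linear S" "blinfun_apply T \<circ> S = id"
    using linear_surjective_right_inverse[OF bounded_linear.linear[OF blinfun.bounded_linear_right] assms] by blast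
  have "blinfun_apply (Blinfun S) = S"
    using linear_imp_bounded_linear[OF S(1)] by (rule bounded_linear_Blinfun_apply)
  then show ?thesis using S(2) by (intro exI[of _ "Blinfun S"] blinfun_eqI) (simp add: pointfree_idE)
qed

text \<open>Instead of splitting the source into kernel and complement, \<open>F\<close> corrects
  the displacement from \<open>x0\<close> by \<open>S\<close> applied to the nonlinear remainder of
  \<phi>. The correction has zero derivative at \<open>x0\<close>, and since \<open>S\<close> is a
  right inverse of \<open>?A\<close>, applying \<open>?A\<close> to \<open>F x\<close> returns
  exactly the increment of \<phi>. The local inverse of \<open>F\<close> thus makes \<phi>
  affine.\<close>

lemma submersion_straightening:
  fixes \<phi> :: "'a::finite_dim_inner \<Rightarrow> 'b::finite_dim_inner"
  assumes U: "open U" "x0 \<in> U" and \<phi>: "smooth_on U \<phi>" and surj: "surj (fderiv \<phi> x0)"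
  shows "\<exists>V \<Psi>. open V \<and> 0 \<in> V \<and> smooth_on V \<Psi> \<and> \<Psi> ` V \<subseteq> U \<and> \<Psi> 0 = x0 \<and>
    fderiv \<Psi> 0 = id_blinfun \<and> (\<forall>y\<in>V. \<phi> (\<Psi> y) = \<phi> x0 + fderiv \<phi> x0 y)"
proof -
  let ?A = "fderiv \<phi> x0"
  obtain S where S: "?A o\<^sub>L S = id_blinfun" using surj_blinfun_right_inverse[OF surj] by blast
  have AS: "?A (S v) = v" for v using S by (metis blinfun_apply_blinfun_compose blinfun_apply_id_blinfun)
  define F where "F = (\<lambda>x. (x - x0) + S (\<phi> x - \<phi> x0 - ?A (x - x0)))"
  have F: "smooth_on U F" unfolding F_def
    by (intro smooth_on_add smooth_on_diff smooth_on_const U(1) \<phi> smooth_on_ident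
        smooth_on_bounded_linear[OF blinfun.bounded_linear_right])
  have D\<phi>: "(\<phi> has_derivative ?A) (at x0)" using smooth_on_differentiable[OF \<phi> U(2)] by (rule fderiv_works)
  have "(F has_derivative (\<lambda>h. h)) (at x0)" unfolding F_def
    by (auto intro!: derivative_eq_intros D\<phi>
        bounded_linear.has_derivative[OF blinfun.bounded_linear_right] simp: blinfun.zero_right)
  then have "fderiv F x0 = id_blinfun" by (intro blinfun_eqI) (simp add: fderiv_unique)
  from smooth_local_inverse[OF U F this] obtain V G where V: "open V" "F x0 \<in> V" "smooth_on V G"
    "G ` V \<subseteq> U" "\<And>y. y \<in> V \<Longrightarrow> F (G y) = y" "G (F x0) = x0" by blast
  have Fx0: "F x0 = 0" by (simp add: F_def blinfun.zero_right)
  have AF: "?A (F x) = \<phi> x - \<phi> x0" for x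
    by (simp add: F_def blinfun.add_right AS)
  have DG: "(G has_derivative fderiv G 0) (at 0)"
    using smooth_on_differentiable[OF V(3)] V(2) Fx0 fderiv_works by metis
  have "((\<lambda>y. F (G y)) has_derivative (\<lambda>h. fderiv G 0 h)) (at 0)"
    using has_derivative_compose[OF DG] \<open>(F has_derivative (\<lambda>h. h)) (at x0)\<close> V(6) Fx0 by simp
  moreover have "((\<lambda>y. F (G y)) has_derivative (\<lambda>h. h)) (at 0)"
    by (rule has_derivative_transform_within_open[OF has_derivative_ident V(1)]) (use V Fx0 in auto)
  ultimately have "blinfun_apply (fderiv G 0) = (\<lambda>h. h)" by (rule has_derivative_unique)
  then have "fderiv G 0 = id_blinfun" by (intro blinfun_eqI) simp
  moreover have "\<phi> (G y) = \<phi> x0 + ?A y" if "y \<in> V" for y using AF[of "G y"] V(5)[OF that] by simp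
  ultimately show ?thesis using V Fx0 by (intro exI[of _ V] exI[of _ G]) auto
qed

text \<open>With a fixed right inverse \<open>S\<close> at \<open>x0\<close>, the product of
  \<open>A y\<close> and \<open>S\<close> is the identity at \<open>x0\<close> and invertible
  nearby; \<open>S\<close> times its inverse is the right inverse at y.\<close>

lemma smooth_local_right_inverse:
  fixes A :: "'c::real_normed_vector \<Rightarrow> 'a::real_normed_vector \<Rightarrow>\<^sub>L 'b::finite_dim_inner"
  assumes U: "open U" "x0 \<in> U" and A: "smooth_on U A" and surj: "surj (A x0)"
  shows "\<exists>W s. open W \<and> x0 \<in> W \<and> W \<subseteq> U \<and> smooth_on W s \<and> (\<forall>y\<in>W. A y o\<^sub>L s y = id_blinfun)"
proof -
  obtain S where S: "A x0 o\<^sub>L S = id_blinfun" using surj_blinfun_right_inverse[OF surj] by blast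
  define g where "g = (\<lambda>y. A y o\<^sub>L S)"
  have g: "smooth_on U g" unfolding g_def by (intro smooth_on_blinfun_compose U(1) A smooth_on_const)
  define W where "W = U \<inter> (\<lambda>y. g y - id_blinfun) -` ball 0 1"
  have W: "open W" unfolding W_def
    using U(1) smooth_on_continuous[OF g] by (intro continuous_open_preimage continuous_intros) auto
  have "\<forall>y\<in>W. \<exists>T. g y o\<^sub>L T = id_blinfun \<and> T o\<^sub>L g y = id_blinfun"
    using blinfun_near_id_invertible by (auto simp: W_def)
  then obtain T where T: "\<And>y. y \<in> W \<Longrightarrow> g y o\<^sub>L T y = id_blinfun" "\<And>y. y \<in> W \<Longrightarrow> T y o\<^sub>L g y = id_blinfun"
    by metis
  have "smooth_on W g" by (rule smooth_on_subset[OF g]) (auto simp: W_def)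
  from smooth_on_blinfun_inverse[where G = T, OF W this T(2,1)] have "smooth_on W T" by blast
  then have "smooth_on W (\<lambda>y. S o\<^sub>L T y)" by (intro smooth_on_blinfun_compose W smooth_on_const)
  moreover have "A y o\<^sub>L (S o\<^sub>L T y) = id_blinfun" if "y \<in> W" for y
    using T(1)[OF that] by (intro blinfun_eqI) (metis blinfun_apply_blinfun_compose g_def)
  ultimately show ?thesis using W U(2) S by (intro exI[of _ W] exI[of _ "\<lambda>y. S o\<^sub>L T y"]) (auto simp: W_def g_def)
qed

text \<open>A linear left inverse of norm at most \<open>C\<close> bounds F' h from below by the
  norm of h divided by \<open>C\<close>. A remainder of half that size cannot cancel it.\<close>

lemma isolated_zero:
  fixes F :: "'a::real_normed_vector \<Rightarrow> 'b::finite_dim_inner"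
  assumes F: "(F has_derivative F') (at p)" and inj: "inj F'" and 0: "F p = 0"
  shows "\<exists>\<delta>>0. \<forall>q. norm (q - p) < \<delta> \<and> F q = 0 \<longrightarrow> q = p"
proof -
  obtain G where G: "linear G" "G \<circ> F' = id"
    using linear_injective_left_inverse[OF has_derivative_linear[OF F] inj] by blast
  obtain C where C: "C > 0" "\<And>x. norm (G x) \<le> norm x * C"
    using bounded_linear.pos_bounded[OF linear_imp_bounded_linear[OF G(1)]] by blast
  have "1 / (2 * C) > 0" using C by simp
  then obtain \<delta> where \<delta>: "\<delta> > 0"
    "\<And>q. norm (q - p) < \<delta> \<Longrightarrow> norm (F q - F p - F' (q - p)) \<le> 1 / (2 * C) * norm (q - p)"
    using F unfolding has_derivative_at_alt by blast
  show ?thesis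
  proof (intro exI[of _ \<delta>] conjI allI impI \<delta>(1))
    fix q assume q: "norm (q - p) < \<delta> \<and> F q = 0"
    have "norm (q - p) = norm (G (F' (q - p)))" using G(2) by (simp add: pointfree_idE)
    also have "\<dots> \<le> norm (F' (q - p)) * C" by (rule C(2))
    also have "\<dots> \<le> (1 / (2 * C) * norm (q - p)) * C"
      using \<delta>(2)[of q] q 0 C(1) by (intro mult_right_mono) (auto simp: norm_minus_commute)
    also have "\<dots> = norm (q - p) / 2" using C(1) by simp
    finally show "q = p" by simp
  qed
qed


section \<open>Smooth cutoff functions\<close>

text \<open>The flat function exp(-1/t), extended by zero, is taken together with all polynomial
  factors in 1/t: this family is closed under differentiation.\<close>

definition flat_exp :: "real poly \<Rightarrow> real \<Rightarrow> real" where
  "flat_exp p t = (if t \<le> 0 then 0 else poly p (1 / t) * exp (- (1 / t)))"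

lemma poly_times_exp_tendsto_0:
  fixes p :: "real poly"
  shows "((\<lambda>x. poly p x * exp (- x)) \<longlongrightarrow> 0) at_top"
proof -
  \<comment> \<open>The extra power carries the induction: splitting off the constant coefficient of
    a polynomial leaves a factor x behind.\<close>
  have "((\<lambda>x. x ^ n * (poly p x * exp (- x))) \<longlongrightarrow> 0) at_top" for n
  proof (induction p arbitrary: n)
    case 0
    then show ?case by simp
  next
    case (pCons a p)
    have "((\<lambda>x. a * (x ^ n / exp x) + x ^ Suc n * (poly p x * exp (- x))) \<longlongrightarrow> a * 0 + 0) at_top"
      by (intro tendsto_intros tendsto_power_div_exp_0 pCons.IH)
    then show ?case by (simp add: algebra_simps exp_minus divide_inverse)
  qed
  from this[of 0] show ?thesis by simp
qed

text \<open>With u = 1/t, whose derivative is minus the square of u, the product p(u) exp(-u) has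
  derivative (p - p')(u) exp(-u) times the square of u; \<open>monom 1 2\<close> is that
  square.\<close>

lemma flat_exp_has_derivative:
  "(flat_exp p has_field_derivative flat_exp (monom 1 2 * (p - pderiv p)) t) (at t)"
proof (cases "t = 0")
  case True
  have "((\<lambda>h. flat_exp p h / h) \<longlongrightarrow> 0) (at_right 0)"
  proof -
    \<comment> \<open>Substituting x = 1/h turns the difference quotient into x p(x) exp(-x), which
      is the limit above for the polynomial \<open>pCons 0 p\<close>.\<close>
    have "((\<lambda>x. flat_exp p (inverse x) / inverse x) \<longlongrightarrow> 0) at_top"
    proof (rule Lim_transform_eventually[OF poly_times_exp_tendsto_0[of "pCons 0 p"]])
      show "eventually (\<lambda>x. poly (pCons 0 p) x * exp (- x) = flat_exp p (inverse x) / inverse x) at_top"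
        using eventually_gt_at_top[of 0]
        by eventually_elim (simp add: flat_exp_def field_simps)
    qed
    then show ?thesis by (simp add: filterlim_at_right_to_top)
  qed
  moreover have "((\<lambda>h. flat_exp p h / h) \<longlongrightarrow> 0) (at_left 0)"
  proof (rule tendsto_eventually)
    show "eventually (\<lambda>h. flat_exp p h / h = 0) (at_left 0)"
      by (auto simp: eventually_at_filter flat_exp_def intro!: always_eventually)
  qed
  ultimately have "((\<lambda>h. flat_exp p h / h) \<longlongrightarrow> 0) (at 0)" by (simp add: filterlim_split_at)
  then show ?thesis using True by (simp add: has_field_derivative_iff flat_exp_def)
next
  case False
  show ?thesis
  proof (cases "t < 0")
    case True
    have "(flat_exp p has_field_derivative 0) (at t)"
      by (rule DERIV_cong_ev[THEN iffD1, OF refl _ refl DERIV_const[of 0]],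
          rule eventually_mono[OF eventually_nhds_in_open[of "{..<0}"]])
        (use True in \<open>auto simp: flat_exp_def\<close>)
    then show ?thesis using True by (simp add: flat_exp_def)
  next
    case False
    with \<open>t \<noteq> 0\<close> have t: "t > 0" by simp
    have "((\<lambda>t. poly p (1 / t) * exp (- (1 / t))) has_field_derivative
        flat_exp (monom 1 2 * (p - pderiv p)) t) (at t)"
      using t by (auto intro!: derivative_eq_intros simp: flat_exp_def poly_monom field_simps power2_eq_square)
    then show ?thesis
      by (rule DERIV_cong_ev[THEN iffD1, OF refl _ refl, rotated],
          intro eventually_mono[OF eventually_nhds_in_open[of "{0<..}"]])
        (use t in \<open>auto simp: flat_exp_def\<close>)
  qed
qed

lemma smooth_on_flat_exp: "smooth_on UNIV (flat_exp p)"
proof -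
  have "Ck_on k UNIV (flat_exp p)" for k
  proof (induction k arbitrary: p)
    case 0
    show ?case using DERIV_isCont[OF flat_exp_has_derivative]
      by (simp add: continuous_at_imp_continuous_on)
  next
    case (Suc k)
    show ?case
    proof (rule Ck_on_SucI[OF open_UNIV])
      show "(flat_exp p has_derivative (\<lambda>v. flat_exp (monom 1 2 * (p - pderiv p)) x * v)) (at x)" for x
        using flat_exp_has_derivative[of p x] by (simp add: has_field_derivative_def)
      show "Ck_on k UNIV (\<lambda>x. flat_exp (monom 1 2 * (p - pderiv p)) x * v)" for v
        by (intro Ck_on_bilinear[OF bounded_bilinear_mult open_UNIV] Suc Ck_on_const)
    qed
  qed
  then show ?thesis by (simp add: smooth_on_def)
qed

lemma smooth_on_real_inverse:
  fixes h :: "'a::real_normed_vector \<Rightarrow> real"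
  assumes U: "open U" and h: "smooth_on U h" and nz: "\<And>x. x \<in> U \<Longrightarrow> h x \<noteq> 0"
  shows "smooth_on U (\<lambda>x. inverse (h x))"
proof -
  have "Ck_on k U (\<lambda>x. inverse (h x))" for k
  proof (induction k)
    case 0
    show ?case using smooth_on_continuous[OF h] nz by (auto intro: continuous_intros)
  next
    case (Suc k)
    show ?case
    proof (rule Ck_on_SucI[OF U])
      show "((\<lambda>x. inverse (h x)) has_derivative
          (\<lambda>v. - (inverse (h x) * frechet_derivative h (at x) v * inverse (h x)))) (at x)" if "x \<in> U" for x
        using Deriv.has_derivative_inverse[OF nz[OF that]
            smooth_on_differentiable[OF h that, unfolded frechet_derivative_works]] .
      have "Ck_on k U (\<lambda>x. frechet_derivative h (at x) v)" for v
        using smooth_on_frechet_derivative[OF h, of v] by (simp add: smooth_on_def)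
      then show "Ck_on k U (\<lambda>x. - (inverse (h x) * frechet_derivative h (at x) v * inverse (h x)))" for v
        by (intro Ck_on_bounded_linear[OF bounded_linear_minus[OF bounded_linear_ident] U]
            Ck_on_bilinear[OF bounded_bilinear_mult U] Suc)
    qed
  qed
  then show ?thesis by (simp add: smooth_on_def)
qed

text \<open>The quotient a / (a + b) of flat functions, where \<open>a\<close> vanishes from 1 on
  and \<open>b\<close> up to 1/2; at every point at least one of them is positive.\<close>

lemma smooth_step_exists:
  "\<exists>\<eta>::real \<Rightarrow> real. smooth_on UNIV \<eta> \<and> (\<forall>t\<le>1/2. \<eta> t = 1) \<and> (\<forall>t\<ge>1. \<eta> t = 0)"
proof -
  let ?f = "flat_exp 1"
  define a where "a = (\<lambda>t::real. ?f (1 - t))"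
  define b where "b = (\<lambda>t::real. ?f (t - 1/2))"
  have f: "?f t \<ge> 0" "t > 0 \<Longrightarrow> ?f t > 0" "t \<le> 0 \<Longrightarrow> ?f t = 0" for t by (auto simp: flat_exp_def)
  have sa: "smooth_on UNIV a" unfolding a_def
    by (rule smooth_on_compose[OF open_UNIV open_UNIV _ _ smooth_on_flat_exp])
      (simp_all add: smooth_on_diff[OF open_UNIV smooth_on_const smooth_on_ident])
  have sb: "smooth_on UNIV b" unfolding b_def
    by (rule smooth_on_compose[OF open_UNIV open_UNIV _ _ smooth_on_flat_exp])
      (simp_all add: smooth_on_diff[OF open_UNIV smooth_on_ident smooth_on_const])
  have pos: "a t + b t > 0" for t
  proof (cases "t < 1")
    case True
    then show ?thesis using f(1)[of "t - 1/2"] f(2)[of "1 - t"] by (simp add: a_def b_def add_pos_nonneg)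
  next
    case False
    then show ?thesis using f(1)[of "1 - t"] f(2)[of "t - 1/2"] by (simp add: a_def b_def add_nonneg_pos)
  qed
  have "smooth_on UNIV (\<lambda>t. a t * inverse (a t + b t))"
    using pos by (intro smooth_on_bilinear[OF bounded_bilinear_mult] smooth_on_real_inverse
        smooth_on_add sa sb open_UNIV) (simp add: less_imp_neq[symmetric])
  moreover have "a t * inverse (a t + b t) = 1" if "t \<le> 1/2" for t
    using pos[of t] f(3)[of "t - 1/2"] that by (simp add: b_def)
  moreover have "a t * inverse (a t + b t) = 0" if "t \<ge> 1" for t
    using f(3)[of "1 - t"] that by (simp add: a_def)
  ultimately show ?thesis by (intro exI[of _ "\<lambda>t. a t * inverse (a t + b t)"]) auto
qed

lemma smooth_bump_exists:
  fixes y0 :: "'a::finite_dim_inner"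
  assumes "\<epsilon> > 0"
  shows "\<exists>\<beta>::'a \<Rightarrow> real. smooth_on UNIV \<beta> \<and> (\<exists>\<delta>>0. \<forall>y\<in>ball y0 \<delta>. \<beta> y = 1) \<and> (\<forall>y. dist y0 y \<ge> \<epsilon> \<longrightarrow> \<beta> y = 0)"
proof -
  obtain \<eta> :: "real \<Rightarrow> real" where \<eta>: "smooth_on UNIV \<eta>" "\<And>t. t \<le> 1/2 \<Longrightarrow> \<eta> t = 1" "\<And>t. t \<ge> 1 \<Longrightarrow> \<eta> t = 0"
    using smooth_step_exists by blast
  \<comment> \<open>The squared distance is smooth also at the centre, unlike the distance. Within
    half the radius \<open>q\<close> is at most 1/4, where the step function is still 1.\<close>
  define q where "q = (\<lambda>y. ((y - y0) \<bullet> (y - y0)) * inverse (\<epsilon>\<^sup>2))"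
  have q: "q y = (dist y0 y / \<epsilon>)\<^sup>2" for y
    by (simp add: q_def dist_norm norm_minus_commute[of y0] power_divide divide_inverse dot_square_norm
        power_mult_distrib power_inverse)
  have "smooth_on UNIV q" unfolding q_def
    by (intro smooth_on_bilinear[OF bounded_bilinear_mult] smooth_on_bilinear[OF bounded_bilinear_inner]
        smooth_on_const smooth_on_diff smooth_on_ident open_UNIV)
  then have 1: "smooth_on UNIV (\<lambda>y. \<eta> (q y))"
    by (intro smooth_on_compose[where g = \<eta>, OF open_UNIV open_UNIV _ _ \<eta>(1)]) auto
  have 2: "\<eta> (q y) = 1" if "y \<in> ball y0 (\<epsilon> / 2)" for y
  proof (rule \<eta>(2))
    have "(dist y0 y / \<epsilon>)\<^sup>2 \<le> (1/2)\<^sup>2"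
      using that assms by (intro power_mono) (auto simp: field_simps)
    also have "(1/2)\<^sup>2 \<le> (1/2 :: real)" by (simp add: power2_eq_square)
    finally show "q y \<le> 1/2" unfolding q .
  qed
  have 3: "\<eta> (q y) = 0" if "dist y0 y \<ge> \<epsilon>" for y
  proof (rule \<eta>(3))
    have "1\<^sup>2 \<le> (dist y0 y / \<epsilon>)\<^sup>2"
      using that assms by (intro power_mono) (auto simp: field_simps)
    then show "q y \<ge> 1" unfolding q by simp
  qed
  show ?thesis using 1 2 3 assms by (intro exI[of _ "\<lambda>y. \<eta> (q y)"] conjI exI[of _ "\<epsilon> / 2"]) auto
qed


section \<open>Brackets and Lie derivatives under smooth maps, in coordinates\<close>

lemma fderiv_blinfun_apply:
  fixes A :: "'a::real_normed_vector \<Rightarrow> 'b::real_normed_vector \<Rightarrow>\<^sub>L 'c::real_normed_vector"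
  assumes "A differentiable (at x)" "f differentiable (at x)"
  shows "fderiv (\<lambda>y. A y (f y)) x h = A x (fderiv f x h) + fderiv A x h (f x)"
  by (rule fun_cong[OF fderiv_unique[OF bounded_bilinear.FDERIV[OF bounded_bilinear_blinfun_apply
        fderiv_works[OF assms(1)] fderiv_works[OF assms(2)]]]])

lemma fderiv_const [simp]: "fderiv (\<lambda>x. c) x = 0"
  by (intro blinfun_eqI) (simp add: fderiv_unique[OF has_derivative_const])

lemma fderiv_symmetric:
  fixes f :: "'a::finite_dim_inner \<Rightarrow> 'b::real_normed_vector"
  assumes U: "open U" "x \<in> U" and f: "smooth_on U f"
  shows "fderiv (fderiv f) x v w = fderiv (fderiv f) x w v"
proof -
  have d: "fderiv f differentiable (at x)"
    using smooth_on_differentiable[OF smooth_on_fderiv[OF U(1) f] U(2)] .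
  have *: "fderiv (fderiv f) x v w = frechet_derivative (\<lambda>y. frechet_derivative f (at y) w) (at x) v" for v w
  proof -
    have "fderiv (fderiv f) x v w = fderiv (\<lambda>y. fderiv f y w) x v"
      using fderiv_blinfun_apply[OF d, of "\<lambda>_. w" v] by (simp add: blinfun.zero_right)
    also have "\<dots> = frechet_derivative (\<lambda>y. fderiv f y w) (at x) v"
      by (subst fderiv_apply[OF differentiableI[OF bounded_bilinear.FDERIV[OF bounded_bilinear_blinfun_apply
              fderiv_works[OF d] has_derivative_const[of w]]]]) (rule refl)
    also have "\<dots> = frechet_derivative (\<lambda>y. frechet_derivative f (at y) w) (at x) v"
      by (rule fun_cong[OF frechet_derivative_cong_open[OF U]])
        (simp add: fderiv_apply smooth_on_differentiable[OF f])
    finally show ?thesis .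
  qed
  show ?thesis unfolding * using second_derivative_symmetric[OF U f] .
qed

text \<open>The two terms with the second derivative of \<phi> cancel by symmetry. The right-hand
  side differentiates the pushforwards as functions on the source, so they need not be fields on the
  target.\<close>

lemma pushforward_bracket:
  fixes \<phi> :: "'a::finite_dim_inner \<Rightarrow> 'b::real_normed_vector"
  assumes U: "open U" "y \<in> U" and \<phi>: "smooth_on U \<phi>"
    and X: "X differentiable (at y)" and Y: "Y differentiable (at y)"
  shows "fderiv \<phi> y (fderiv Y y (X y) - fderiv X y (Y y)) =
    fderiv (\<lambda>z. fderiv \<phi> z (Y z)) y (X y) - fderiv (\<lambda>z. fderiv \<phi> z (X z)) y (Y y)"
proof -
  have d: "fderiv \<phi> differentiable (at y)"
    using smooth_on_differentiable[OF smooth_on_fderiv[OF U(1) \<phi>] U(2)] .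
  show ?thesis
    unfolding fderiv_blinfun_apply[OF d X] fderiv_blinfun_apply[OF d Y] fderiv_symmetric[OF U \<phi>, of "X y"]
    by (simp add: blinfun.diff_right)
qed

text \<open>Differentiating \<open>relX\<close> and \<open>rel\<alpha>\<close> produces the second
  derivative of \<phi> once from the vector field and once from the form. By symmetry these
  contributions are equal, and they cancel in the sum.\<close>

lemma pullback_lie_derivative:
  fixes \<phi> :: "'a::finite_dim_inner \<Rightarrow> 'b::finite_dim_inner"
  assumes U: "open U" "y \<in> U" and \<phi>: "smooth_on U \<phi>"
    and X: "X differentiable (at y)" and X': "X' differentiable (at (\<phi> y))"
    and \<alpha>': "\<alpha>' differentiable (at (\<phi> y))"
    and relX: "\<And>z. z \<in> U \<Longrightarrow> fderiv \<phi> z (X z) = X' (\<phi> z)"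
    and rel\<alpha>: "\<And>z. z \<in> U \<Longrightarrow> \<alpha> z = \<alpha>' (\<phi> z) o\<^sub>L fderiv \<phi> z"
  shows "fderiv \<alpha> y (X y) + (\<alpha> y o\<^sub>L fderiv X y) =
    (fderiv \<alpha>' (\<phi> y) (X' (\<phi> y)) + (\<alpha>' (\<phi> y) o\<^sub>L fderiv X' (\<phi> y))) o\<^sub>L fderiv \<phi> y"
proof (rule blinfun_eqI)
  fix v
  have d: "fderiv \<phi> differentiable (at y)"
    using smooth_on_differentiable[OF smooth_on_fderiv[OF U(1) \<phi>] U(2)] .
  have D\<phi>: "(\<phi> has_derivative fderiv \<phi> y) (at y)"
    using smooth_on_differentiable[OF \<phi> U(2)] by (rule fderiv_works)
  have "fderiv (\<lambda>z. fderiv \<phi> z (X z)) y v = fderiv (\<lambda>z. X' (\<phi> z)) y v"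
    using fderiv_cong_open[OF U relX] by simp
  also have "\<dots> = fderiv X' (\<phi> y) (fderiv \<phi> y v)"
    by (rule fun_cong[OF fderiv_unique[OF has_derivative_compose[OF D\<phi> fderiv_works[OF X']]]])
  finally have 1: "fderiv \<phi> y (fderiv X y v) + fderiv (fderiv \<phi>) y v (X y) = fderiv X' (\<phi> y) (fderiv \<phi> y v)"
    unfolding fderiv_blinfun_apply[OF d X] .
  have "fderiv \<alpha> y = fderiv (\<lambda>z. \<alpha>' (\<phi> z) o\<^sub>L fderiv \<phi> z) y"
    using fderiv_cong_open[OF U rel\<alpha>] .
  also have "blinfun_apply \<dots> = (\<lambda>h. (\<alpha>' (\<phi> y) o\<^sub>L fderiv (fderiv \<phi>) y h) + (fderiv \<alpha>' (\<phi> y) (fderiv \<phi> y h) o\<^sub>L fderiv \<phi> y))"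
    by (rule fderiv_unique[OF bounded_bilinear.FDERIV[OF bounded_bilinear_blinfun_compose
          has_derivative_compose[OF D\<phi> fderiv_works[OF \<alpha>']] fderiv_works[OF d]]])
  finally have 2: "fderiv \<alpha> y (X y) v = \<alpha>' (\<phi> y) (fderiv (fderiv \<phi>) y (X y) v) + fderiv \<alpha>' (\<phi> y) (X' (\<phi> y)) (fderiv \<phi> y v)"
    using relX[OF U(2)] by (simp add: blinfun.add_left)
  show "blinfun_apply (fderiv \<alpha> y (X y) + (\<alpha> y o\<^sub>L fderiv X y)) v =
    blinfun_apply ((fderiv \<alpha>' (\<phi> y) (X' (\<phi> y)) + (\<alpha>' (\<phi> y) o\<^sub>L fderiv X' (\<phi> y))) o\<^sub>L fderiv \<phi> y) v"
    by (simp add: blinfun.add_left 2 1[symmetric] rel\<alpha>[OF U(2)] blinfun.add_right fderiv_symmetric[OF U \<phi>, of v])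
qed

section \<open>Charts and smooth maps\<close>

lemma chart_subset_carrier: "smooth_manifold M \<Longrightarrow> c \<in> atlas M \<Longrightarrow> fst c \<subseteq> carrier M"
  unfolding smooth_manifold_def by (meson openin_subset)

lemma chart_open: "smooth_manifold M \<Longrightarrow> c \<in> atlas M \<Longrightarrow> openin (mtop M) (fst c)"
  unfolding smooth_manifold_def by blast

lemma chart_homeomorphic:
  "smooth_manifold M \<Longrightarrow> c \<in> atlas M \<Longrightarrow>
    homeomorphic_map (subtopology (mtop M) (fst c)) (top_of_set (snd c ` fst c)) (snd c)"
  unfolding smooth_manifold_def by blast

lemma chart_at_exists: "smooth_manifold M \<Longrightarrow> x \<in> carrier M \<Longrightarrow> \<exists>c. c \<in> atlas M \<and> x \<in> fst c"
  unfolding smooth_manifold_def by blast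

lemma chart_at:
  assumes "smooth_manifold M" "x \<in> carrier M"
  shows "chart_at M x \<in> atlas M" "x \<in> fst (chart_at M x)"
  using someI_ex[OF chart_at_exists[OF assms]] by (auto simp: chart_at_def)

lemma chart_inv_chart [simp]:
  assumes "smooth_manifold M" "c \<in> atlas M" "x \<in> fst c"
  shows "chart_inv c (snd c x) = x"
proof -
  have "topspace (subtopology (mtop M) (fst c)) = fst c"
    using chart_subset_carrier[OF assms(1,2)] by auto
  then have "inj_on (snd c) (fst c)"
    using homeomorphic_imp_injective_map[OF chart_homeomorphic[OF assms(1,2)]] by simp
  then show ?thesis unfolding chart_inv_def using assms(3) by simp
qed

lemma chart_image_open:
  assumes M: "smooth_manifold M" and c: "c \<in> atlas M" and U: "openin (mtop M) U" "U \<subseteq> fst c"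
  shows "open (snd c ` U)"
proof -
  have "openin (subtopology (mtop M) (fst c)) U"
    using U by (simp add: openin_open_subtopology chart_open[OF M c])
  then have "openin (top_of_set (snd c ` fst c)) (snd c ` U)"
    using homeomorphic_imp_open_map[OF chart_homeomorphic[OF M c]] by (simp add: open_map_def)
  moreover have "open (snd c ` fst c)" using M c unfolding smooth_manifold_def by blast
  ultimately show ?thesis by (simp add: openin_open_eq)
qed

lemma chart_preimage_open:
  assumes M: "smooth_manifold M" and c: "c \<in> atlas M" and V: "open V"
  shows "openin (mtop M) {x \<in> fst c. snd c x \<in> V}"
proof -
  have "continuous_map (subtopology (mtop M) (fst c)) (top_of_set (snd c ` fst c)) (snd c)"
    using homeomorphic_imp_continuous_map[OF chart_homeomorphic[OF M c]] .
  moreover have "openin (top_of_set (snd c ` fst c)) (snd c ` fst c \<inter> V)" using V by (simp add: openin_open_Int)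
  ultimately have "openin (subtopology (mtop M) (fst c))
      {x \<in> topspace (subtopology (mtop M) (fst c)). snd c x \<in> snd c ` fst c \<inter> V}"
    by (rule openin_continuous_map_preimage)
  moreover have "{x \<in> topspace (subtopology (mtop M) (fst c)). snd c x \<in> snd c ` fst c \<inter> V} = {x \<in> fst c. snd c x \<in> V}"
    using chart_subset_carrier[OF M c] by auto
  ultimately show ?thesis by (simp add: openin_open_subtopology chart_open[OF M c])
qed

section \<open>Smooth maps and their Jacobians in charts\<close>

lemma smooth_map_in_carrier: "smooth_map M N f \<Longrightarrow> x \<in> carrier M \<Longrightarrow> f x \<in> carrier N"
  unfolding smooth_map_def continuous_map_def by blast

lemma smooth_map_domain_open:
  assumes M: "smooth_manifold M" and N: "smooth_manifold N" and f: "smooth_map M N f"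
    and c: "c \<in> atlas M" and d: "d \<in> atlas N"
  shows "openin (mtop M) {x \<in> fst c. f x \<in> fst d}"
proof -
  have "openin (mtop M) {x \<in> carrier M. f x \<in> fst d}"
    using f chart_open[OF N d] unfolding smooth_map_def by (blast intro: openin_continuous_map_preimage)
  moreover have "{x \<in> fst c. f x \<in> fst d} = fst c \<inter> {x \<in> carrier M. f x \<in> fst d}"
    using chart_subset_carrier[OF M c] by auto
  ultimately show ?thesis using chart_open[OF M c] by auto
qed

lemma smooth_map_open_image:
  assumes "smooth_manifold M" "smooth_manifold N" "smooth_map M N f" "c \<in> atlas M" "d \<in> atlas N"
  shows "open (snd c ` {x \<in> fst c. f x \<in> fst d})"
  by (rule chart_image_open[OF assms(1,4) smooth_map_domain_open[OF assms]]) auto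

lemma smooth_map_rep:
  assumes "smooth_map M N f" "c \<in> atlas M" "d \<in> atlas N"
  shows "smooth_on (snd c ` {x \<in> fst c. f x \<in> fst d}) (snd d \<circ> f \<circ> chart_inv c)"
  using assms unfolding smooth_map_def by blast

lemma smooth_map_ident: "smooth_manifold M \<Longrightarrow> smooth_map M M (\<lambda>x. x)"
  unfolding smooth_map_def smooth_manifold_def
  by (auto simp: comp_def Int_def intro: continuous_map_id[unfolded id_def])

text \<open>The Jacobian in a chosen pair of charts. \<open>tangent_map\<close>,
  \<open>to_chart\<close> and \<open>from_chart\<close> are all instances, so a single chain rule
  covers them.\<close>

definition cderiv ::
  "('p, 'e::real_normed_vector) chart \<Rightarrow> ('q, 'f::real_normed_vector) chart \<Rightarrow> ('p \<Rightarrow> 'q) \<Rightarrow> 'p \<Rightarrow> 'e \<Rightarrow>\<^sub>L 'f" where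
  "cderiv c d f x = fderiv (snd d \<circ> f \<circ> chart_inv c) (snd c x)"

lemma tangent_map_cderiv: "tangent_map M N f x = cderiv (chart_at M x) (chart_at N (f x)) f x"
  by (simp add: tangent_map_def cderiv_def fderiv_def)

lemma to_chart_cderiv: "to_chart M c x = cderiv (chart_at M x) c (\<lambda>x. x) x"
  by (simp add: to_chart_def cderiv_def fderiv_def comp_def)

lemma from_chart_cderiv: "from_chart M c x = cderiv c (chart_at M x) (\<lambda>x. x) x"
  by (simp add: from_chart_def cderiv_def fderiv_def comp_def)

lemma cderiv_chain:
  assumes M: "smooth_manifold M" and N: "smooth_manifold N" and P: "smooth_manifold P"
    and f: "smooth_map M N f" and g: "smooth_map N P g"
    and c: "c \<in> atlas M" "x \<in> fst c" and d: "d \<in> atlas N" "f x \<in> fst d" and e: "e \<in> atlas P" "g (f x) \<in> fst e"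
  shows "cderiv c e (\<lambda>x. g (f x)) x = cderiv d e g (f x) o\<^sub>L cderiv c d f x"
proof -
  let ?O = "snd c ` {x \<in> fst c. f x \<in> fst d}"
  have O: "open ?O" "snd c x \<in> ?O" using smooth_map_open_image[OF M N f c(1) d(1)] c d by auto
  have Df: "((snd d \<circ> f \<circ> chart_inv c) has_derivative cderiv c d f x) (at (snd c x))"
    unfolding cderiv_def
    by (rule fderiv_works[OF smooth_on_differentiable[OF smooth_map_rep[OF f c(1) d(1)] O(2)]])
  have eq: "(snd d \<circ> f \<circ> chart_inv c) (snd c x) = snd d (f x)" using M c by simp
  have Dg: "((snd e \<circ> g \<circ> chart_inv d) has_derivative cderiv d e g (f x)) (at ((snd d \<circ> f \<circ> chart_inv c) (snd c x)))"
    unfolding cderiv_def eq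
    by (rule fderiv_works[OF smooth_on_differentiable[OF smooth_map_rep[OF g d(1) e(1)]]]) (use d e in auto)
  have "((\<lambda>y. (snd e \<circ> g \<circ> chart_inv d) ((snd d \<circ> f \<circ> chart_inv c) y)) has_derivative
      (\<lambda>v. cderiv d e g (f x) (cderiv c d f x v))) (at (snd c x))"
    by (rule has_derivative_compose[OF Df Dg])
  then have "((snd e \<circ> (\<lambda>x. g (f x)) \<circ> chart_inv c) has_derivative
      (\<lambda>v. cderiv d e g (f x) (cderiv c d f x v))) (at (snd c x))"
    by (rule has_derivative_transform_within_open[OF _ O]) (use M N c d in auto)
  from fderiv_unique[OF this] show ?thesis
    by (intro blinfun_eqI) (simp add: cderiv_def[of c e])
qed

lemma cderiv_ident:
  assumes M: "smooth_manifold M" and c: "c \<in> atlas M" "x \<in> fst c"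
  shows "cderiv c c (\<lambda>x. x) x = id_blinfun"
proof -
  have "((snd c \<circ> (\<lambda>x. x) \<circ> chart_inv c) has_derivative (\<lambda>v. v)) (at (snd c x))"
    by (rule has_derivative_transform_within_open[OF has_derivative_ident chart_image_open[OF M c(1) chart_open[OF M c(1)] subset_refl]])
      (use M c in auto)
  from fderiv_unique[OF this] show ?thesis by (intro blinfun_eqI) (simp add: cderiv_def)
qed

lemma cderiv_change:
  assumes M: "smooth_manifold M" and c: "c \<in> atlas M" "x \<in> fst c" and d: "d \<in> atlas M" "x \<in> fst d"
    and e: "e \<in> atlas M" "x \<in> fst e"
  shows "cderiv d e (\<lambda>x. x) x o\<^sub>L cderiv c d (\<lambda>x. x) x = cderiv c e (\<lambda>x. x) x"
  using cderiv_chain[OF M M M smooth_map_ident[OF M] smooth_map_ident[OF M] c d e] by simp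

lemma to_from_chart [simp]:
  assumes "smooth_manifold M" "c \<in> atlas M" "x \<in> fst c"
  shows "to_chart M c x o\<^sub>L from_chart M c x = id_blinfun"
    and "from_chart M c x o\<^sub>L to_chart M c x = id_blinfun"
proof -
  have x: "x \<in> carrier M" using chart_subset_carrier[OF assms(1,2)] assms(3) by blast
  show "to_chart M c x o\<^sub>L from_chart M c x = id_blinfun" "from_chart M c x o\<^sub>L to_chart M c x = id_blinfun"
    unfolding to_chart_cderiv from_chart_cderiv
    using cderiv_change[OF assms(1)] cderiv_ident[OF assms(1)] chart_at[OF assms(1) x] assms by metis+
qed

lemma to_from_chart_apply [simp]:
  assumes "smooth_manifold M" "c \<in> atlas M" "x \<in> fst c"
  shows "to_chart M c x (from_chart M c x v) = v" and "from_chart M c x (to_chart M c x v) = v"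
  using to_from_chart[OF assms] by (metis blinfun_apply_blinfun_compose blinfun_apply_id_blinfun)+

lemma to_chart_chart_at [simp]:
  assumes "smooth_manifold M" "x \<in> carrier M"
  shows "to_chart M (chart_at M x) x = id_blinfun" "from_chart M (chart_at M x) x = id_blinfun"
  unfolding to_chart_cderiv from_chart_cderiv using cderiv_ident[OF assms(1) chart_at[OF assms]] by auto

text \<open>\<open>tangent_map\<close> refers to preferred charts, which may change abruptly between
  neighbouring points. This formula relates it to fixed charts, in which the Jacobian of a smooth
  map is smooth.\<close>

lemma cderiv_tangent_map:
  assumes M: "smooth_manifold M" and N: "smooth_manifold N" and f: "smooth_map M N f"
    and c: "c \<in> atlas M" "x \<in> fst c" and d: "d \<in> atlas N" "f x \<in> fst d"
  shows "cderiv c d f x = to_chart N d (f x) o\<^sub>L tangent_map M N f x o\<^sub>L from_chart M c x"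
proof -
  have x: "x \<in> carrier M" using chart_subset_carrier[OF M c(1)] c(2) by blast
  then have fx: "f x \<in> carrier N" using smooth_map_in_carrier[OF f] by blast
  have "cderiv c (chart_at N (f x)) f x = tangent_map M N f x o\<^sub>L from_chart M c x"
    unfolding tangent_map_cderiv from_chart_cderiv
    using cderiv_chain[OF M M N smooth_map_ident[OF M] f c chart_at[OF M x] chart_at[OF N fx]] by simp
  moreover have "cderiv c d f x = to_chart N d (f x) o\<^sub>L cderiv c (chart_at N (f x)) f x"
    unfolding to_chart_cderiv
    using cderiv_chain[OF M N N f smooth_map_ident[OF N] c chart_at[OF N fx] d] by simp
  ultimately show ?thesis by (simp add: blinfun_eqI)
qed

section \<open>Smooth fields in charts\<close>

lemma vf_in_chart:
  "smooth_manifold M \<Longrightarrow> c \<in> atlas M \<Longrightarrow> x \<in> fst c \<Longrightarrow> vf_in M c X (snd c x) = to_chart M c x (X x)"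
  by (simp add: vf_in_def)

lemma form_in_chart:
  "smooth_manifold M \<Longrightarrow> c \<in> atlas M \<Longrightarrow> x \<in> fst c \<Longrightarrow> form_in M c \<alpha> (snd c x) = \<alpha> x o\<^sub>L from_chart M c x"
  by (simp add: form_in_def)

lemma tensor_in_chart:
  "smooth_manifold M \<Longrightarrow> c \<in> atlas M \<Longrightarrow> x \<in> fst c \<Longrightarrow>
    tensor_in M c r (snd c x) = to_chart M c x o\<^sub>L r x o\<^sub>L from_chart M c x"
  by (simp add: tensor_in_def)

lemma transition_smooth:
  assumes M: "smooth_manifold M" and c: "c \<in> atlas M" and d: "d \<in> atlas M"
  shows "open (snd c ` (fst c \<inter> fst d))" "smooth_on (snd c ` (fst c \<inter> fst d)) (snd d \<circ> chart_inv c)"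
proof -
  show "open (snd c ` (fst c \<inter> fst d))"
    by (intro chart_image_open[OF M c]) (use chart_open[OF M c] chart_open[OF M d] in auto)
  show "smooth_on (snd c ` (fst c \<inter> fst d)) (snd d \<circ> chart_inv c)"
    using M c d unfolding smooth_manifold_def by blast
qed

text \<open>In another chart the representation is the given one along the transition map,
  multiplied by the Jacobian of the reverse transition. So one chart that covers \<open>U\<close>
  decides smoothness.\<close>

lemma smooth_vf_on_chartI:
  assumes M: "smooth_manifold M" and c: "c \<in> atlas M" and U: "openin (mtop M) U" "U \<subseteq> fst c"
    and X: "smooth_on (snd c ` U) (vf_in M c X)"
  shows "smooth_vf_on M U X"
  unfolding smooth_vf_on_def
proof
  fix d assume d: "d \<in> atlas M"
  let ?S = "snd d ` (fst d \<inter> U)"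
  have S: "open ?S" using chart_image_open[OF M d, of "fst d \<inter> U"] U chart_open[OF M d] by auto
  let ?\<tau> = "snd c \<circ> chart_inv d" let ?\<sigma> = "snd d \<circ> chart_inv c"
  have \<tau>: "smooth_on ?S ?\<tau>"
    by (rule smooth_on_subset[OF transition_smooth(2)[OF M d c]]) (use U(2) in auto)
  have cU: "open (snd c ` U)" using chart_image_open[OF M c U] .
  have im: "?\<tau> ` ?S \<subseteq> snd c ` U" using M d by auto
  have 1: "smooth_on ?S (\<lambda>y. vf_in M c X (?\<tau> y))"
    by (rule smooth_on_compose[OF S cU im \<tau> X])
  have 2: "smooth_on ?S (\<lambda>y. fderiv ?\<sigma> (?\<tau> y))"
  proof (rule smooth_on_compose[OF S transition_smooth(1)[OF M c d] _ \<tau>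
        smooth_on_fderiv[OF transition_smooth(1)[OF M c d] transition_smooth(2)[OF M c d]]])
    show "?\<tau> ` ?S \<subseteq> snd c ` (fst c \<inter> fst d)" using M d U(2) by auto
  qed
  show "smooth_on ?S (vf_in M d X)"
  proof (rule smooth_on_cong[OF S _ smooth_on_blinfun_apply[OF S 2 1]])
    fix y assume "y \<in> ?S"
    then obtain x where x: "x \<in> fst d" "x \<in> U" "y = snd d x" by auto
    have xc: "x \<in> fst c" using U(2) x by blast
    then have xM: "x \<in> carrier M" using chart_subset_carrier[OF M c] by blast
    have "fderiv ?\<sigma> (?\<tau> y) (vf_in M c X (?\<tau> y)) = cderiv c d (\<lambda>x. x) x (to_chart M c x (X x))"
      using x xc M c d by (simp add: vf_in_chart cderiv_def comp_def)
    also have "\<dots> = to_chart M d x (X x)"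
      using cderiv_change[OF M chart_at[OF M xM] c xc d x(1)] unfolding to_chart_cderiv
      by (metis blinfun_apply_blinfun_compose)
    finally show "fderiv ?\<sigma> (?\<tau> y) (vf_in M c X (?\<tau> y)) = vf_in M d X y"
      using x M d by (simp add: vf_in_chart)
  qed
qed

lemma smooth_form_on_chartI:
  assumes M: "smooth_manifold M" and c: "c \<in> atlas M" and U: "openin (mtop M) U" "U \<subseteq> fst c"
    and \<alpha>: "smooth_on (snd c ` U) (form_in M c \<alpha>)"
  shows "smooth_form_on M U \<alpha>"
  unfolding smooth_form_on_def
proof
  fix d assume d: "d \<in> atlas M"
  let ?S = "snd d ` (fst d \<inter> U)"
  have S: "open ?S" using chart_image_open[OF M d, of "fst d \<inter> U"] U chart_open[OF M d] by auto
  let ?\<tau> = "snd c \<circ> chart_inv d"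
  have \<tau>: "smooth_on ?S ?\<tau>"
    by (rule smooth_on_subset[OF transition_smooth(2)[OF M d c]]) (use U(2) in auto)
  have cU: "open (snd c ` U)" using chart_image_open[OF M c U] .
  have im: "?\<tau> ` ?S \<subseteq> snd c ` U" using M d by auto
  have 1: "smooth_on ?S (\<lambda>y. form_in M c \<alpha> (?\<tau> y))"
    by (rule smooth_on_compose[OF S cU im \<tau> \<alpha>])
  show "smooth_on ?S (form_in M d \<alpha>)"
  proof (rule smooth_on_cong[OF S _ smooth_on_blinfun_compose[OF S 1 smooth_on_fderiv[OF S \<tau>]]])
    fix y assume "y \<in> ?S"
    then obtain x where x: "x \<in> fst d" "x \<in> U" "y = snd d x" by auto
    have xc: "x \<in> fst c" using U(2) x by blast
    then have xM: "x \<in> carrier M" using chart_subset_carrier[OF M c] by blast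
    have "form_in M c \<alpha> (?\<tau> y) o\<^sub>L fderiv ?\<tau> y = (\<alpha> x o\<^sub>L from_chart M c x) o\<^sub>L cderiv d c (\<lambda>x. x) x"
      using x xc M c d by (simp add: form_in_chart cderiv_def comp_def)
    also have "\<dots> = \<alpha> x o\<^sub>L from_chart M d x"
      using cderiv_change[OF M d x(1) c xc chart_at[OF M xM]] unfolding from_chart_cderiv
      by (intro blinfun_eqI) (metis blinfun_apply_blinfun_compose)
    finally show "form_in M c \<alpha> (?\<tau> y) o\<^sub>L fderiv ?\<tau> y = form_in M d \<alpha> y"
      using x M d by (simp add: form_in_chart)
  qed
qed

lemma smooth_vf_on_locally:
  assumes M: "smooth_manifold M"
    and X: "\<And>x. x \<in> U \<Longrightarrow> \<exists>V. openin (mtop M) V \<and> x \<in> V \<and> smooth_vf_on M V X"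
  shows "smooth_vf_on M U X"
  unfolding smooth_vf_on_def
proof (intro ballI smooth_on_locally)
  fix c y assume c: "c \<in> atlas M" and "y \<in> snd c ` (fst c \<inter> U)"
  then obtain x V where x: "x \<in> fst c" "y = snd c x" and V: "openin (mtop M) V" "x \<in> V" "smooth_vf_on M V X"
    using X by blast
  have "open (snd c ` (fst c \<inter> V))"
    by (intro chart_image_open[OF M c]) (use V chart_open[OF M c] in auto)
  then show "\<exists>W. open W \<and> y \<in> W \<and> smooth_on W (vf_in M c X)"
    using x V c by (intro exI[of _ "snd c ` (fst c \<inter> V)"]) (auto simp: smooth_vf_on_def)
qed

lemma smooth_form_on_locally:
  assumes M: "smooth_manifold M"
    and \<alpha>: "\<And>x. x \<in> U \<Longrightarrow> \<exists>V. openin (mtop M) V \<and> x \<in> V \<and> smooth_form_on M V \<alpha>"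
  shows "smooth_form_on M U \<alpha>"
  unfolding smooth_form_on_def
proof (intro ballI smooth_on_locally)
  fix c y assume c: "c \<in> atlas M" and "y \<in> snd c ` (fst c \<inter> U)"
  then obtain x V where x: "x \<in> fst c" "y = snd c x" and V: "openin (mtop M) V" "x \<in> V" "smooth_form_on M V \<alpha>"
    using \<alpha> by blast
  have "open (snd c ` (fst c \<inter> V))"
    by (intro chart_image_open[OF M c]) (use V chart_open[OF M c] in auto)
  then show "\<exists>W. open W \<and> y \<in> W \<and> smooth_on W (form_in M c \<alpha>)"
    using x V c by (intro exI[of _ "snd c ` (fst c \<inter> V)"]) (auto simp: smooth_form_on_def)
qed

lemma smooth_vf_on_zero:
  assumes M: "smooth_manifold M" and U: "openin (mtop M) U" and X: "\<And>x. x \<in> U \<Longrightarrow> X x = 0"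
  shows "smooth_vf_on M U X"
  unfolding smooth_vf_on_def
proof
  fix c assume c: "c \<in> atlas M"
  have "open (snd c ` (fst c \<inter> U))"
    by (intro chart_image_open[OF M c]) (use U chart_open[OF M c] in auto)
  then show "smooth_on (snd c ` (fst c \<inter> U)) (vf_in M c X)"
    by (rule smooth_on_cong[OF _ _ smooth_on_const[of _ 0]])
      (use M c X in \<open>auto simp: vf_in_chart blinfun.zero_right\<close>)
qed

lemma smooth_form_on_zero:
  assumes M: "smooth_manifold M" and U: "openin (mtop M) U" and \<alpha>: "\<And>x. x \<in> U \<Longrightarrow> \<alpha> x = 0"
  shows "smooth_form_on M U \<alpha>"
  unfolding smooth_form_on_def
proof
  fix c assume c: "c \<in> atlas M"
  have "open (snd c ` (fst c \<inter> U))"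
    by (intro chart_image_open[OF M c]) (use U chart_open[OF M c] in auto)
  then show "smooth_on (snd c ` (fst c \<inter> U)) (form_in M c \<alpha>)"
    by (rule smooth_on_cong[OF _ _ smooth_on_const[of _ 0]])
      (use M c \<alpha> in \<open>auto simp: form_in_chart intro!: blinfun_eqI\<close>)
qed

lemma vector_field_smooth:
  assumes "smooth_manifold M" "c \<in> atlas M" "X \<in> vector_fields M"
  shows "smooth_on (snd c ` fst c) (vf_in M c X)"
  using assms chart_subset_carrier[OF assms(1,2)]
  by (auto simp: vector_fields_def smooth_vf_on_def Int_absorb2)

lemma one_form_smooth:
  assumes "smooth_manifold M" "c \<in> atlas M" "\<alpha> \<in> one_forms M"
  shows "smooth_on (snd c ` fst c) (form_in M c \<alpha>)"
  using assms chart_subset_carrier[OF assms(1,2)]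
  by (auto simp: one_forms_def smooth_form_on_def Int_absorb2)

lemma vector_fieldI:
  assumes M: "smooth_manifold M"
    and "\<And>c. c \<in> atlas M \<Longrightarrow> smooth_on (snd c ` fst c) (vf_in M c X)"
  shows "X \<in> vector_fields M"
  using assms(2) chart_subset_carrier[OF M]
  by (simp add: vector_fields_def smooth_vf_on_def Int_absorb2)

lemma one_formI:
  assumes M: "smooth_manifold M"
    and "\<And>c. c \<in> atlas M \<Longrightarrow> smooth_on (snd c ` fst c) (form_in M c \<alpha>)"
  shows "\<alpha> \<in> one_forms M"
  using assms(2) chart_subset_carrier[OF M]
  by (simp add: one_forms_def smooth_form_on_def Int_absorb2)

lemma chart_range_open:
  "smooth_manifold M \<Longrightarrow> c \<in> atlas M \<Longrightarrow> open (snd c ` fst c)"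
  unfolding smooth_manifold_def by blast

lemma apply_tensor_vector_field:
  assumes M: "smooth_manifold M" and r: "r \<in> tensor_fields M" and X: "X \<in> vector_fields M"
  shows "apply_tensor r X \<in> vector_fields M"
proof (rule vector_fieldI[OF M])
  fix c assume c: "c \<in> atlas M"
  have o: "open (snd c ` fst c)" using chart_range_open[OF M c] .
  have "smooth_on (snd c ` fst c) (tensor_in M c r)" using r c by (simp add: tensor_fields_def)
  then show "smooth_on (snd c ` fst c) (vf_in M c (apply_tensor r X))"
    by (rule smooth_on_cong[OF o _ smooth_on_blinfun_apply[OF o _ vector_field_smooth[OF M c X]], rotated])
      (use M c in \<open>auto simp: vf_in_chart tensor_in_chart apply_tensor_def\<close>)
qed

lemma dual_tensor_one_form:
  assumes M: "smooth_manifold M" and r: "r \<in> tensor_fields M" and \<alpha>: "\<alpha> \<in> one_forms M"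
  shows "dual_tensor r \<alpha> \<in> one_forms M"
proof (rule one_formI[OF M])
  fix c assume c: "c \<in> atlas M"
  have o: "open (snd c ` fst c)" using chart_range_open[OF M c] .
  have "smooth_on (snd c ` fst c) (tensor_in M c r)" using r c by (simp add: tensor_fields_def)
  then show "smooth_on (snd c ` fst c) (form_in M c (dual_tensor r \<alpha>))"
    by (rule smooth_on_cong[OF o _ smooth_on_blinfun_compose[OF o one_form_smooth[OF M c \<alpha>]], rotated])
      (use M c in \<open>auto simp: form_in_chart tensor_in_chart dual_tensor_def intro!: blinfun_eqI\<close>)
qed


section \<open>Brackets and Lie derivatives of related fields on manifolds\<close>

lemma vf_in_chart_at:
  assumes "smooth_manifold M" "x \<in> carrier M"
  shows "vf_in M (chart_at M x) X (snd (chart_at M x) x) = X x"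
  using assms by (simp add: vf_in_chart chart_at)

lemma form_in_chart_at:
  assumes "smooth_manifold M" "x \<in> carrier M"
  shows "form_in M (chart_at M x) \<alpha> (snd (chart_at M x) x) = \<alpha> x"
  using assms by (intro blinfun_eqI) (simp add: form_in_chart chart_at)

lemma lie_bracket_in_chart:
  assumes M: "smooth_manifold M" and x: "x \<in> carrier M" and X: "X \<in> vector_fields M" and Y: "Y \<in> vector_fields M"
  shows "lie_bracket M X Y x = fderiv (vf_in M (chart_at M x) Y) (snd (chart_at M x) x) (X x)
    - fderiv (vf_in M (chart_at M x) X) (snd (chart_at M x) x) (Y x)"
proof -
  have "vf_in M (chart_at M x) Z differentiable (at (snd (chart_at M x) x))" if "Z \<in> vector_fields M" for Z
    by (rule smooth_on_differentiable[OF vector_field_smooth[OF M chart_at(1)[OF M x] that]])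
      (use chart_at(2)[OF M x] in blast)
  then show ?thesis using X Y by (simp add: lie_bracket_def vf_deriv_def fderiv_apply)
qed

lemma lie_form_in_chart:
  assumes M: "smooth_manifold M" and x: "x \<in> carrier M" and \<alpha>: "\<alpha> \<in> one_forms M"
  shows "lie_form M X \<alpha> x = fderiv (form_in M (chart_at M x) \<alpha>) (snd (chart_at M x) x) (X x)
    + (\<alpha> x o\<^sub>L fderiv (vf_in M (chart_at M x) X) (snd (chart_at M x) x))"
proof -
  have "form_in M (chart_at M x) \<alpha> differentiable (at (snd (chart_at M x) x))"
    by (rule smooth_on_differentiable[OF one_form_smooth[OF M chart_at(1)[OF M x] \<alpha>]])
      (use chart_at(2)[OF M x] in blast)
  then show ?thesis by (simp add: lie_form_def form_deriv_def vf_deriv_def fderiv_apply fderiv_def[of "vf_in M (chart_at M x) X"])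
qed

lemma cderiv_vf_in:
  assumes M: "smooth_manifold M" and N: "smooth_manifold N" and f: "smooth_map M N f"
    and c: "c \<in> atlas M" "x \<in> fst c" and d: "d \<in> atlas N" "f x \<in> fst d"
  shows "cderiv c d f x (vf_in M c X (snd c x)) = to_chart N d (f x) (tangent_map M N f x (X x))"
  using assms by (simp add: cderiv_tangent_map[OF assms] vf_in_chart)

text \<open>\<open>PX\<close> and \<open>PY\<close> are coordinate expressions of the pushforwards,
  as functions on the source. They need not come from vector fields on \<open>N\<close>; this covers
  \<open>r X\<close> before \<open>r\<close> is known to descend.\<close>

lemma tangent_lie_bracket:
  assumes M: "smooth_manifold M" and N: "smooth_manifold N" and f: "smooth_map M N f"
    and X: "X \<in> vector_fields M" and Y: "Y \<in> vector_fields M"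
    and U: "openin (mtop M) U" "x \<in> U"
    and c: "c = chart_at M x" and d: "d = chart_at N (f x)"
    and PX: "\<And>z. z \<in> U \<Longrightarrow> z \<in> fst c \<Longrightarrow> f z \<in> fst d \<Longrightarrow> PX (snd c z) = to_chart N d (f z) (tangent_map M N f z (X z))"
    and PY: "\<And>z. z \<in> U \<Longrightarrow> z \<in> fst c \<Longrightarrow> f z \<in> fst d \<Longrightarrow> PY (snd c z) = to_chart N d (f z) (tangent_map M N f z (Y z))"
  shows "tangent_map M N f x (lie_bracket M X Y x) = fderiv PY (snd c x) (X x) - fderiv PX (snd c x) (Y x)"
proof -
  have x: "x \<in> carrier M" using openin_subset[OF U(1)] U(2) by blast
  have fx: "f x \<in> carrier N" using smooth_map_in_carrier[OF f x] .
  have cc: "c \<in> atlas M" "x \<in> fst c" and dd: "d \<in> atlas N" "f x \<in> fst d"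
    using chart_at[OF M x] chart_at[OF N fx] by (auto simp: c d)
  let ?O = "{z \<in> fst c. f z \<in> fst d}"
  let ?W = "snd c ` (?O \<inter> U)"
  let ?\<phi> = "snd d \<circ> f \<circ> chart_inv c"
  have W: "open ?W" "snd c x \<in> ?W"
    using chart_image_open[OF M cc(1), of "?O \<inter> U"] smooth_map_domain_open[OF M N f cc(1) dd(1)] U cc dd by auto
  have \<phi>: "smooth_on ?W ?\<phi>"
    by (rule smooth_on_subset[OF smooth_map_rep[OF f cc(1) dd(1)]]) auto
  have diff: "vf_in M c Z differentiable (at (snd c x))" if "Z \<in> vector_fields M" for Z
    by (rule smooth_on_differentiable[OF vector_field_smooth[OF M cc(1) that]]) (use cc in blast)
  have P: "fderiv ?\<phi> z (vf_in M c X z) = PX z" "fderiv ?\<phi> z (vf_in M c Y z) = PY z" if "z \<in> ?W" for z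
    using that PX PY cderiv_vf_in[OF M N f cc(1) _ dd(1)] by (auto simp: cderiv_def)
  have "tangent_map M N f x (lie_bracket M X Y x) =
    fderiv ?\<phi> (snd c x) (fderiv (vf_in M c Y) (snd c x) (vf_in M c X (snd c x)) - fderiv (vf_in M c X) (snd c x) (vf_in M c Y (snd c x)))"
    unfolding lie_bracket_in_chart[OF M x X Y] tangent_map_cderiv c[symmetric] d[symmetric]
      vf_in_chart_at[OF M x, folded c] cderiv_def ..
  also have "\<dots> = fderiv (\<lambda>z. fderiv ?\<phi> z (vf_in M c Y z)) (snd c x) (vf_in M c X (snd c x)) -
      fderiv (\<lambda>z. fderiv ?\<phi> z (vf_in M c X z)) (snd c x) (vf_in M c Y (snd c x))"
    by (rule pushforward_bracket[OF W \<phi> diff[OF X] diff[OF Y]])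
  also have "fderiv (\<lambda>z. fderiv ?\<phi> z (vf_in M c Y z)) (snd c x) = fderiv PY (snd c x)"
    by (rule fderiv_cong_open[OF W]) (rule P)
  also have "fderiv (\<lambda>z. fderiv ?\<phi> z (vf_in M c X z)) (snd c x) = fderiv PX (snd c x)"
    by (rule fderiv_cong_open[OF W]) (rule P)
  also note vf_in_chart_at[OF M x, folded c]
  also note vf_in_chart_at[OF M x, folded c]
  finally show ?thesis .
qed

text \<open>The case where \<open>PX\<close> and \<open>PY\<close> are fields on \<open>N\<close>
  along the map. Relatedness is asked for near \<open>x\<close> only, since lifts made global by a
  cutoff are related only there.\<close>

lemma related_lie_bracket:
  assumes M: "smooth_manifold M" and N: "smooth_manifold N" and f: "smooth_map M N f"
    and X: "X \<in> vector_fields M" and Y: "Y \<in> vector_fields M"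
    and X': "X' \<in> vector_fields N" and Y': "Y' \<in> vector_fields N"
    and U: "openin (mtop M) U" "x \<in> U"
    and relX: "\<And>z. z \<in> U \<Longrightarrow> tangent_map M N f z (X z) = X' (f z)"
    and relY: "\<And>z. z \<in> U \<Longrightarrow> tangent_map M N f z (Y z) = Y' (f z)"
  shows "tangent_map M N f x (lie_bracket M X Y x) = lie_bracket N X' Y' (f x)"
proof -
  have x: "x \<in> carrier M" using openin_subset[OF U(1)] U(2) by blast
  have fx: "f x \<in> carrier N" using smooth_map_in_carrier[OF f x] .
  let ?c = "chart_at M x" let ?d = "chart_at N (f x)"
  let ?\<phi> = "snd ?d \<circ> f \<circ> chart_inv ?c"
  have \<phi>x: "?\<phi> (snd ?c x) = snd ?d (f x)" using chart_at[OF M x] M by simp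
  have D: "(?\<phi> has_derivative tangent_map M N f x) (at (snd ?c x))"
    unfolding tangent_map_cderiv cderiv_def
    by (rule fderiv_works[OF smooth_on_differentiable[OF smooth_map_rep[OF f chart_at(1)[OF M x] chart_at(1)[OF N fx]]]])
      (use chart_at[OF M x] chart_at[OF N fx] in auto)
  have E: "fderiv (\<lambda>y. vf_in N ?d Z (?\<phi> y)) (snd ?c x) v = fderiv (vf_in N ?d Z) (snd ?d (f x)) (tangent_map M N f x v)"
    if "Z \<in> vector_fields N" for Z v
  proof -
    have "vf_in N ?d Z differentiable (at (?\<phi> (snd ?c x)))" unfolding \<phi>x
      by (rule smooth_on_differentiable[OF vector_field_smooth[OF N chart_at(1)[OF N fx] that]])
        (use chart_at(2)[OF N fx] in blast)
    from fun_cong[OF fderiv_unique[OF has_derivative_compose[OF D fderiv_works[OF this]]]]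
    show ?thesis unfolding \<phi>x .
  qed
  have "tangent_map M N f x (lie_bracket M X Y x) =
    fderiv (\<lambda>y. vf_in N ?d Y' (?\<phi> y)) (snd ?c x) (X x) - fderiv (\<lambda>y. vf_in N ?d X' (?\<phi> y)) (snd ?c x) (Y x)"
    by (rule tangent_lie_bracket[OF M N f X Y U refl refl])
      (use relX relY chart_at[OF M x] chart_at[OF N fx] M N in \<open>auto simp: vf_in_chart\<close>)
  also have "\<dots> = lie_bracket N X' Y' (f x)"
    unfolding E[OF X'] E[OF Y'] relX[OF U(2)] relY[OF U(2)] lie_bracket_in_chart[OF N fx X' Y'] ..
  finally show ?thesis .
qed

lemma related_lie_form:
  assumes M: "smooth_manifold M" and N: "smooth_manifold N" and f: "smooth_map M N f"
    and X: "X \<in> vector_fields M" and \<alpha>: "\<alpha> \<in> one_forms M"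
    and X': "X' \<in> vector_fields N" and \<alpha>': "\<alpha>' \<in> one_forms N"
    and U: "openin (mtop M) U" "x \<in> U"
    and relX: "\<And>z. z \<in> U \<Longrightarrow> tangent_map M N f z (X z) = X' (f z)"
    and rel\<alpha>: "\<And>z. z \<in> U \<Longrightarrow> \<alpha> z = \<alpha>' (f z) o\<^sub>L tangent_map M N f z"
  shows "lie_form M X \<alpha> x = lie_form N X' \<alpha>' (f x) o\<^sub>L tangent_map M N f x"
proof -
  have x: "x \<in> carrier M" using openin_subset[OF U(1)] U(2) by blast
  have fx: "f x \<in> carrier N" using smooth_map_in_carrier[OF f x] .
  define c where "c = chart_at M x" define d where "d = chart_at N (f x)"
  have cc: "c \<in> atlas M" "x \<in> fst c" and dd: "d \<in> atlas N" "f x \<in> fst d"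
    using chart_at[OF M x] chart_at[OF N fx] by (auto simp: c_def d_def)
  let ?O = "{z \<in> fst c. f z \<in> fst d}"
  let ?W = "snd c ` (?O \<inter> U)"
  let ?\<phi> = "snd d \<circ> f \<circ> chart_inv c"
  have W: "open ?W" "snd c x \<in> ?W"
    using chart_image_open[OF M cc(1), of "?O \<inter> U"] smooth_map_domain_open[OF M N f cc(1) dd(1)] U cc dd by auto
  have \<phi>: "smooth_on ?W ?\<phi>"
    by (rule smooth_on_subset[OF smooth_map_rep[OF f cc(1) dd(1)]]) auto
  have \<phi>x: "?\<phi> (snd c x) = snd d (f x)" using cc M by simp
  have T: "fderiv ?\<phi> (snd c x) = tangent_map M N f x"
    by (simp add: tangent_map_cderiv cderiv_def c_def d_def)
  have "fderiv (form_in M c \<alpha>) (snd c x) (vf_in M c X (snd c x)) + (form_in M c \<alpha> (snd c x) o\<^sub>L fderiv (vf_in M c X) (snd c x)) =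
    (fderiv (form_in N d \<alpha>') (?\<phi> (snd c x)) (vf_in N d X' (?\<phi> (snd c x))) +
      (form_in N d \<alpha>' (?\<phi> (snd c x)) o\<^sub>L fderiv (vf_in N d X') (?\<phi> (snd c x)))) o\<^sub>L fderiv ?\<phi> (snd c x)"
  proof (rule pullback_lie_derivative[OF W \<phi>])
    show "vf_in M c X differentiable (at (snd c x))"
      by (rule smooth_on_differentiable[OF vector_field_smooth[OF M cc(1) X]]) (use cc in blast)
    show "vf_in N d X' differentiable (at (?\<phi> (snd c x)))" unfolding \<phi>x
      by (rule smooth_on_differentiable[OF vector_field_smooth[OF N dd(1) X']]) (use dd in blast)
    show "form_in N d \<alpha>' differentiable (at (?\<phi> (snd c x)))" unfolding \<phi>x
      by (rule smooth_on_differentiable[OF one_form_smooth[OF N dd(1) \<alpha>']]) (use dd in blast)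
    fix y assume "y \<in> ?W"
    then obtain z where z: "z \<in> fst c" "f z \<in> fst d" "z \<in> U" "y = snd c z" by auto
    show "fderiv ?\<phi> y (vf_in M c X y) = vf_in N d X' (?\<phi> y)"
      using cderiv_vf_in[OF M N f cc(1) z(1) dd(1) z(2)] relX[OF z(3)] z M N cc dd
      by (simp add: cderiv_def vf_in_chart)
    show "form_in M c \<alpha> y = form_in N d \<alpha>' (?\<phi> y) o\<^sub>L fderiv ?\<phi> y"
      using cderiv_tangent_map[OF M N f cc(1) z(1) dd(1) z(2)] rel\<alpha>[OF z(3)] z M N cc dd
      by (intro blinfun_eqI) (simp add: cderiv_def form_in_chart)
  qed
  from this[unfolded \<phi>x T, unfolded c_def d_def vf_in_chart_at[OF M x] vf_in_chart_at[OF N fx]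
      form_in_chart_at[OF M x] form_in_chart_at[OF N fx]]
  show ?thesis unfolding lie_form_in_chart[OF M x \<alpha>] lie_form_in_chart[OF N fx \<alpha>'] .
qed

lemma lie_bracket_zero:
  assumes "smooth_manifold M" "x \<in> carrier M" "X \<in> vector_fields M"
  shows "lie_bracket M (\<lambda>_. 0) X x = 0"
proof -
  have "vf_in M c (\<lambda>_. 0) = (\<lambda>_. 0)" for c by (rule ext) (simp add: vf_in_def Let_def blinfun.zero_right)
  moreover have "(\<lambda>_. 0) \<in> vector_fields M" using smooth_vf_on_zero[OF assms(1)] by (simp add: vector_fields_def)
  ultimately show ?thesis using lie_bracket_in_chart[OF assms(1,2) _ assms(3)] by (simp add: blinfun.zero_right)
qed

lemma lie_form_zero:
  assumes "smooth_manifold M" "x \<in> carrier M"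
  shows "lie_form M X (\<lambda>_. 0) x = 0"
proof -
  have "form_in M c (\<lambda>_. 0) = (\<lambda>_. 0)" for c by (rule ext) (auto simp: form_in_def Let_def intro!: blinfun_eqI)
  moreover have "(\<lambda>_. 0) \<in> one_forms M" using smooth_form_on_zero[OF assms(1)] by (simp add: one_forms_def)
  ultimately show ?thesis using lie_form_in_chart[OF assms] by (auto intro!: blinfun_eqI)
qed

section \<open>Extending local fields by bump functions\<close>

text \<open>One cutoff \<open>b\<close> is offered for all \<open>F\<close> and all
  \<open>A\<close>, so that a vector field and a one-form can be cut off together.\<close>

lemma local_extension:
  assumes M: "smooth_manifold M" and c: "c \<in> atlas M" "x0 \<in> fst c"
    and W: "open W" "snd c x0 \<in> W" "W \<subseteq> snd c ` fst c"
  obtains b U where "openin (mtop M) U" "x0 \<in> U" "\<And>x. x \<in> U \<Longrightarrow> x \<in> fst c \<and> snd c x \<in> W \<and> b x = 1"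
    "\<And>x. b x \<noteq> 0 \<Longrightarrow> x \<in> fst c \<and> snd c x \<in> W"
    "\<And>F. smooth_on W F \<Longrightarrow> (\<lambda>x. b x *\<^sub>R from_chart M c x (F (snd c x))) \<in> vector_fields M"
    "\<And>A. smooth_on W A \<Longrightarrow> (\<lambda>x. b x *\<^sub>R (A (snd c x) o\<^sub>L to_chart M c x)) \<in> one_forms M"
proof -
  obtain e where e: "e > 0" "cball (snd c x0) e \<subseteq> W" using W open_contains_cball by blast
  obtain \<beta> \<delta> where \<beta>: "smooth_on UNIV \<beta>" "\<delta> > 0" "\<And>y. y \<in> ball (snd c x0) \<delta> \<Longrightarrow> \<beta> y = 1"
    "\<And>y. dist (snd c x0) y \<ge> e \<Longrightarrow> \<beta> y = (0::real)"
    using smooth_bump_exists[OF e(1), of "snd c x0"] by blast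
  \<comment> \<open>Outside its domain \<open>snd c\<close> is arbitrary and could take values in
    \<open>W\<close>, so membership in the domain has to be tested as well.\<close>
  define b where "b = (\<lambda>x. if x \<in> fst c \<and> snd c x \<in> W then \<beta> (snd c x) else 0)"
  let ?V = "{x \<in> fst c. snd c x \<in> W}"
  let ?S = "{x \<in> fst c. snd c x \<in> cball (snd c x0) e}"
  have V: "openin (mtop M) ?V" by (rule chart_preimage_open[OF M c(1) W(1)])
  have "snd c ` ?S = cball (snd c x0) e" using e W by auto
  moreover have "compactin (top_of_set (snd c ` fst c)) (cball (snd c x0) e)"
    using e(2) W(3) by (auto simp: compactin_subtopology)
  moreover have "?S \<subseteq> topspace (subtopology (mtop M) (fst c))" using chart_subset_carrier[OF M c(1)] by auto
  ultimately have "compactin (subtopology (mtop M) (fst c)) ?S"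
    using homeomorphic_map_compactness[OF chart_homeomorphic[OF M c(1)]] by metis
  then have "compactin (mtop M) ?S" by (simp add: compactin_subtopology)
  \<comment> \<open>The Hausdorff property enters here: the compact set outside of which
    \<open>b\<close> vanishes is closed in \<open>M\<close>, so the extension by zero is smooth on
    an open complement that together with \<open>?V\<close> covers \<open>M\<close>.\<close>
  then have "closedin (mtop M) ?S" using M by (simp add: smooth_manifold_def compactin_imp_closedin)
  then have S: "openin (mtop M) (carrier M - ?S)" by blast
  have zero: "b x = 0" if "x \<notin> ?S" for x using that \<beta>(4)[of "snd c x"] by (auto simp: b_def)
  let ?U = "?V \<inter> {x \<in> fst c. snd c x \<in> ball (snd c x0) \<delta>}"
  have cover: "x \<in> ?V \<or> x \<in> carrier M - ?S" if "x \<in> carrier M" for x using that e(2) by auto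
  have cV: "snd c ` ?V = W" using W(3) by auto
  have "(\<lambda>x. b x *\<^sub>R from_chart M c x (F (snd c x))) \<in> vector_fields M" (is "?X \<in> _") if F: "smooth_on W F" for F
    unfolding vector_fields_def mem_Collect_eq
  proof (rule smooth_vf_on_locally[OF M])
    have "smooth_on W (\<lambda>y. \<beta> y *\<^sub>R F y)"
      using \<beta>(1) by (intro smooth_on_scaleR W(1) F) (auto intro: smooth_on_subset)
    then have "smooth_on (snd c ` ?V) (vf_in M c ?X)"
      unfolding cV by (rule smooth_on_cong[OF W(1), rotated])
        (use W(3) M c in \<open>auto simp: vf_in_chart b_def blinfun.scaleR_right\<close>)
    then have 1: "smooth_vf_on M ?V ?X" by (intro smooth_vf_on_chartI[OF M c(1) V]) auto
    have 2: "smooth_vf_on M (carrier M - ?S) ?X"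
      using zero by (intro smooth_vf_on_zero[OF M S]) auto
    show "\<exists>V. openin (mtop M) V \<and> x \<in> V \<and> smooth_vf_on M V ?X" if "x \<in> carrier M" for x
      using cover[OF that] 1 2 V S by blast
  qed
  moreover have "(\<lambda>x. b x *\<^sub>R (A (snd c x) o\<^sub>L to_chart M c x)) \<in> one_forms M" (is "?\<alpha> \<in> _") if A: "smooth_on W A" for A
    unfolding one_forms_def mem_Collect_eq
  proof (rule smooth_form_on_locally[OF M])
    have "smooth_on W (\<lambda>y. \<beta> y *\<^sub>R A y)"
      using \<beta>(1) by (intro smooth_on_scaleR W(1) A) (auto intro: smooth_on_subset)
    then have "smooth_on (snd c ` ?V) (form_in M c ?\<alpha>)"
      unfolding cV by (rule smooth_on_cong[OF W(1), rotated])
        (use W(3) M c in \<open>auto simp: form_in_chart b_def blinfun.scaleR_left intro!: blinfun_eqI\<close>)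
    then have 1: "smooth_form_on M ?V ?\<alpha>" by (intro smooth_form_on_chartI[OF M c(1) V]) auto
    have 2: "smooth_form_on M (carrier M - ?S) ?\<alpha>"
      using zero by (intro smooth_form_on_zero[OF M S]) auto
    show "\<exists>V. openin (mtop M) V \<and> x \<in> V \<and> smooth_form_on M V ?\<alpha>" if "x \<in> carrier M" for x
      using cover[OF that] 1 2 V S by blast
  qed
  moreover have "openin (mtop M) ?U" using V chart_preimage_open[OF M c(1)] by blast
  moreover have "x0 \<in> ?U" using c W \<beta>(2) by simp
  moreover have "x \<in> fst c \<and> snd c x \<in> W \<and> b x = 1" if "x \<in> ?U" for x using that \<beta>(3) by (simp add: b_def)
  moreover have "x \<in> fst c \<and> snd c x \<in> W" if "b x \<noteq> 0" for x using that by (simp add: b_def split: if_splits)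
  ultimately show ?thesis by (rule that[rotated 4])
qed


section \<open>Submersions\<close>

locale submersion =
  fixes M :: "('p, 'e::finite_dim_inner) manifold" and Q :: "('q, 'f::finite_dim_inner) manifold"
    and \<psi> :: "'p \<Rightarrow> 'q"
  assumes M: "smooth_manifold M" and Q: "smooth_manifold Q" and submersion: "surjective_submersion M Q \<psi>"
begin

abbreviation T :: "'p \<Rightarrow> 'e \<Rightarrow>\<^sub>L 'f" where "T \<equiv> tangent_map M Q \<psi>"

lemma smooth_\<psi>: "smooth_map M Q \<psi>"
  and surj_T: "x \<in> carrier M \<Longrightarrow> surj (T x)"
  using submersion by (auto simp: surjective_submersion_def)

lemma \<psi>_carrier: "x \<in> carrier M \<Longrightarrow> \<psi> x \<in> carrier Q"
  using smooth_map_in_carrier[OF smooth_\<psi>] .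

lemma fibre_nonempty: "q \<in> carrier Q \<Longrightarrow> \<exists>x\<in>carrier M. \<psi> x = q"
  using submersion unfolding surjective_submersion_def by (metis imageE)

lemma T_from_chart:
  assumes "c \<in> atlas M" "x \<in> fst c" "d \<in> atlas Q" "\<psi> x \<in> fst d"
  shows "T x (from_chart M c x v) = from_chart Q d (\<psi> x) (cderiv c d \<psi> x v)"
  using cderiv_tangent_map[OF M Q smooth_\<psi> assms] assms Q by simp

lemma surj_cderiv:
  assumes "c \<in> atlas M" "x \<in> fst c" "d \<in> atlas Q" "\<psi> x \<in> fst d"
  shows "surj (cderiv c d \<psi> x)"
proof (rule surjI)
  have x: "x \<in> carrier M" using assms chart_subset_carrier[OF M] by blast
  fix w
  show "cderiv c d \<psi> x (to_chart M c x (inv (T x) (from_chart Q d (\<psi> x) w))) = w"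
    using cderiv_tangent_map[OF M Q smooth_\<psi> assms] assms M Q surj_f_inv_f[OF surj_T[OF x]] by simp
qed

text \<open>The operator \<open>s\<close> is a smooth choice of horizontal lift in coordinates. It
  is used to lift fields, to project onto vertical directions and to represent
  \<open>B\<close>.\<close>

lemma local_splitting:
  assumes c: "c \<in> atlas M" "x0 \<in> fst c" and d: "d \<in> atlas Q" "\<psi> x0 \<in> fst d"
  obtains W s where "open W" "snd c x0 \<in> W" "W \<subseteq> snd c ` {x \<in> fst c. \<psi> x \<in> fst d}" "smooth_on W s"
    "\<And>x. x \<in> fst c \<Longrightarrow> snd c x \<in> W \<Longrightarrow> \<psi> x \<in> fst d \<and> cderiv c d \<psi> x o\<^sub>L s (snd c x) = id_blinfun"
proof -
  let ?O = "snd c ` {x \<in> fst c. \<psi> x \<in> fst d}" let ?\<phi> = "snd d \<circ> \<psi> \<circ> chart_inv c"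
  have O: "open ?O" "snd c x0 \<in> ?O" using smooth_map_open_image[OF M Q smooth_\<psi> c(1) d(1)] c d by auto
  have "surj (fderiv ?\<phi> (snd c x0))" using surj_cderiv[OF c d] by (simp add: cderiv_def)
  from smooth_local_right_inverse[OF O smooth_on_fderiv[OF O(1) smooth_map_rep[OF smooth_\<psi> c(1) d(1)]] this]
  obtain W s where W: "open W" "snd c x0 \<in> W" "W \<subseteq> ?O" "smooth_on W s"
    "\<And>y. y \<in> W \<Longrightarrow> fderiv ?\<phi> y o\<^sub>L s y = id_blinfun" by blast
  have "\<psi> x \<in> fst d \<and> cderiv c d \<psi> x o\<^sub>L s (snd c x) = id_blinfun" if x: "x \<in> fst c" "snd c x \<in> W" for x
  proof -
    obtain x' where x': "x' \<in> fst c" "\<psi> x' \<in> fst d" "snd c x = snd c x'" using W(3) x by auto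
    then have "x = x'" using chart_inv_chart[OF M c(1)] x(1) by metis
    then show ?thesis using x' W(5)[OF x(2)] by (simp add: cderiv_def)
  qed
  then show ?thesis using that[OF W(1-4)] by blast
qed

text \<open>Vector fields are lifted by \<open>s\<close> and one-forms are pulled back, with the
  same factor \<open>b\<close> for all of them; thus a lift and a pulled-back form can be combined
  to a section of \<open>L\<close>.\<close>

lemma lift_exists:
  assumes x0: "x0 \<in> carrier M"
  shows "\<exists>b U. openin (mtop M) U \<and> x0 \<in> U \<and> (\<forall>x\<in>U. b x = (1::real)) \<and>
    (\<forall>X\<in>vector_fields Q. \<exists>Y\<in>vector_fields M. \<forall>x\<in>carrier M. T x (Y x) = b x *\<^sub>R X (\<psi> x)) \<and>
    (\<forall>\<alpha>\<in>one_forms Q. (\<lambda>x. b x *\<^sub>R (\<alpha> (\<psi> x) o\<^sub>L T x)) \<in> one_forms M)"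
proof -
  define c where "c = chart_at M x0" define d where "d = chart_at Q (\<psi> x0)"
  have c: "c \<in> atlas M" "x0 \<in> fst c" and d: "d \<in> atlas Q" "\<psi> x0 \<in> fst d"
    using chart_at[OF M x0] chart_at[OF Q \<psi>_carrier[OF x0]] by (auto simp: c_def d_def)
  let ?O = "snd c ` {x \<in> fst c. \<psi> x \<in> fst d}" let ?\<phi> = "snd d \<circ> \<psi> \<circ> chart_inv c"
  obtain W s where W: "open W" "snd c x0 \<in> W" "W \<subseteq> ?O" "smooth_on W s"
    and s: "\<And>x. x \<in> fst c \<Longrightarrow> snd c x \<in> W \<Longrightarrow> \<psi> x \<in> fst d \<and> cderiv c d \<psi> x o\<^sub>L s (snd c x) = id_blinfun"
    by (rule local_splitting[OF c d]) blast
  have \<phi>: "smooth_on W ?\<phi>" using smooth_on_subset[OF smooth_map_rep[OF smooth_\<psi> c(1) d(1)] W(3)] .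
  have im: "?\<phi> ` W \<subseteq> snd d ` fst d" using W(3) M c by auto
  have WC: "W \<subseteq> snd c ` fst c" using W(3) by auto
  obtain b U where U: "openin (mtop M) U" "x0 \<in> U" "\<And>x. x \<in> U \<Longrightarrow> x \<in> fst c \<and> snd c x \<in> W \<and> b x = 1"
    and b: "\<And>x. b x \<noteq> 0 \<Longrightarrow> x \<in> fst c \<and> snd c x \<in> W"
    and extv: "\<And>F. smooth_on W F \<Longrightarrow> (\<lambda>x. b x *\<^sub>R from_chart M c x (F (snd c x))) \<in> vector_fields M"
    and extf: "\<And>A. smooth_on W A \<Longrightarrow> (\<lambda>x. b x *\<^sub>R (A (snd c x) o\<^sub>L to_chart M c x)) \<in> one_forms M"
    by (rule local_extension[OF M c W(1,2) WC]) blast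
  have "\<exists>Y\<in>vector_fields M. \<forall>x\<in>carrier M. T x (Y x) = b x *\<^sub>R X (\<psi> x)" if X: "X \<in> vector_fields Q" for X
  proof -
    have "smooth_on W (\<lambda>y. s y (vf_in Q d X (?\<phi> y)))"
      by (intro smooth_on_blinfun_apply W(1,4) smooth_on_compose[OF W(1) chart_range_open[OF Q d(1)] im \<phi> vector_field_smooth[OF Q d(1) X]])
    from extv[OF this] have Y: "(\<lambda>x. b x *\<^sub>R from_chart M c x (s (snd c x) (vf_in Q d X (?\<phi> (snd c x))))) \<in> vector_fields M" .
    have "T x (b x *\<^sub>R from_chart M c x (s (snd c x) (vf_in Q d X (?\<phi> (snd c x))))) = b x *\<^sub>R X (\<psi> x)" for x
    proof (cases "b x = 0")
      case False
      from b[OF this] have x: "x \<in> fst c" "snd c x \<in> W" by auto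
      have "cderiv c d \<psi> x (s (snd c x) w) = w" for w
        using s[OF x] by (metis blinfun_apply_blinfun_compose blinfun_apply_id_blinfun)
      then show ?thesis using s[OF x] x c d M Q by (simp add: blinfun.scaleR_right T_from_chart[OF c(1) x(1) d(1)] vf_in_chart)
    qed (simp add: blinfun.zero_right)
    then show ?thesis by (intro bexI[OF _ Y]) simp
  qed
  moreover have "(\<lambda>x. b x *\<^sub>R (\<alpha> (\<psi> x) o\<^sub>L T x)) \<in> one_forms M" if \<alpha>: "\<alpha> \<in> one_forms Q" for \<alpha>
  proof -
    have "smooth_on W (\<lambda>y. form_in Q d \<alpha> (?\<phi> y) o\<^sub>L fderiv ?\<phi> y)"
      by (intro smooth_on_blinfun_compose W(1) smooth_on_fderiv[OF W(1) \<phi>]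
          smooth_on_compose[OF W(1) chart_range_open[OF Q d(1)] im \<phi> one_form_smooth[OF Q d(1) \<alpha>]])
    from extf[OF this] have "(\<lambda>x. b x *\<^sub>R ((form_in Q d \<alpha> (?\<phi> (snd c x)) o\<^sub>L fderiv ?\<phi> (snd c x)) o\<^sub>L to_chart M c x)) \<in> one_forms M" .
    moreover have "(\<lambda>x. b x *\<^sub>R ((form_in Q d \<alpha> (?\<phi> (snd c x)) o\<^sub>L fderiv ?\<phi> (snd c x)) o\<^sub>L to_chart M c x)) =
        (\<lambda>x. b x *\<^sub>R (\<alpha> (\<psi> x) o\<^sub>L T x))"
    proof (rule ext)
      fix x show "b x *\<^sub>R ((form_in Q d \<alpha> (?\<phi> (snd c x)) o\<^sub>L fderiv ?\<phi> (snd c x)) o\<^sub>L to_chart M c x) = b x *\<^sub>R (\<alpha> (\<psi> x) o\<^sub>L T x)"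
      proof (cases "b x = 0")
        case False
        from b[OF this] have x: "x \<in> fst c" "snd c x \<in> W" by auto
        have "\<psi> x \<in> fst d" using s[OF x] by blast
        then have "fderiv ?\<phi> (snd c x) = to_chart Q d (\<psi> x) o\<^sub>L T x o\<^sub>L from_chart M c x"
          using cderiv_tangent_map[OF M Q smooth_\<psi> c(1) x(1) d(1)] by (simp add: cderiv_def)
        then have "(form_in Q d \<alpha> (?\<phi> (snd c x)) o\<^sub>L fderiv ?\<phi> (snd c x)) o\<^sub>L to_chart M c x = \<alpha> (\<psi> x) o\<^sub>L T x"
          using \<open>\<psi> x \<in> fst d\<close> x c d M Q by (intro blinfun_eqI) (simp add: form_in_chart)
        then show ?thesis by simp
      qed simp
    qed
    ultimately show ?thesis by (simp only:)
  qed
  ultimately show ?thesis using U by blast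
qed

text \<open>From the field with constant coordinates \<open>v\<close> its horizontal part is
  subtracted. At \<open>x0\<close> that part is zero, so the value there remains
  \<open>v\<close>.\<close>

lemma vertical_extension:
  assumes x0: "x0 \<in> carrier M" and v: "T x0 v = 0"
  shows "\<exists>Y\<in>vector_fields M. Y x0 = v \<and> (\<forall>x\<in>carrier M. T x (Y x) = 0)"
proof -
  define c where "c = chart_at M x0" define d where "d = chart_at Q (\<psi> x0)"
  have c: "c \<in> atlas M" "x0 \<in> fst c" and d: "d \<in> atlas Q" "\<psi> x0 \<in> fst d"
    using chart_at[OF M x0] chart_at[OF Q \<psi>_carrier[OF x0]] by (auto simp: c_def d_def)
  let ?O = "snd c ` {x \<in> fst c. \<psi> x \<in> fst d}" let ?\<phi> = "snd d \<circ> \<psi> \<circ> chart_inv c"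
  obtain W s where W: "open W" "snd c x0 \<in> W" "W \<subseteq> ?O" "smooth_on W s"
    and s: "\<And>x. x \<in> fst c \<Longrightarrow> snd c x \<in> W \<Longrightarrow> \<psi> x \<in> fst d \<and> cderiv c d \<psi> x o\<^sub>L s (snd c x) = id_blinfun"
    by (rule local_splitting[OF c d]) blast
  have \<phi>: "smooth_on W ?\<phi>" using smooth_on_subset[OF smooth_map_rep[OF smooth_\<psi> c(1) d(1)] W(3)] .
  have WC: "W \<subseteq> snd c ` fst c" using W(3) by auto
  obtain b U where U: "openin (mtop M) U" "x0 \<in> U" "\<And>x. x \<in> U \<Longrightarrow> x \<in> fst c \<and> snd c x \<in> W \<and> b x = 1"
    and b: "\<And>x. b x \<noteq> 0 \<Longrightarrow> x \<in> fst c \<and> snd c x \<in> W"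
    and extv: "\<And>F. smooth_on W F \<Longrightarrow> (\<lambda>x. b x *\<^sub>R from_chart M c x (F (snd c x))) \<in> vector_fields M"
    and extf: "\<And>A. smooth_on W A \<Longrightarrow> (\<lambda>x. b x *\<^sub>R (A (snd c x) o\<^sub>L to_chart M c x)) \<in> one_forms M"
    by (rule local_extension[OF M c W(1,2) WC]) blast
  have "smooth_on W (\<lambda>y. v - s y (fderiv ?\<phi> y v))"
    by (intro smooth_on_diff smooth_on_const smooth_on_blinfun_apply W(1,4) smooth_on_fderiv[OF W(1) \<phi>])
  from extv[OF this] have Y: "(\<lambda>x. b x *\<^sub>R from_chart M c x (v - s (snd c x) (fderiv ?\<phi> (snd c x) v))) \<in> vector_fields M" (is "?Y \<in> _") .
  have "T x (?Y x) = 0" for x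
  proof (cases "b x = 0")
    case False
    from b[OF this] have x: "x \<in> fst c" "snd c x \<in> W" by auto
    have "cderiv c d \<psi> x (s (snd c x) w) = w" for w
      using s[OF x] by (metis blinfun_apply_blinfun_compose blinfun_apply_id_blinfun)
    then have "cderiv c d \<psi> x (v - s (snd c x) (fderiv ?\<phi> (snd c x) v)) = 0"
      by (simp add: blinfun.diff_right) (simp add: cderiv_def)
    then show ?thesis using s[OF x] by (simp add: blinfun.scaleR_right T_from_chart[OF c(1) x(1) d(1)] blinfun.zero_right)
  qed (simp add: blinfun.zero_right)
  moreover have "?Y x0 = v"
  proof -
    have "fderiv ?\<phi> (snd c x0) v = 0" using v by (simp add: tangent_map_cderiv c_def d_def cderiv_def)
    then show ?thesis using U M x0 by (simp add: blinfun.zero_right c_def)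
  qed
  ultimately show ?thesis by (intro bexI[OF _ Y]) simp
qed

text \<open>In straightened coordinates \<psi> is affine with linear part \<open>?A\<close>, and a
  right inverse of \<open>?A\<close> gives an affine section.\<close>

lemma local_section:
  assumes x0: "x0 \<in> carrier M" and c: "c \<in> atlas M" "x0 \<in> fst c" and d: "d \<in> atlas Q" "\<psi> x0 \<in> fst d"
    and W: "open W" "snd c x0 \<in> W" "W \<subseteq> snd c ` {x \<in> fst c. \<psi> x \<in> fst d}"
  shows "\<exists>V \<sigma>. open V \<and> snd d (\<psi> x0) \<in> V \<and> smooth_on V \<sigma> \<and> \<sigma> ` V \<subseteq> W \<and>
    (\<forall>y\<in>V. snd d (\<psi> (chart_inv c (\<sigma> y))) = y)"
proof -
  let ?\<phi> = "snd d \<circ> \<psi> \<circ> chart_inv c"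
  have \<phi>: "smooth_on W ?\<phi>" using smooth_on_subset[OF smooth_map_rep[OF smooth_\<psi> c(1) d(1)] W(3)] .
  let ?A = "fderiv ?\<phi> (snd c x0)"
  have surj: "surj ?A" using surj_cderiv[OF c d] by (simp add: cderiv_def)
  obtain S where S: "?A o\<^sub>L S = id_blinfun" using surj_blinfun_right_inverse[OF surj] by blast
  then have AS: "?A (S v) = v" for v by (metis blinfun_apply_blinfun_compose blinfun_apply_id_blinfun)
  obtain V \<Psi> where V: "open V" "0 \<in> V" "smooth_on V \<Psi>" "\<Psi> ` V \<subseteq> W"
    and \<Psi>: "\<And>y. y \<in> V \<Longrightarrow> ?\<phi> (\<Psi> y) = ?\<phi> (snd c x0) + ?A y"
    using submersion_straightening[OF W(1,2) \<phi> surj] by blast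
  have eq: "?\<phi> (snd c x0) = snd d (\<psi> x0)" using M c by simp
  define l where "l = (\<lambda>y. S (y - snd d (\<psi> x0)))"
  define V' where "V' = l -` V"
  have l: "smooth_on UNIV l" unfolding l_def
    by (intro smooth_on_bounded_linear[OF blinfun.bounded_linear_right] smooth_on_diff smooth_on_ident smooth_on_const open_UNIV)
  have V': "open V'" unfolding V'_def using open_vimage[OF V(1)] smooth_on_continuous[OF l] by blast
  have "smooth_on V' (\<lambda>y. \<Psi> (l y))"
    by (rule smooth_on_compose[OF V' V(1) _ smooth_on_subset[OF l] V(3)]) (auto simp: V'_def)
  moreover have "snd d (\<psi> (chart_inv c (\<Psi> (l y)))) = y" if "y \<in> V'" for y
    using \<Psi>[of "l y"] that AS by (simp add: V'_def eq[unfolded comp_apply] l_def)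
  moreover have "snd d (\<psi> x0) \<in> V'" using V(2) by (simp add: V'_def l_def blinfun.zero_right)
  ultimately show ?thesis using V' V(4) by (intro exI[of _ V'] exI[of _ "\<lambda>y. \<Psi> (l y)"]) (auto simp: V'_def)
qed

text \<open>In straightened coordinates the line through 0 in a kernel direction stays in the fibre,
  and its image starts with velocity \<open>v\<close> because the derivative of \<Psi> at 0 is the
  identity. Continuity of \<gamma>' later keeps transversality near time 0.\<close>

lemma curve_in_fibre:
  assumes c: "c \<in> atlas M" "x0 \<in> fst c" and d: "d \<in> atlas Q" "\<psi> x0 \<in> fst d"
    and W: "open W" "snd c x0 \<in> W" "W \<subseteq> snd c ` {x \<in> fst c. \<psi> x \<in> fst d}"
    and v: "cderiv c d \<psi> x0 v = 0"
  shows "\<exists>I \<gamma> \<gamma>'. open I \<and> (0::real) \<in> I \<and> \<gamma> 0 = snd c x0 \<and> \<gamma>' 0 = v \<and> continuous_on I \<gamma>' \<and>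
    (\<forall>t\<in>I. (\<gamma> has_derivative (\<lambda>h. h *\<^sub>R \<gamma>' t)) (at t) \<and> \<gamma> t \<in> W \<and> \<psi> (chart_inv c (\<gamma> t)) = \<psi> x0)"
proof -
  let ?\<phi> = "snd d \<circ> \<psi> \<circ> chart_inv c"
  have \<phi>: "smooth_on W ?\<phi>" using smooth_on_subset[OF smooth_map_rep[OF smooth_\<psi> c(1) d(1)] W(3)] .
  let ?A = "fderiv ?\<phi> (snd c x0)"
  have surj: "surj ?A" using surj_cderiv[OF c d] by (simp add: cderiv_def)
  obtain V \<Psi> where V: "open V" "0 \<in> V" "smooth_on V \<Psi>" "\<Psi> ` V \<subseteq> W" "\<Psi> 0 = snd c x0" "fderiv \<Psi> 0 = id_blinfun"
    and \<Psi>: "\<And>y. y \<in> V \<Longrightarrow> ?\<phi> (\<Psi> y) = ?\<phi> (snd c x0) + ?A y"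
    using submersion_straightening[OF W(1,2) \<phi> surj] by blast
  define I where "I = (\<lambda>t. t *\<^sub>R v) -` V"
  have I: "open I" unfolding I_def by (intro open_vimage V(1) continuous_intros)
  have "continuous_on I (\<lambda>t. fderiv \<Psi> (t *\<^sub>R v))"
    by (rule continuous_on_compose2[OF smooth_on_continuous[OF smooth_on_fderiv[OF V(1,3)]]])
      (auto simp: I_def intro: continuous_intros)
  then have "continuous_on I (\<lambda>t. fderiv \<Psi> (t *\<^sub>R v) v)" by (intro continuous_intros)
  moreover have "((\<lambda>t. \<Psi> (t *\<^sub>R v)) has_derivative (\<lambda>h. h *\<^sub>R fderiv \<Psi> (t *\<^sub>R v) v)) (at t)" if "t \<in> I" for t
  proof -
    have "(\<Psi> has_derivative fderiv \<Psi> (t *\<^sub>R v)) (at (t *\<^sub>R v))"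
      by (rule fderiv_works[OF smooth_on_differentiable[OF V(3)]]) (use that in \<open>simp add: I_def\<close>)
    moreover have "((\<lambda>t. t *\<^sub>R v) has_derivative (\<lambda>h. h *\<^sub>R v)) (at t)" by (auto intro!: derivative_eq_intros)
    ultimately show ?thesis using has_derivative_compose by (fastforce simp: blinfun.scaleR_right)
  qed
  moreover have "\<Psi> (t *\<^sub>R v) \<in> W \<and> \<psi> (chart_inv c (\<Psi> (t *\<^sub>R v))) = \<psi> x0" if "t \<in> I" for t
  proof -
    have tV: "t *\<^sub>R v \<in> V" using that by (simp add: I_def)
    then have inW: "\<Psi> (t *\<^sub>R v) \<in> W" using V(4) by blast
    then obtain x where x: "x \<in> fst c" "\<psi> x \<in> fst d" "\<Psi> (t *\<^sub>R v) = snd c x" using W(3) by auto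
    have "?A (t *\<^sub>R v) = 0" using v by (simp add: cderiv_def blinfun.scaleR_right)
    then have "snd d (\<psi> x) = snd d (\<psi> x0)" using \<Psi>[OF tV] x M c by simp
    then have "\<psi> x = \<psi> x0" using chart_inv_chart[OF Q d(1)] x d by metis
    then show ?thesis using inW x M c by simp
  qed
  ultimately show ?thesis using I V
    by (intro exI[of _ I] exI[of _ "\<lambda>t. \<Psi> (t *\<^sub>R v)"] exI[of _ "\<lambda>t. fderiv \<Psi> (t *\<^sub>R v) v"]) (auto simp: I_def)
qed

end

section \<open>Leaves\<close>

text \<open>The function is constant on the preimages of coordinate balls, so its level sets are
  open and closed.\<close>

lemma locally_constant_on_connected:
  assumes N: "smooth_manifold N" and con: "connected_space (mtop N)"
    and h: "\<And>n x. n \<in> atlas N \<Longrightarrow> x \<in> fst n \<Longrightarrow> ((h \<circ> chart_inv n) has_derivative (\<lambda>_. 0)) (at (snd n x))"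
    and x: "x \<in> carrier N" and y: "y \<in> carrier N"
  shows "h x = h y"
proof -
  have loc: "\<exists>V. openin (mtop N) V \<and> z \<in> V \<and> (\<forall>w\<in>V. h w = h z)" if z: "z \<in> carrier N" for z
  proof -
    let ?n = "chart_at N z"
    have n: "?n \<in> atlas N" "z \<in> fst ?n" using chart_at[OF N z] .
    obtain e where e: "e > 0" "ball (snd ?n z) e \<subseteq> snd ?n ` fst ?n"
      using chart_range_open[OF N n(1)] n(2) open_contains_ball by blast
    have "\<exists>k. \<forall>u\<in>ball (snd ?n z) e. (h \<circ> chart_inv ?n) u = k"
    proof (rule has_derivative_zero_constant[OF convex_ball])
      fix u assume "u \<in> ball (snd ?n z) e"
      then obtain w where "w \<in> fst ?n" "u = snd ?n w" using e by auto
      then show "((h \<circ> chart_inv ?n) has_derivative (\<lambda>h. 0)) (at u within ball (snd ?n z) e)"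
        using h[OF n(1)] has_derivative_at_withinI by blast
    qed
    then obtain k where k: "\<And>u. u \<in> ball (snd ?n z) e \<Longrightarrow> h (chart_inv ?n u) = k" by auto
    have "h w = k" if "w \<in> fst ?n" "snd ?n w \<in> ball (snd ?n z) e" for w
      using k[OF that(2)] N n that(1) by simp
    moreover have "z \<in> {w \<in> fst ?n. snd ?n w \<in> ball (snd ?n z) e}" using n e by simp
    ultimately show ?thesis
      by (intro exI[of _ "{w \<in> fst ?n. snd ?n w \<in> ball (snd ?n z) e}"] conjI chart_preimage_open[OF N n(1)])
        (auto simp del: mem_ball)
  qed
  let ?A = "{z \<in> carrier N. h z = h x}"
  have "openin (mtop N) ?A"
  proof (subst openin_subopen, rule ballI)
    fix z assume z: "z \<in> ?A"
    then have "z \<in> carrier N" by simp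
    from loc[OF this] obtain V where V: "openin (mtop N) V" "z \<in> V" "\<forall>w\<in>V. h w = h z" by (elim exE conjE)
    have "w \<in> ?A" if "w \<in> V" for w
      using bspec[OF V(3) that] z openin_subset[OF V(1)] that by auto
    then show "\<exists>T. openin (mtop N) T \<and> z \<in> T \<and> T \<subseteq> ?A" using V(1,2) by blast
  qed
  moreover have "openin (mtop N) (carrier N - ?A)"
  proof (subst openin_subopen, rule ballI)
    fix z assume z: "z \<in> carrier N - ?A"
    then have "z \<in> carrier N" by simp
    from loc[OF this] obtain V where V: "openin (mtop N) V" "z \<in> V" "\<forall>w\<in>V. h w = h z" by (elim exE conjE)
    have "w \<in> carrier N - ?A" if "w \<in> V" for w
      using bspec[OF V(3) that] z openin_subset[OF V(1)] that by auto
    then show "\<exists>T. openin (mtop N) T \<and> z \<in> T \<and> T \<subseteq> carrier N - ?A" using V(1,2) by blast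
  qed
  then have "closedin (mtop N) ?A" unfolding closedin_def by blast
  ultimately have "?A = {} \<or> ?A = carrier N" using con unfolding connected_space_clopen_in by blast
  then show ?thesis using x y by (metis (mono_tags, lifting) empty_iff mem_Collect_eq)
qed

text \<open>What is isolated are the points (t, x t) in the product of the line with
  \<open>X\<close>; choosing basic neighbourhoods sends t injectively to a pair of basis elements.
  Since \<open>x\<close> may be any function, this applies to a curve whose continuity in the leaf
  topology is not known.\<close>

lemma countable_if_isolated:
  fixes I :: "real set" and X :: "'p topology"
  assumes X: "second_countable X"
    and iso: "\<And>t. t \<in> I \<Longrightarrow> \<exists>J B. open J \<and> t \<in> J \<and> openin X B \<and> x t \<in> B \<and> (\<forall>s\<in>I. s \<in> J \<and> x s \<in> B \<longrightarrow> s = t)"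
  shows "countable I"
proof -
  obtain \<B> where \<B>: "countable \<B>" "\<And>U z. openin X U \<Longrightarrow> z \<in> U \<Longrightarrow> \<exists>V\<in>\<B>. z \<in> V \<and> V \<subseteq> U"
    using X unfolding second_countable_def by metis
  obtain \<C> :: "real set set" where \<C>: "countable \<C>" "topological_basis \<C>" using ex_countable_basis by blast
  have "\<exists>p. p \<in> \<C> \<times> \<B> \<and> t \<in> fst p \<and> x t \<in> snd p \<and> (\<forall>s\<in>I. s \<in> fst p \<and> x s \<in> snd p \<longrightarrow> s = t)" if t: "t \<in> I" for t
  proof -
    obtain J B where JB: "open J" "t \<in> J" "openin X B" "x t \<in> B" "\<And>s. s \<in> I \<Longrightarrow> s \<in> J \<Longrightarrow> x s \<in> B \<Longrightarrow> s = t"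
      using iso[OF t] by blast
    obtain J' where "J' \<in> \<C>" "t \<in> J'" "J' \<subseteq> J" using topological_basisE[OF \<C>(2) JB(1,2)] by blast
    moreover obtain B' where "B' \<in> \<B>" "x t \<in> B'" "B' \<subseteq> B" using \<B>(2)[OF JB(3,4)] by blast
    ultimately show ?thesis using JB(5) by (intro exI[of _ "(J', B')"]) auto
  qed
  then obtain p where p: "\<And>t. t \<in> I \<Longrightarrow> p t \<in> \<C> \<times> \<B>" "\<And>t. t \<in> I \<Longrightarrow> t \<in> fst (p t) \<and> x t \<in> snd (p t)"
    "\<And>t s. t \<in> I \<Longrightarrow> s \<in> I \<Longrightarrow> s \<in> fst (p t) \<Longrightarrow> x s \<in> snd (p t) \<Longrightarrow> s = t" by metis
  have "inj_on p I" using p(2,3) by (metis inj_onI)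
  moreover have "countable (p ` I)"
    by (rule countable_subset[OF image_subsetI[OF p(1)] countable_SIGMA[OF \<C>(1) \<B>(1)]])
  ultimately show ?thesis by (rule countable_image_inj_on[rotated])
qed


section \<open>Leaf spaces of Dirac structures\<close>

text \<open>The point type of \<open>Q\<close> is left abstract: of the leaf space only the fact
  that the fibres of \<psi> are the leaves is retained.\<close>

locale dirac_quotient = submersion M Q \<psi>
  for M :: "('p, 'e::finite_dim_inner) manifold" and Q :: "('q, 'f::finite_dim_inner) manifold"
    and \<psi> :: "'p \<Rightarrow> 'q" +
  fixes L :: "('p, 'e) subbundle" and F :: "('p, 'g::finite_dim_inner) manifold set"
  assumes dirac: "dirac M L" and foliation: "foliation_of M (null_distribution L) F"
    and fibres: "x \<in> carrier M \<Longrightarrow> y \<in> carrier M \<Longrightarrow> \<psi> x = \<psi> y \<longleftrightarrow> (\<exists>N\<in>F. x \<in> carrier N \<and> y \<in> carrier N)"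
begin

abbreviation K :: "'p \<Rightarrow> 'e set" where "K \<equiv> null_distribution L"

lemma L_orthogonal: "x \<in> carrier M \<Longrightarrow> L x = orthogonal_space (L x)"
  using dirac by (simp add: dirac_def)

text \<open>Membership in \<open>L x\<close> becomes a system of linear equations, from which
  closure under sums and multiples is read off.\<close>

lemma L_iff: "x \<in> carrier M \<Longrightarrow> a \<in> L x \<longleftrightarrow> (\<forall>b\<in>L x. pairing b a = 0)"
  by (subst L_orthogonal) (simp_all add: orthogonal_space_def)

lemma L_add: "x \<in> carrier M \<Longrightarrow> (v, \<alpha>) \<in> L x \<Longrightarrow> (w, \<beta>) \<in> L x \<Longrightarrow> (v + w, \<alpha> + \<beta>) \<in> L x"
  by (simp add: L_iff pairing_def blinfun.add_left blinfun.add_right) (smt (verit) fst_conv snd_conv)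

lemma L_scaleR: "x \<in> carrier M \<Longrightarrow> (v, \<alpha>) \<in> L x \<Longrightarrow> (s *\<^sub>R v, s *\<^sub>R \<alpha>) \<in> L x"
  by (simp add: L_iff pairing_def blinfun.scaleR_left blinfun.scaleR_right flip: distrib_left)

lemma leafE:
  assumes x: "x \<in> carrier M"
  obtains N where "N \<in> F" "x \<in> carrier N" "integral_manifold M K N" "carrier N \<subseteq> carrier M"
    "\<And>y. y \<in> carrier M \<Longrightarrow> \<psi> y = \<psi> x \<longleftrightarrow> y \<in> carrier N"
proof -
  have part: "partition_on (carrier M) (leaves F)" and int: "\<And>N. N \<in> F \<Longrightarrow> integral_manifold M K N"
    using foliation by (auto simp: foliation_of_def)
  obtain N where N: "N \<in> F" "x \<in> carrier N" using x partition_onD1[OF part] by auto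
  have "\<psi> y = \<psi> x \<longleftrightarrow> y \<in> carrier N" if y: "y \<in> carrier M" for y
  proof
    assume "\<psi> y = \<psi> x"
    then obtain N' where N': "N' \<in> F" "x \<in> carrier N'" "y \<in> carrier N'" using fibres[OF y x] by blast
    then have "carrier N = carrier N'"
      using disjointD[OF partition_onD2[OF part], of "carrier N" "carrier N'"] N by blast
    then show "y \<in> carrier N" using N' by blast
  qed (use fibres[OF y x] N in blast)
  then show ?thesis using that[OF N int[OF N(1)]] int[OF N(1)] by (simp add: integral_manifold_def)
qed

text \<open>Composed with the inclusion of the leaf, \<psi> is constant, and the derivative of the
  inclusion has image \<open>K x\<close>.\<close>

lemma K_imp_kernel:
  assumes x: "x \<in> carrier M" and v: "v \<in> K x"
  shows "T x v = 0"
proof -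
  obtain N where "N \<in> F" and N: "x \<in> carrier N" "integral_manifold M K N" "carrier N \<subseteq> carrier M"
    "\<And>y. y \<in> carrier M \<Longrightarrow> \<psi> y = \<psi> x \<longleftrightarrow> y \<in> carrier N" using leafE[OF x] by blast
  then have mN: "smooth_manifold N" and inc: "smooth_map N M (\<lambda>x. x)"
    and ran: "range (tangent_map N M (\<lambda>x. x) x) = K x" by (auto simp: integral_manifold_def)
  let ?n = "chart_at N x" let ?d = "chart_at Q (\<psi> x)"
  have n: "?n \<in> atlas N" "x \<in> fst ?n" using chart_at[OF mN N(1)] .
  have d: "?d \<in> atlas Q" "\<psi> x \<in> fst ?d" using chart_at[OF Q \<psi>_carrier[OF x]] .
  obtain u where u: "v = tangent_map N M (\<lambda>x. x) x u" using v ran by blast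
  have "T x v = cderiv ?n ?d (\<lambda>x. \<psi> x) x u"
    using cderiv_chain[OF mN M Q inc smooth_\<psi> n chart_at[OF M x] d]
    unfolding u tangent_map_cderiv by simp
  also have "cderiv ?n ?d (\<lambda>x. \<psi> x) x = fderiv (\<lambda>_. snd ?d (\<psi> x)) (snd ?n x)" unfolding cderiv_def
  proof (rule fderiv_cong_open[OF chart_range_open[OF mN n(1)]])
    fix y assume "y \<in> snd ?n ` fst ?n"
    then obtain z where z: "z \<in> fst ?n" "y = snd ?n z" by blast
    then have "z \<in> carrier N" using chart_subset_carrier[OF mN n(1)] by blast
    then have "\<psi> z = \<psi> x" using N by blast
    then show "(snd ?d \<circ> (\<lambda>x. \<psi> x) \<circ> chart_inv ?n) y = snd ?d (\<psi> x)" using z mN n by simp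
  qed (use n in blast)
  finally show ?thesis by simp
qed

text \<open>Since \<open>L x\<close> is its own orthogonal space, (v, 0) belongs to it exactly when
  v is annihilated by all covector parts of \<open>L x\<close>, and those of a local frame suffice.
  Being outside of \<open>K\<close> is thereby an open condition.\<close>

lemma K_local_equations:
  assumes x0: "x0 \<in> carrier M"
  obtains U k \<alpha> where "openin (mtop M) U" "x0 \<in> U" "\<And>i. i < (k::nat) \<Longrightarrow> smooth_form_on M U (\<alpha> i)"
    "\<And>x v. x \<in> U \<Longrightarrow> v \<in> K x \<longleftrightarrow> (\<forall>i<k. \<alpha> i x v = 0)"
proof -
  obtain k where k: "\<forall>x\<^sub>0\<in>carrier M. \<exists>U X \<alpha>. openin (mtop M) U \<and> x\<^sub>0 \<in> U \<and>
        (\<forall>i<k. smooth_vf_on M U (X i) \<and> smooth_form_on M U (\<alpha> i)) \<and>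
        (\<forall>x\<in>U. inj_on (\<lambda>i::nat. (X i x, \<alpha> i x)) {..<k} \<and>
           independent ((\<lambda>i. (X i x, \<alpha> i x)) ` {..<k}) \<and>
           span ((\<lambda>i. (X i x, \<alpha> i x)) ` {..<k}) = L x)"
    using dirac unfolding dirac_def smooth_subbundle_def by blast
  obtain U X \<alpha> where U: "openin (mtop M) U" "x0 \<in> U" "\<forall>i<k. smooth_vf_on M U (X i) \<and> smooth_form_on M U (\<alpha> i)"
    and span: "\<forall>x\<in>U. inj_on (\<lambda>i::nat. (X i x, \<alpha> i x)) {..<k} \<and>
           independent ((\<lambda>i. (X i x, \<alpha> i x)) ` {..<k}) \<and> span ((\<lambda>i. (X i x, \<alpha> i x)) ` {..<k}) = L x"
    using bspec[OF k x0] by (elim exE conjE)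
  have "v \<in> K x \<longleftrightarrow> (\<forall>i<k. \<alpha> i x v = 0)" if x: "x \<in> U" for x v
  proof -
    have xM: "x \<in> carrier M" using openin_subset[OF U(1)] x by blast
    have Lx: "span ((\<lambda>i. (X i x, \<alpha> i x)) ` {..<k}) = L x" using span x by blast
    have "v \<in> K x \<longleftrightarrow> (\<forall>b\<in>L x. blinfun_apply (snd b) v = 0)"
      unfolding null_distribution_def mem_Collect_eq L_iff[OF xM, of "(v, 0)"] by (simp add: pairing_def)
    also have "\<dots> \<longleftrightarrow> (\<forall>i<k. \<alpha> i x v = 0)"
    proof
      assume "\<forall>b\<in>L x. blinfun_apply (snd b) v = 0"
      moreover have "(X i x, \<alpha> i x) \<in> L x" if "i < k" for i
        unfolding Lx[symmetric] using that by (intro span_base) auto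
      ultimately show "\<forall>i<k. \<alpha> i x v = 0" by fastforce
    next
      assume *: "\<forall>i<k. \<alpha> i x v = 0"
      have "blinfun_apply (snd b) v = 0" if "b \<in> span ((\<lambda>i. (X i x, \<alpha> i x)) ` {..<k})" for b
      proof (rule span_induct[OF that])
        show "subspace {b. blinfun_apply (snd b) v = 0}"
          by (auto simp: subspace_def blinfun.add_left blinfun.scaleR_left)
        show "blinfun_apply (snd b) v = 0" if "b \<in> (\<lambda>i. (X i x, \<alpha> i x)) ` {..<k}" for b
          using * that by auto
      qed
      then show "\<forall>b\<in>L x. blinfun_apply (snd b) v = 0" unfolding Lx by blast
    qed
    finally show ?thesis .
  qed
  then show ?thesis using that[OF U(1,2), of k \<alpha>] U(3) by blast
qed

text \<open>
  A vector of the kernel outside of \<open>K\<close> would be tangent to a curve in a fibre that is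
  everywhere transversal to the leaf. The leaf meets such a curve in isolated points of its own
  second countable topology, that is in countably many points, although it contains the fibre.
\<close>

lemma kernel_imp_K:
  assumes x0: "x0 \<in> carrier M" and v: "T x0 v = 0"
  shows "v \<in> K x0"
proof (rule ccontr)
  assume nK: "v \<notin> K x0"
  obtain N where N: "N \<in> F" "x0 \<in> carrier N" "integral_manifold M K N" "carrier N \<subseteq> carrier M"
    and leaf: "\<And>y. y \<in> carrier M \<Longrightarrow> \<psi> y = \<psi> x0 \<longleftrightarrow> y \<in> carrier N" using leafE[OF x0] by blast
  have mN: "smooth_manifold N" and inc: "smooth_map N M (\<lambda>x. x)"
    and ran: "\<And>x. x \<in> carrier N \<Longrightarrow> inj (tangent_map N M (\<lambda>x. x) x) \<and> range (tangent_map N M (\<lambda>x. x) x) = K x"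
    using N(3) by (auto simp: integral_manifold_def)
  obtain U k \<alpha> where U: "openin (mtop M) U" "x0 \<in> U" "\<And>i. i < (k::nat) \<Longrightarrow> smooth_form_on M U (\<alpha> i)"
    and Keq: "\<And>x v. x \<in> U \<Longrightarrow> v \<in> K x \<longleftrightarrow> (\<forall>i<k. \<alpha> i x v = 0)" using K_local_equations[OF x0] by blast
  obtain i where i: "i < k" "\<alpha> i x0 v \<noteq> 0" using nK Keq[OF U(2)] by blast
  define c where "c = chart_at M x0" define d where "d = chart_at Q (\<psi> x0)"
  have c: "c \<in> atlas M" "x0 \<in> fst c" and d: "d \<in> atlas Q" "\<psi> x0 \<in> fst d"
    using chart_at[OF M x0] chart_at[OF Q \<psi>_carrier[OF x0]] by (auto simp: c_def d_def)
  let ?D = "{x \<in> fst c. \<psi> x \<in> fst d} \<inter> U"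
  have D: "openin (mtop M) ?D" using smooth_map_domain_open[OF M Q smooth_\<psi> c(1) d(1)] U(1) by blast
  let ?W = "snd c ` ?D"
  have W: "open ?W" "snd c x0 \<in> ?W" "?W \<subseteq> snd c ` {x \<in> fst c. \<psi> x \<in> fst d}"
    using chart_image_open[OF M c(1) D] c d U by auto
  have "cderiv c d \<psi> x0 v = 0" using v by (simp add: c_def d_def tangent_map_cderiv)
  from curve_in_fibre[OF c d W this] obtain I \<gamma> \<gamma>' where
    I: "open I" "(0::real) \<in> I" and \<gamma>0: "\<gamma> 0 = snd c x0" "\<gamma>' 0 = v" and cont: "continuous_on I \<gamma>'"
    and \<gamma>: "\<And>t. t \<in> I \<Longrightarrow> (\<gamma> has_derivative (\<lambda>h. h *\<^sub>R \<gamma>' t)) (at t)" "\<And>t. t \<in> I \<Longrightarrow> \<gamma> t \<in> ?W"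
      "\<And>t. t \<in> I \<Longrightarrow> \<psi> (chart_inv c (\<gamma> t)) = \<psi> x0" by blast
  define x where "x = (\<lambda>t. chart_inv c (\<gamma> t))"
  have x: "x t \<in> fst c" "x t \<in> U" "snd c (x t) = \<gamma> t" "x t \<in> carrier M" "x t \<in> carrier N" if t: "t \<in> I" for t
  proof -
    obtain z where z: "z \<in> fst c" "z \<in> U" "\<gamma> t = snd c z" using \<gamma>(2)[OF t] by auto
    then have "x t = z" using M c by (simp add: x_def)
    then show 1: "x t \<in> fst c" "x t \<in> U" "snd c (x t) = \<gamma> t" using z by auto
    show 2: "x t \<in> carrier M" using 1 chart_subset_carrier[OF M c(1)] by blast
    show "x t \<in> carrier N" using leaf[OF 2] \<gamma>(3)[OF t] by (simp add: x_def)
  qed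
  \<comment> \<open>One of the forms defining \<open>K\<close>, chosen to be nonzero on
    \<open>v\<close>, is evaluated on the velocity of the curve. It stays nonzero on the
    neighbourhood \<open>J\<close> of time 0, where the curve is transversal to
    \<open>K\<close>.\<close>
  define g where "g = (\<lambda>t. form_in M c (\<alpha> i) (\<gamma> t) (\<gamma>' t))"
  have contg: "continuous_on I g"
  proof -
    have "smooth_on (snd c ` (fst c \<inter> U)) (form_in M c (\<alpha> i))"
      using U(3)[OF i(1)] c(1) by (simp add: smooth_form_on_def)
    moreover have "continuous_on I \<gamma>"
      using \<gamma>(1) by (meson continuous_at_imp_continuous_on has_derivative_continuous)
    moreover have "\<gamma> ` I \<subseteq> snd c ` (fst c \<inter> U)" using \<gamma>(2) by auto
    ultimately have "continuous_on I (\<lambda>t. form_in M c (\<alpha> i) (\<gamma> t))"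
      using continuous_on_compose2[OF smooth_on_continuous] by metis
    then show ?thesis unfolding g_def by (intro continuous_intros cont)
  qed
  define J where "J = I \<inter> g -` (- {0})"
  have "open J" unfolding J_def using contg I(1) by (intro continuous_open_preimage) auto
  moreover have "0 \<in> J"
    using i(2) I(2) form_in_chart_at[OF M x0, of "\<alpha> i"] by (simp add: J_def g_def \<gamma>0 c_def)
  ultimately obtain e where e: "e > 0" "ball 0 e \<subseteq> J" using open_contains_ball by blast
  have transversal: "from_chart M c (x t) (\<gamma>' t) \<notin> K (x t)" if t: "t \<in> J" for t
  proof -
    have tI: "t \<in> I" using t by (simp add: J_def)
    have "\<alpha> i (x t) (from_chart M c (x t) (\<gamma>' t)) = g t"
      unfolding g_def x(3)[OF tI, symmetric] form_in_chart[OF M c(1) x(1)[OF tI]] by simp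
    then show ?thesis using t i(1) Keq[OF x(2)[OF tI]] by (auto simp: J_def)
  qed
  have "countable J"
  proof (rule countable_if_isolated[where X = "mtop N" and x = x])
    show "second_countable (mtop N)" using mN by (simp add: smooth_manifold_def)
    fix t assume t: "t \<in> J"
    then have tI: "t \<in> I" by (simp add: J_def)
    let ?n = "chart_at N (x t)"
    have n: "?n \<in> atlas N" "x t \<in> fst ?n" using chart_at[OF mN x(5)[OF tI]] .
    let ?\<iota> = "snd c \<circ> (\<lambda>x. x) \<circ> chart_inv ?n" let ?z = "snd ?n (x t)"
    have \<iota>: "(?\<iota> has_derivative cderiv ?n c (\<lambda>x. x) (x t)) (at ?z)" unfolding cderiv_def
      by (rule fderiv_works[OF smooth_on_differentiable[OF smooth_map_rep[OF inc n(1) c(1)]]])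
        (use n x(1)[OF tI] in auto)
    have \<iota>': "cderiv ?n c (\<lambda>x. x) (x t) w = to_chart M c (x t) (tangent_map N M (\<lambda>x. x) (x t) w)" for w
      using cderiv_tangent_map[OF mN M inc n c(1) x(1)[OF tI]] mN x(5)[OF tI] by simp
    \<comment> \<open>A zero of \<open>?G\<close> is an encounter of the curve with the chart of the
      leaf. Its derivative is injective because the leaf is immersed and the velocity lies outside
      of the tangent space of the leaf.\<close>
    let ?G = "\<lambda>p. \<gamma> (fst p) - ?\<iota> (snd p)"
    let ?G' = "\<lambda>p. fst p *\<^sub>R \<gamma>' t - cderiv ?n c (\<lambda>x. x) (x t) (snd p)"
    have DG: "(?G has_derivative ?G') (at (t, ?z))"
    proof (rule has_derivative_diff)
      show "((\<lambda>p. \<gamma> (fst p)) has_derivative (\<lambda>p. fst p *\<^sub>R \<gamma>' t)) (at (t, ?z))"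
        using has_derivative_compose[OF has_derivative_fst[OF has_derivative_ident], of \<gamma> _ "(t, ?z)"] \<gamma>(1)[OF tI] by simp
      show "((\<lambda>p. ?\<iota> (snd p)) has_derivative (\<lambda>p. cderiv ?n c (\<lambda>x. x) (x t) (snd p))) (at (t, ?z))"
        using has_derivative_compose[OF has_derivative_snd[OF has_derivative_ident], of ?\<iota> _ "(t, ?z)"] \<iota> by simp
    qed
    have inj: "inj ?G'"
      unfolding linear_injective_0[OF has_derivative_linear[OF DG]]
    proof (intro allI impI)
      fix p assume p: "?G' p = 0"
      obtain h w where hw: "p = (h, w)" by (cases p)
      have 1: "h *\<^sub>R \<gamma>' t = to_chart M c (x t) (tangent_map N M (\<lambda>x. x) (x t) w)" using p hw \<iota>' by simp
      have "h = 0"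
      proof (rule ccontr)
        assume "h \<noteq> 0"
        then have "\<gamma>' t = inverse h *\<^sub>R to_chart M c (x t) (tangent_map N M (\<lambda>x. x) (x t) w)"
          by (simp add: 1[symmetric])
        then have "from_chart M c (x t) (\<gamma>' t) = tangent_map N M (\<lambda>x. x) (x t) (inverse h *\<^sub>R w)"
          using M c x(1)[OF tI] by (simp add: blinfun.scaleR_right)
        then show False using transversal[OF t] ran[OF x(5)[OF tI]] by (metis rangeI)
      qed
      then have "from_chart M c (x t) (to_chart M c (x t) (tangent_map N M (\<lambda>x. x) (x t) w)) = 0"
        unfolding 1[symmetric] by (simp add: blinfun.zero_right)
      then have "tangent_map N M (\<lambda>x. x) (x t) w = tangent_map N M (\<lambda>x. x) (x t) 0"
        using M c x(1)[OF tI] by (simp add: blinfun.zero_right)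
      then have "w = 0" using ran[OF x(5)[OF tI]] by (meson injD)
      then show "p = 0" using hw \<open>h = 0\<close> by (simp add: zero_prod_def)
    qed
    have "?G (t, ?z) = 0" using mN n x(3)[OF tI] by simp
    from isolated_zero[OF DG inj this] obtain \<delta> where \<delta>: "\<delta> > 0"
      "\<And>q. norm (q - (t, ?z)) < \<delta> \<Longrightarrow> ?G q = 0 \<Longrightarrow> q = (t, ?z)" by blast
    \<comment> \<open>Half of \<delta> is allotted to time and half to the leaf coordinate, as the
      norm of a pair is at most the sum of the two norms.\<close>
    let ?B = "{y \<in> fst ?n. snd ?n y \<in> ball ?z (\<delta>/2)}"
    have "s = t" if s: "s \<in> J" "s \<in> ball t (\<delta>/2)" "x s \<in> ?B" for s
    proof -
      have sI: "s \<in> I" using s by (simp add: J_def)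
      have "norm ((s, snd ?n (x s)) - (t, ?z)) \<le> norm (s - t) + norm (snd ?n (x s) - ?z)"
        unfolding diff_Pair by (rule norm_Pair_le)
      also have "\<dots> < \<delta>" using s by (simp add: dist_norm norm_minus_commute abs_minus_commute)
      finally have "norm ((s, snd ?n (x s)) - (t, ?z)) < \<delta>" .
      moreover have "?G (s, snd ?n (x s)) = 0" using mN n s(3) x(3)[OF sI] by simp
      ultimately show ?thesis using \<delta>(2) by blast
    qed
    moreover have "openin (mtop N) ?B" by (rule chart_preimage_open[OF mN n(1)]) simp
    moreover have "x t \<in> ?B" using n \<delta>(1) by simp
    ultimately show "\<exists>J' B. open J' \<and> t \<in> J' \<and> openin (mtop N) B \<and> x t \<in> B \<and> (\<forall>s\<in>J. s \<in> J' \<and> x s \<in> B \<longrightarrow> s = t)"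
      using \<delta>(1) by (intro exI[of _ "ball t (\<delta>/2)"] exI[of _ ?B]) auto
  qed
  then have "countable (ball (0::real) e)" using countable_subset[OF e(2)] by blast
  moreover have "ball (0::real) e = {-e<..<e}" by (simp add: ball_eq_greaterThanLessThan)
  ultimately show False using uncountable_open_interval[of "-e" e] e(1) by simp
qed

lemma K_kernel: "x \<in> carrier M \<Longrightarrow> v \<in> K x \<longleftrightarrow> T x v = 0"
  using K_imp_kernel kernel_imp_K by blast

end


section \<open>Descent of compatible tensor fields\<close>

locale compatible_quotient = dirac_quotient M Q \<psi> L F
  for M :: "('p, 'e::finite_dim_inner) manifold" and Q :: "('q, 'f::finite_dim_inner) manifold"
    and \<psi> :: "'p \<Rightarrow> 'q" and L :: "('p, 'e) subbundle" and F :: "('p, 'g::finite_dim_inner) manifold set" +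
  fixes r :: "('p, 'e) tensor11"
  assumes r: "r \<in> tensor_fields M" and compatible: "dirac_compatible M L r"
begin

lemma r_L: "x \<in> carrier M \<Longrightarrow> (v, \<alpha>) \<in> L x \<Longrightarrow> (r x v, \<alpha> o\<^sub>L r x) \<in> L x"
  using compatible unfolding dirac_compatible_def by blast

lemma D_section:
  "X \<in> vector_fields M \<Longrightarrow> (Y, \<alpha>) \<in> sections M L \<Longrightarrow> (D_vec M r X Y, D_form M r X \<alpha>) \<in> sections M L"
  using compatible unfolding dirac_compatible_def by blast

lemma r_kernel:
  assumes "x \<in> carrier M" "T x v = 0"
  shows "T x (r x v) = 0"
proof -
  have "(v, 0) \<in> L x" using assms K_kernel by (simp add: null_distribution_def)
  from r_L[OF assms(1) this] have "r x v \<in> K x" by (simp add: null_distribution_def)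
  then show ?thesis using K_kernel assms(1) by blast
qed

text \<open>The operator acts in the preferred chart of \<open>Q\<close> at \<psi> x, which is the
  same for all points of a fibre. The choice of the right inverse does not affect the value, because
  \<open>r\<close> preserves the kernel of \<open>T x\<close>.\<close>

definition B :: "'p \<Rightarrow> 'f \<Rightarrow>\<^sub>L 'f" where
  "B x = T x o\<^sub>L r x o\<^sub>L (SOME S. T x o\<^sub>L S = id_blinfun)"

lemma B_T:
  assumes x: "x \<in> carrier M"
  shows "B x (T x v) = T x (r x v)"
proof -
  let ?S = "SOME S. T x o\<^sub>L S = id_blinfun"
  have "T x o\<^sub>L ?S = id_blinfun" by (rule someI_ex[OF surj_blinfun_right_inverse[OF surj_T[OF x]]])
  then have "T x (?S w) = w" for w by (metis blinfun_apply_blinfun_compose blinfun_apply_id_blinfun)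
  then have "T x (?S (T x v) - v) = 0" by (simp add: blinfun.diff_right)
  from r_kernel[OF x this] show ?thesis by (simp add: B_def blinfun.diff_right)
qed

text \<open>The right inverse chosen in \<open>B\<close> need not depend smoothly on the point. In
  coordinates it is replaced by the smooth \<open>s\<close>, which yields the same
  endomorphism.\<close>

lemma B_local:
  assumes c: "c \<in> atlas M" "x0 \<in> fst c" and d: "d \<in> atlas Q" "\<psi> x0 \<in> fst d"
  obtains W Bh where "open W" "snd c x0 \<in> W" "W \<subseteq> snd c ` {x \<in> fst c. \<psi> x \<in> fst d}" "smooth_on W Bh"
    "\<And>x. x \<in> fst c \<Longrightarrow> snd c x \<in> W \<Longrightarrow> \<psi> x \<in> fst d \<and>
      Bh (snd c x) = to_chart Q d (\<psi> x) o\<^sub>L B x o\<^sub>L from_chart Q d (\<psi> x)"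
proof -
  let ?\<phi> = "snd d \<circ> \<psi> \<circ> chart_inv c"
  obtain W s where W: "open W" "snd c x0 \<in> W" "W \<subseteq> snd c ` {x \<in> fst c. \<psi> x \<in> fst d}" "smooth_on W s"
    and s: "\<And>x. x \<in> fst c \<Longrightarrow> snd c x \<in> W \<Longrightarrow> \<psi> x \<in> fst d \<and> cderiv c d \<psi> x o\<^sub>L s (snd c x) = id_blinfun"
    by (rule local_splitting[OF c d]) blast
  have \<phi>: "smooth_on W ?\<phi>" using smooth_on_subset[OF smooth_map_rep[OF smooth_\<psi> c(1) d(1)] W(3)] .
  have "smooth_on (snd c ` fst c) (tensor_in M c r)" using r c(1) by (simp add: tensor_fields_def)
  then have rh: "smooth_on W (tensor_in M c r)" by (rule smooth_on_subset) (use W(3) in auto)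
  define Bh where "Bh = (\<lambda>y. (fderiv ?\<phi> y o\<^sub>L tensor_in M c r y) o\<^sub>L s y)"
  have "smooth_on W Bh" unfolding Bh_def
    by (rule smooth_on_blinfun_compose[OF W(1) smooth_on_blinfun_compose[OF W(1) smooth_on_fderiv[OF W(1) \<phi>] rh] W(4)])
  moreover have "\<psi> x \<in> fst d \<and> Bh (snd c x) = to_chart Q d (\<psi> x) o\<^sub>L B x o\<^sub>L from_chart Q d (\<psi> x)"
    if x: "x \<in> fst c" "snd c x \<in> W" for x
  proof
    show \<psi>x: "\<psi> x \<in> fst d" using s[OF x] by blast
    have xM: "x \<in> carrier M" using chart_subset_carrier[OF M c(1)] x by blast
    have P: "cderiv c d \<psi> x = to_chart Q d (\<psi> x) o\<^sub>L T x o\<^sub>L from_chart M c x"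
      using cderiv_tangent_map[OF M Q smooth_\<psi> c(1) x(1) d(1) \<psi>x] .
    show "Bh (snd c x) = to_chart Q d (\<psi> x) o\<^sub>L B x o\<^sub>L from_chart Q d (\<psi> x)"
    proof (rule blinfun_eqI)
      fix w
      have sw: "cderiv c d \<psi> x (s (snd c x) w) = w"
        using s[OF x] by (metis blinfun_apply_blinfun_compose blinfun_apply_id_blinfun)
      have "Bh (snd c x) w = to_chart Q d (\<psi> x) (T x (r x (from_chart M c x (s (snd c x) w))))"
        using P M c x by (simp add: Bh_def cderiv_def[symmetric] tensor_in_chart)
      also have "\<dots> = to_chart Q d (\<psi> x) (B x (T x (from_chart M c x (s (snd c x) w))))"
        by (simp add: B_T[OF xM])
      also have "\<dots> = to_chart Q d (\<psi> x) (B x (from_chart Q d (\<psi> x) w))"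
        by (simp add: T_from_chart[OF c(1) x(1) d(1) \<psi>x] sw)
      finally show "Bh (snd c x) w = (to_chart Q d (\<psi> x) o\<^sub>L B x o\<^sub>L from_chart Q d (\<psi> x)) w" by simp
    qed
  qed
  ultimately show ?thesis using that[OF W(1-3)] by blast
qed

lemma vertical_section:
  assumes "Y \<in> vector_fields M" "\<And>x. x \<in> carrier M \<Longrightarrow> T x (Y x) = 0"
  shows "(Y, \<lambda>_. 0) \<in> sections M L"
  using assms smooth_form_on_zero[OF M openin_topspace] K_kernel
  by (auto simp: sections_def one_forms_def null_distribution_def)

lemma D_form_zero: "x \<in> carrier M \<Longrightarrow> D_form M r X (\<lambda>_. 0) x = 0"
proof -
  assume x: "x \<in> carrier M"
  have "dual_tensor r (\<lambda>_. 0) = (\<lambda>_. 0)" by (rule ext) (simp add: dual_tensor_def)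
  then show ?thesis by (simp add: D_form_def lie_form_zero[OF M x])
qed

text \<open>
  For vertical \<open>Y\<close> and a lift \<open>X\<close> of a vector field of \<open>Q\<close>, compatibility makes \<open>[Y, r X]\<close>
  vertical, which says that \<open>B\<close> has no derivative along \<open>Y\<close>.
\<close>

lemma B_deriv:
  assumes x0: "x0 \<in> carrier M" and c: "c = chart_at M x0" and d: "d = chart_at Q (\<psi> x0)"
    and W: "open W" "snd c x0 \<in> W" "smooth_on W Bh"
    and Bh: "\<And>x. x \<in> fst c \<Longrightarrow> snd c x \<in> W \<Longrightarrow> \<psi> x \<in> fst d \<and>
      Bh (snd c x) = to_chart Q d (\<psi> x) o\<^sub>L B x o\<^sub>L from_chart Q d (\<psi> x)"
    and v: "v \<in> K x0"
  shows "fderiv Bh (snd c x0) v = 0"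
proof (rule blinfun_eqI)
  fix e
  have cc: "c \<in> atlas M" "x0 \<in> fst c" and dd: "d \<in> atlas Q" "\<psi> x0 \<in> fst d"
    using chart_at[OF M x0] chart_at[OF Q \<psi>_carrier[OF x0]] by (auto simp: c d)
  obtain b U where U: "openin (mtop Q) U" "\<psi> x0 \<in> U"
    "\<And>q. q \<in> U \<Longrightarrow> q \<in> fst d \<and> snd d q \<in> snd d ` fst d \<and> b q = 1"
    and b: "\<And>q. b q \<noteq> 0 \<Longrightarrow> q \<in> fst d \<and> snd d q \<in> snd d ` fst d"
    and extv: "\<And>F. smooth_on (snd d ` fst d) F \<Longrightarrow> (\<lambda>q. b q *\<^sub>R from_chart Q d q (F (snd d q))) \<in> vector_fields Q"
    and extf: "\<And>A. smooth_on (snd d ` fst d) A \<Longrightarrow> (\<lambda>q. b q *\<^sub>R (A (snd d q) o\<^sub>L to_chart Q d q)) \<in> one_forms Q"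
    by (rule local_extension[OF Q dd chart_range_open[OF Q dd(1)] imageI[OF dd(2)] subset_refl]) blast
  \<comment> \<open>A global field on \<open>Q\<close> whose coordinates in \<open>d\<close> are
    constantly \<open>e\<close> near \<psi> x0.\<close>
  define E where "E = (\<lambda>q. b q *\<^sub>R from_chart Q d q e)"
  have E: "E \<in> vector_fields Q" unfolding E_def by (rule extv[OF smooth_on_const])
  obtain b' V where V: "openin (mtop M) V" "x0 \<in> V" "\<forall>x\<in>V. b' x = (1::real)"
    and lift: "\<forall>X\<in>vector_fields Q. \<exists>Y\<in>vector_fields M. \<forall>x\<in>carrier M. T x (Y x) = b' x *\<^sub>R X (\<psi> x)"
    using lift_exists[OF x0] by blast
  obtain X where X: "X \<in> vector_fields M" "\<And>x. x \<in> carrier M \<Longrightarrow> T x (X x) = b' x *\<^sub>R E (\<psi> x)"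
    using bspec[OF lift E] by blast
  have "T x0 v = 0" using K_kernel[OF x0] v by blast
  then obtain Y where Y: "Y \<in> vector_fields M" "Y x0 = v" "\<And>x. x \<in> carrier M \<Longrightarrow> T x (Y x) = 0"
    using vertical_extension[OF x0] by blast
  have VM: "x \<in> carrier M" if "x \<in> V" for x using openin_subset[OF V(1)] that by blast
  have "(D_vec M r X Y x0, D_form M r X (\<lambda>_. 0) x0) \<in> L x0"
    using D_section[OF X(1) vertical_section[OF Y(1,3)]] x0 by (simp add: sections_def)
  then have "D_vec M r X Y x0 \<in> K x0" by (simp add: D_form_zero[OF x0] null_distribution_def)
  then have D: "T x0 (D_vec M r X Y x0) = 0" using K_kernel[OF x0] by blast
  \<comment> \<open>Near \<open>x0\<close> the field \<open>X\<close> projects to \<open>E\<close>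
    and \<open>Y\<close> to zero, so their bracket is vertical at \<open>x0\<close>, and so is its
    image under \<open>r\<close>.\<close>
  have "T x0 (lie_bracket M Y X x0) = lie_bracket Q (\<lambda>_. 0) E (\<psi> x0)"
  proof (rule related_lie_bracket[OF M Q smooth_\<psi> Y(1) X(1) _ E V(1,2)])
    show "(\<lambda>_. 0) \<in> vector_fields Q" using smooth_vf_on_zero[OF Q openin_topspace] by (simp add: vector_fields_def)
  qed (use X(2) Y(3) VM V(3) in auto)
  also have "\<dots> = 0" by (rule lie_bracket_zero[OF Q \<psi>_carrier[OF x0] E])
  finally have "T x0 (r x0 (lie_bracket M Y X x0)) = 0" by (rule r_kernel[OF x0])
  then have 0: "T x0 (lie_bracket M Y (apply_tensor r X) x0) = 0"
    using D by (simp add: D_vec_def blinfun.diff_right)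
  let ?U = "V \<inter> {x \<in> fst c. snd c x \<in> W} \<inter> {x \<in> carrier M. \<psi> x \<in> U}"
  have "openin (mtop M) {x \<in> carrier M. \<psi> x \<in> U}"
    using smooth_\<psi> U(1) unfolding smooth_map_def by (blast intro: openin_continuous_map_preimage)
  then have oU: "openin (mtop M) ?U" using V(1) chart_preimage_open[OF M cc(1) W(1)] by blast
  have xU: "x0 \<in> ?U" using V(2) cc W(2) x0 U(2) by blast
  \<comment> \<open>The pushforward of \<open>r X\<close> has the coordinates \<open>Bh y e\<close>,
    that of \<open>Y\<close> vanishes; what remains of the bracket is the derivative of
    \<open>Bh y e\<close> along \<open>Y\<close>.\<close>
  have "T x0 (lie_bracket M Y (apply_tensor r X) x0) =
    fderiv (\<lambda>y. Bh y e) (snd c x0) (Y x0) - fderiv (\<lambda>_. 0) (snd c x0) (apply_tensor r X x0)"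
  proof (rule tangent_lie_bracket[OF M Q smooth_\<psi> Y(1) apply_tensor_vector_field[OF M r X(1)] oU xU c d])
    fix z assume z: "z \<in> ?U"
    then have zM: "z \<in> carrier M" by blast
    show "0 = to_chart Q d (\<psi> z) (T z (Y z))" by (simp add: Y(3)[OF zM] blinfun.zero_right)
    have "T z (X z) = from_chart Q d (\<psi> z) e" using X(2)[OF zM] z U(3) V(3) by (simp add: E_def)
    then have "T z (apply_tensor r X z) = B z (from_chart Q d (\<psi> z) e)"
      unfolding apply_tensor_def B_T[OF zM, symmetric] by simp
    then show "Bh (snd c z) e = to_chart Q d (\<psi> z) (T z (apply_tensor r X z))"
      using Bh[of z] z by simp
  qed
  then have "fderiv (\<lambda>y. Bh y e) (snd c x0) v = 0" using 0 Y(2) by simp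
  moreover have "fderiv (\<lambda>y. Bh y e) (snd c x0) v = fderiv Bh (snd c x0) v e"
    using fderiv_blinfun_apply[OF smooth_on_differentiable[OF W(3,2)], of "\<lambda>_. e" v] by (simp add: blinfun.zero_right)
  ultimately show "fderiv Bh (snd c x0) v e = blinfun_apply 0 e" by simp
qed

lemma B_fibre:
  assumes x: "x \<in> carrier M" and y: "y \<in> carrier M" and eq: "\<psi> y = \<psi> x"
  shows "B y = B x"
proof -
  obtain N where N: "N \<in> F" "x \<in> carrier N" "integral_manifold M K N" "carrier N \<subseteq> carrier M"
    and leaf: "\<And>y. y \<in> carrier M \<Longrightarrow> \<psi> y = \<psi> x \<longleftrightarrow> y \<in> carrier N" using leafE[OF x] by blast
  have mN: "smooth_manifold N" and con: "connected_space (mtop N)" and inc: "smooth_map N M (\<lambda>x. x)"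
    and ran: "\<And>x. x \<in> carrier N \<Longrightarrow> range (tangent_map N M (\<lambda>x. x) x) = K x"
    using N(3) by (auto simp: integral_manifold_def)
  show ?thesis
  proof (rule locally_constant_on_connected[OF mN con])
    show "y \<in> carrier N" using leaf[OF y] eq by blast
    fix n z assume n: "n \<in> atlas N" "z \<in> fst n"
    then have zN: "z \<in> carrier N" using chart_subset_carrier[OF mN n(1)] by blast
    then have zM: "z \<in> carrier M" and \<psi>z: "\<psi> z = \<psi> x" using N(4) leaf by blast+
    define c where "c = chart_at M z" define d where "d = chart_at Q (\<psi> z)"
    have c: "c \<in> atlas M" "z \<in> fst c" and d: "d \<in> atlas Q" "\<psi> z \<in> fst d"
      using chart_at[OF M zM] chart_at[OF Q \<psi>_carrier[OF zM]] by (auto simp: c_def d_def)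
    obtain W Bh where W: "open W" "snd c z \<in> W" "W \<subseteq> snd c ` {x \<in> fst c. \<psi> x \<in> fst d}" "smooth_on W Bh"
      and Bh: "\<And>x. x \<in> fst c \<Longrightarrow> snd c x \<in> W \<Longrightarrow> \<psi> x \<in> fst d \<and>
        Bh (snd c x) = to_chart Q d (\<psi> x) o\<^sub>L B x o\<^sub>L from_chart Q d (\<psi> x)"
      by (rule B_local[OF c d]) blast
    let ?\<iota> = "snd c \<circ> (\<lambda>x. x) \<circ> chart_inv n"
    have \<iota>: "(?\<iota> has_derivative cderiv n c (\<lambda>x. x) z) (at (snd n z))" unfolding cderiv_def
      by (rule fderiv_works[OF smooth_on_differentiable[OF smooth_map_rep[OF inc n(1) c(1)]]]) (use n c in auto)
    have \<iota>z: "?\<iota> (snd n z) = snd c z" using mN n by simp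
    have "(Bh has_derivative fderiv Bh (snd c z)) (at (?\<iota> (snd n z)))"
      unfolding \<iota>z by (rule fderiv_works[OF smooth_on_differentiable[OF W(4,2)]])
    from has_derivative_compose[OF \<iota> this]
    have "((\<lambda>u. Bh (?\<iota> u)) has_derivative (\<lambda>h. fderiv Bh (snd c z) (cderiv n c (\<lambda>x. x) z h))) (at (snd n z))" .
    moreover have "fderiv Bh (snd c z) (cderiv n c (\<lambda>x. x) z h) = 0" for h
    proof (rule B_deriv[OF zM c_def d_def W(1,2,4) Bh])
      have "cderiv n c (\<lambda>x. x) z h = tangent_map N M (\<lambda>x. x) z (from_chart N n z h)"
        using cderiv_tangent_map[OF mN M inc n c] M zM by (simp add: c_def)
      then show "cderiv n c (\<lambda>x. x) z h \<in> K z" using ran[OF zN] by (metis rangeI)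
    qed
    ultimately have D: "((\<lambda>u. Bh (?\<iota> u)) has_derivative (\<lambda>_. 0)) (at (snd n z))" by simp
    \<comment> \<open>A neighbourhood of z in the leaf topology on which \<open>Bh\<close>
      represents \<open>B\<close>; it is open because the inclusion of the leaf is
      continuous.\<close>
    let ?O = "fst n \<inter> {w \<in> carrier N. w \<in> {w \<in> fst c. snd c w \<in> W}}"
    have "openin (mtop N) {w \<in> carrier N. w \<in> {w \<in> fst c. snd c w \<in> W}}"
      by (rule openin_continuous_map_preimage[OF _ chart_preimage_open[OF M c(1) W(1)]])
        (use inc in \<open>simp add: smooth_map_def\<close>)
    then have O: "openin (mtop N) ?O" using chart_open[OF mN n(1)] by blast
    have oO: "open (snd n ` ?O)" by (rule chart_image_open[OF mN n(1) O]) blast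
    have zO: "snd n z \<in> snd n ` ?O" using n zN c W(2) by blast
    show "((B \<circ> chart_inv n) has_derivative (\<lambda>_. 0)) (at (snd n z))"
    proof (rule has_derivative_transform_within_open[OF D oO zO])
      fix u assume "u \<in> snd n ` ?O"
      then obtain w where w: "u = snd n w" "w \<in> fst n" "w \<in> carrier N" "w \<in> fst c" "snd c w \<in> W" by blast
      have "w \<in> carrier M" using w(3) N(4) by blast
      from leaf[OF this] w(3) \<psi>z have \<psi>w: "\<psi> w = \<psi> z" by simp
      \<comment> \<open>On the leaf the value of \<psi> is that at z, for which \<open>d\<close> is
        the preferred chart; both changes of chart are then the identity.\<close>
      have "Bh (snd c w) = B w"
        using Bh[OF w(4,5)] Q \<psi>_carrier[OF zM] unfolding \<psi>w d_def by (intro blinfun_eqI) simp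
      then show "Bh (?\<iota> u) = (B \<circ> chart_inv n) u" using w mN n by simp
    qed
  qed (use N in blast)
qed

section \<open>The induced tensor field on the leaf space\<close>

lemma descends: "\<exists>r'. descends_to M Q \<psi> r r'"
proof -
  \<comment> \<open>An arbitrary point of the fibre is chosen; by \<open>B_fibre\<close> every point
    gives the same operator.\<close>
  define r' where "r' = (\<lambda>q. B (SOME x. x \<in> carrier M \<and> \<psi> x = q))"
  have r': "r' (\<psi> x) = B x" if x: "x \<in> carrier M" for x
  proof -
    have "(SOME z. z \<in> carrier M \<and> \<psi> z = \<psi> x) \<in> carrier M \<and> \<psi> (SOME z. z \<in> carrier M \<and> \<psi> z = \<psi> x) = \<psi> x"
      by (rule someI[of _ x]) (use x in simp)
    then show ?thesis unfolding r'_def using B_fibre[OF x] by blast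
  qed
  have "smooth_on (snd d ` fst d) (tensor_in Q d r')" if d: "d \<in> atlas Q" for d
  proof (rule smooth_on_locally)
    fix y0 assume "y0 \<in> snd d ` fst d"
    then obtain q where q: "q \<in> fst d" "y0 = snd d q" by blast
    then have "q \<in> carrier Q" using chart_subset_carrier[OF Q d] by blast
    then obtain x0 where x0: "x0 \<in> carrier M" "\<psi> x0 = q" using fibre_nonempty by blast
    let ?c = "chart_at M x0"
    have c: "?c \<in> atlas M" "x0 \<in> fst ?c" using chart_at[OF M x0(1)] .
    have qd: "\<psi> x0 \<in> fst d" using q x0 by simp
    obtain W Bh where W: "open W" "snd ?c x0 \<in> W" "W \<subseteq> snd ?c ` {x \<in> fst ?c. \<psi> x \<in> fst d}" "smooth_on W Bh"
      and Bh: "\<And>x. x \<in> fst ?c \<Longrightarrow> snd ?c x \<in> W \<Longrightarrow> \<psi> x \<in> fst d \<and>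
        Bh (snd ?c x) = to_chart Q d (\<psi> x) o\<^sub>L B x o\<^sub>L from_chart Q d (\<psi> x)"
      by (rule B_local[OF c d qd]) blast
    obtain V \<sigma> where V: "open V" "snd d (\<psi> x0) \<in> V" "smooth_on V \<sigma>" "\<sigma> ` V \<subseteq> W"
      and \<sigma>: "\<And>y. y \<in> V \<Longrightarrow> snd d (\<psi> (chart_inv ?c (\<sigma> y))) = y"
      using local_section[OF x0(1) c d qd W(1-3)] by blast
    \<comment> \<open>In coordinates the induced tensor is \<open>Bh\<close> composed with the local
      section \<sigma>.\<close>
    have "smooth_on V (tensor_in Q d r')"
    proof (rule smooth_on_cong[OF V(1) _ smooth_on_compose[OF V(1) W(1) V(4,3) W(4)]])
      fix y assume y: "y \<in> V"
      then have \<sigma>W: "\<sigma> y \<in> W" using V(4) by blast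
      then obtain x where x: "x \<in> fst ?c" "\<psi> x \<in> fst d" "\<sigma> y = snd ?c x" using W(3) by auto
      have "x \<in> carrier M" using chart_subset_carrier[OF M c(1)] x by blast
      moreover have "y = snd d (\<psi> x)" using \<sigma>[OF y] x M c by simp
      ultimately show "Bh (\<sigma> y) = tensor_in Q d r' y"
        using Bh[OF x(1)] \<sigma>W x Q d r' by (simp add: tensor_in_chart)
    qed
    then show "\<exists>V. open V \<and> y0 \<in> V \<and> smooth_on V (tensor_in Q d r')"
      using V(1,2) q x0 by blast
  qed
  then have "r' \<in> tensor_fields Q" by (simp add: tensor_fields_def)
  moreover have "r' (\<psi> x) o\<^sub>L T x = T x o\<^sub>L r x" if "x \<in> carrier M" for x
    using r'[OF that] B_T[OF that] by (intro blinfun_eqI) simp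
  ultimately show ?thesis unfolding descends_to_def by blast
qed

lemma descends_nijenhuis:
  assumes desc: "descends_to M Q \<psi> r r'" and nij: "nijenhuis M r"
  shows "nijenhuis Q r'"
  unfolding nijenhuis_def
proof (intro ballI)
  have r': "r' \<in> tensor_fields Q" and rT: "\<And>x v. x \<in> carrier M \<Longrightarrow> T x (r x v) = r' (\<psi> x) (T x v)"
    using desc unfolding descends_to_def by (auto simp flip: blinfun_apply_blinfun_compose)
  fix X Y q assume X: "X \<in> vector_fields Q" and Y: "Y \<in> vector_fields Q" and q: "q \<in> carrier Q"
  obtain x0 where x0: "x0 \<in> carrier M" "\<psi> x0 = q" using fibre_nonempty[OF q] by blast
  obtain b U where U: "openin (mtop M) U" "x0 \<in> U" "\<forall>x\<in>U. b x = (1::real)"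
    and lift: "\<forall>X\<in>vector_fields Q. \<exists>Y\<in>vector_fields M. \<forall>x\<in>carrier M. T x (Y x) = b x *\<^sub>R X (\<psi> x)"
    using lift_exists[OF x0(1)] by blast
  have UM: "x \<in> carrier M" if "x \<in> U" for x using openin_subset[OF U(1)] that by blast
  obtain X' where X': "X' \<in> vector_fields M" "\<And>x. x \<in> U \<Longrightarrow> T x (X' x) = X (\<psi> x)"
    using bspec[OF lift X] U(3) UM by (metis scaleR_one)
  obtain Y' where Y': "Y' \<in> vector_fields M" "\<And>x. x \<in> U \<Longrightarrow> T x (Y' x) = Y (\<psi> x)"
    using bspec[OF lift Y] U(3) UM by (metis scaleR_one)
  have rel: "T x (apply_tensor r Z' x) = apply_tensor r' Z (\<psi> x)" if "T x (Z' x) = Z (\<psi> x)" "x \<in> U" for x Z Z'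
    using rT[OF UM[OF that(2)]] that by (simp add: apply_tensor_def)
  note vf = apply_tensor_vector_field[OF M r] apply_tensor_vector_field[OF Q r']
  note br = related_lie_bracket[OF M Q smooth_\<psi> _ _ _ _ U(1,2)]
  have b1: "T x0 (lie_bracket M X' Y' x0) = lie_bracket Q X Y (\<psi> x0)"
    by (rule br) (use X Y X' Y' in auto)
  have b2: "T x0 (lie_bracket M (apply_tensor r X') Y' x0) = lie_bracket Q (apply_tensor r' X) Y (\<psi> x0)"
    by (rule br) (use X Y X' Y' vf rel in auto)
  have b3: "T x0 (lie_bracket M X' (apply_tensor r Y') x0) = lie_bracket Q X (apply_tensor r' Y) (\<psi> x0)"
    by (rule br) (use X Y X' Y' vf rel in auto)
  have b4: "T x0 (lie_bracket M (apply_tensor r X') (apply_tensor r Y') x0) =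
      lie_bracket Q (apply_tensor r' X) (apply_tensor r' Y) (\<psi> x0)"
    by (rule br) (use X Y X' Y' vf rel in auto)
  have "lie_bracket M (apply_tensor r X') (apply_tensor r Y') x0
        - r x0 (lie_bracket M (apply_tensor r X') Y' x0 + lie_bracket M X' (apply_tensor r Y') x0
               - r x0 (lie_bracket M X' Y' x0)) = 0"
    using nij X'(1) Y'(1) x0(1) unfolding nijenhuis_def by blast
  \<comment> \<open>Under \<open>T x0\<close> each bracket on \<open>M\<close> becomes the
    corresponding bracket on \<open>Q\<close>, and each outer \<open>r\<close> becomes
    \<open>r'\<close>.\<close>
  from arg_cong[OF this, of "T x0"]
  show "lie_bracket Q (apply_tensor r' X) (apply_tensor r' Y) q
        - r' q (lie_bracket Q (apply_tensor r' X) Y q + lie_bracket Q X (apply_tensor r' Y) q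
               - r' q (lie_bracket Q X Y q)) = 0"
    by (simp add: blinfun.diff_right blinfun.add_right blinfun.zero_right rT[OF x0(1)] b1 b2 b3 b4 x0(2))
qed

end

section \<open>Compatibility with the Poisson structure\<close>

lemma blinfun_inner_expansion:
  fixes \<alpha> :: "'e::finite_dim_inner \<Rightarrow>\<^sub>L real"
  shows "(\<Sum>b\<in>fbasis. \<alpha> b *\<^sub>R blinfun_inner_left b) = \<alpha>"
proof (rule blinfun_eqI)
  fix v
  show "blinfun_apply (\<Sum>b\<in>fbasis. \<alpha> b *\<^sub>R blinfun_inner_left b) v = \<alpha> v"
    using linear_fbasis_expansion[OF bounded_linear.linear[OF blinfun.bounded_linear_right], of \<alpha> v]
    by (simp add: blinfun.sum_left blinfun.scaleR_left mult.commute)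
qed

text \<open>Reflexivity in finite dimension: the linear functional on covectors given by the
  bivector is evaluation at a vector. That vector is unique because the inner product with a
  difference of two candidates is itself a covector.\<close>

lemma sharp_apply:
  assumes \<pi>: "\<pi> \<in> bivector_fields Q" and q: "q \<in> carrier Q"
  shows "blinfun_apply \<beta> (sharp \<pi> q \<alpha>) = \<pi> q \<alpha> \<beta>"
proof -
  have lin: "linear (\<pi> q \<alpha>)" using \<pi> q by (simp add: bivector_fields_def bilinear_def)
  define v where "v = (\<Sum>b\<in>fbasis. \<pi> q \<alpha> (blinfun_inner_left b) *\<^sub>R b)"
  have v: "blinfun_apply \<beta> v = \<pi> q \<alpha> \<beta>" for \<beta>
  proof -
    have "blinfun_apply \<beta> v = (\<Sum>b\<in>fbasis. \<beta> b *\<^sub>R \<pi> q \<alpha> (blinfun_inner_left b))"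
      by (simp add: v_def blinfun.sum_right blinfun.scaleR_right mult.commute)
    also have "\<dots> = \<pi> q \<alpha> (\<Sum>b\<in>fbasis. \<beta> b *\<^sub>R blinfun_inner_left b)"
      by (simp only: linear_sum[OF lin] linear_scale[OF lin])
    also have "\<dots> = \<pi> q \<alpha> \<beta>" by (simp only: blinfun_inner_expansion)
    finally show ?thesis .
  qed
  have "sharp \<pi> q \<alpha> = v" unfolding sharp_def
  proof (rule the_equality)
    fix w assume "\<forall>\<beta>. blinfun_apply \<beta> w = \<pi> q \<alpha> \<beta>"
    then have "blinfun_apply (blinfun_inner_left (w - v)) (w - v) = 0" by (simp add: blinfun.diff_right v del: blinfun_inner_left.rep_eq)
    then show "w = v" by simp
  qed (use v in blast)
  then show ?thesis using v by simp
qed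

text \<open>Smoothness of a bivector is stated for covectors with constant coordinates. Expanding
  \<alpha> and the components of the result in \<open>fbasis\<close> reduces to these.\<close>

lemma sharp_vector_field:
  assumes Q: "smooth_manifold Q" and \<pi>: "\<pi> \<in> bivector_fields Q" and \<alpha>: "\<alpha> \<in> one_forms Q"
  shows "(\<lambda>q. sharp \<pi> q (\<alpha> q)) \<in> vector_fields Q"
proof (rule vector_fieldI[OF Q])
  fix d assume d: "d \<in> atlas Q"
  have o: "open (snd d ` fst d)" using chart_range_open[OF Q d] .
  let ?p = "\<lambda>a b y. let x = chart_inv d y in \<pi> x (blinfun_inner_left a o\<^sub>L to_chart Q d x) (blinfun_inner_left b o\<^sub>L to_chart Q d x)"
  have p: "smooth_on (snd d ` fst d) (?p a b)" for a b
    using \<pi> d by (simp add: bivector_fields_def)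
  have "smooth_on (snd d ` fst d) (\<lambda>y. \<Sum>b\<in>fbasis. (\<Sum>a\<in>fbasis. form_in Q d \<alpha> y a *\<^sub>R ?p a b y) *\<^sub>R b)"
    by (rule smooth_on_sum[OF o smooth_on_scaleR[OF o smooth_on_sum[OF o smooth_on_scaleR[OF o
        smooth_on_blinfun_apply[OF o one_form_smooth[OF Q d \<alpha>] smooth_on_const] p]] smooth_on_const]])
  then show "smooth_on (snd d ` fst d) (vf_in Q d (\<lambda>q. sharp \<pi> q (\<alpha> q)))"
  proof (rule smooth_on_cong[OF o, rotated])
    fix y assume "y \<in> snd d ` fst d"
    then obtain q where q: "q \<in> fst d" "y = snd d q" by blast
    then have qQ: "q \<in> carrier Q" using chart_subset_carrier[OF Q d] by blast
    let ?T = "to_chart Q d q"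
    have lin: "linear (\<lambda>\<alpha>. \<pi> q \<alpha> \<beta>)" for \<beta> using \<pi> qQ by (simp add: bivector_fields_def bilinear_def)
    have \<alpha>q: "\<alpha> q = (\<Sum>a\<in>fbasis. form_in Q d \<alpha> y a *\<^sub>R (blinfun_inner_left a o\<^sub>L ?T))"
    proof (rule blinfun_eqI)
      fix v
      have "\<alpha> q v = form_in Q d \<alpha> y (?T v)" using q Q d by (simp add: form_in_chart)
      also have "\<dots> = (\<Sum>a\<in>fbasis. form_in Q d \<alpha> y a *\<^sub>R blinfun_inner_left a) (?T v)"
        by (simp only: blinfun_inner_expansion)
      finally show "\<alpha> q v = (\<Sum>a\<in>fbasis. form_in Q d \<alpha> y a *\<^sub>R (blinfun_inner_left a o\<^sub>L ?T)) v"
        by (simp add: blinfun.sum_left blinfun.scaleR_left)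
    qed
    have *: "(\<Sum>a\<in>fbasis. form_in Q d \<alpha> y a *\<^sub>R ?p a b y) = ?T (sharp \<pi> q (\<alpha> q)) \<bullet> b" for b
    proof -
      have "?T (sharp \<pi> q (\<alpha> q)) \<bullet> b = blinfun_apply (blinfun_inner_left b o\<^sub>L ?T) (sharp \<pi> q (\<alpha> q))" by simp
      also have "\<dots> = \<pi> q (\<alpha> q) (blinfun_inner_left b o\<^sub>L ?T)" by (rule sharp_apply[OF \<pi> qQ])
      also have "\<dots> = (\<Sum>a\<in>fbasis. form_in Q d \<alpha> y a *\<^sub>R \<pi> q (blinfun_inner_left a o\<^sub>L ?T) (blinfun_inner_left b o\<^sub>L ?T))"
        by (subst \<alpha>q) (simp only: linear_sum[OF lin] linear_scale[OF lin])
      finally show ?thesis using q Q d by simp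
    qed
    show "(\<Sum>b\<in>fbasis. (\<Sum>a\<in>fbasis. form_in Q d \<alpha> y a *\<^sub>R ?p a b y) *\<^sub>R b) = vf_in Q d (\<lambda>q. sharp \<pi> q (\<alpha> q)) y"
      unfolding * fbasis_expansion using q Q d by (simp add: vf_in_chart)
  qed
qed

context compatible_quotient
begin

lemma descends_poisson_compatible:
  assumes \<pi>: "\<pi> \<in> bivector_fields Q" and fwd: "forward_dirac M L Q (graph_sharp \<pi>) \<psi>"
    and desc: "descends_to M Q \<psi> r r'"
  shows "poisson_compatible Q \<pi> r'"
proof -
  have r': "r' \<in> tensor_fields Q" and rT: "\<And>x v. x \<in> carrier M \<Longrightarrow> T x (r x v) = r' (\<psi> x) (T x v)"
    using desc unfolding descends_to_def by (auto simp flip: blinfun_apply_blinfun_compose)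
  \<comment> \<open>The two inclusions of the forward Dirac equality: an element of \<open>L\<close>
    with pulled-back covector projects into the graph, and every covector of \<open>Q\<close> arises
    from such an element.\<close>
  have sharp_unique: "T x v = sharp \<pi> (\<psi> x) \<beta>" if "x \<in> carrier M" "(v, \<beta> o\<^sub>L T x) \<in> L x" for x v \<beta>
  proof -
    have "(T x v, \<beta>) \<in> graph_sharp \<pi> (\<psi> x)" using fwd that unfolding forward_dirac_def by blast
    then show ?thesis by (simp add: graph_sharp_def)
  qed
  have sharp_exists: "\<exists>v. (v, \<beta> o\<^sub>L T x) \<in> L x \<and> T x v = sharp \<pi> (\<psi> x) \<beta>" if "x \<in> carrier M" for x \<beta>
  proof -
    have "(sharp \<pi> (\<psi> x) \<beta>, \<beta>) \<in> graph_sharp \<pi> (\<psi> x)" by (auto simp: graph_sharp_def)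
    then have "(sharp \<pi> (\<psi> x) \<beta>, \<beta>) \<in> {(T x v, \<beta>) | v \<beta>. (v, \<beta> o\<^sub>L T x) \<in> L x}"
      using fwd that unfolding forward_dirac_def by blast
    then show ?thesis by auto
  qed
  have part1: "sharp \<pi> q (\<alpha> o\<^sub>L r' q) = r' q (sharp \<pi> q \<alpha>)" if q: "q \<in> carrier Q" for q \<alpha>
  proof -
    obtain x where x: "x \<in> carrier M" "\<psi> x = q" using fibre_nonempty[OF q] by blast
    obtain v where v: "(v, \<alpha> o\<^sub>L T x) \<in> L x" "T x v = sharp \<pi> (\<psi> x) \<alpha>" using sharp_exists[OF x(1)] by blast
    have "(r x v, (\<alpha> o\<^sub>L T x) o\<^sub>L r x) \<in> L x" by (rule r_L[OF x(1) v(1)])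
    moreover have "(\<alpha> o\<^sub>L T x) o\<^sub>L r x = (\<alpha> o\<^sub>L r' (\<psi> x)) o\<^sub>L T x"
      using rT[OF x(1)] by (intro blinfun_eqI) simp
    ultimately have "T x (r x v) = sharp \<pi> (\<psi> x) (\<alpha> o\<^sub>L r' (\<psi> x))" using sharp_unique[OF x(1)] by metis
    then show ?thesis using rT[OF x(1)] v(2) x(2) by simp
  qed
  have part2: "sharp \<pi> q (lie_form Q X (dual_tensor r' \<alpha>) q - lie_form Q (apply_tensor r' X) \<alpha> q)
        - lie_tensor Q (\<lambda>y. sharp \<pi> y (\<alpha> y)) r' X q = 0"
    if X: "X \<in> vector_fields Q" and \<alpha>: "\<alpha> \<in> one_forms Q" and q: "q \<in> carrier Q" for X \<alpha> q
  proof -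
    let ?Z = "\<lambda>y. sharp \<pi> y (\<alpha> y)"
    have Z: "?Z \<in> vector_fields Q" by (rule sharp_vector_field[OF Q \<pi> \<alpha>])
    obtain x0 where x0: "x0 \<in> carrier M" "\<psi> x0 = q" using fibre_nonempty[OF q] by blast
    obtain b U where U: "openin (mtop M) U" "x0 \<in> U" "\<forall>x\<in>U. b x = (1::real)"
      and lift: "\<forall>X\<in>vector_fields Q. \<exists>Y\<in>vector_fields M. \<forall>x\<in>carrier M. T x (Y x) = b x *\<^sub>R X (\<psi> x)"
      and liftf: "\<forall>\<alpha>\<in>one_forms Q. (\<lambda>x. b x *\<^sub>R (\<alpha> (\<psi> x) o\<^sub>L T x)) \<in> one_forms M"
      using lift_exists[OF x0(1)] by blast
    have UM: "x \<in> carrier M" if "x \<in> U" for x using openin_subset[OF U(1)] that by blast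
    obtain X' where X': "X' \<in> vector_fields M" "\<And>x. x \<in> carrier M \<Longrightarrow> T x (X' x) = b x *\<^sub>R X (\<psi> x)"
      using bspec[OF lift X] by blast
    obtain Y where Y: "Y \<in> vector_fields M" "\<And>x. x \<in> carrier M \<Longrightarrow> T x (Y x) = b x *\<^sub>R ?Z (\<psi> x)"
      using bspec[OF lift Z] by blast
    define \<beta> where "\<beta> = (\<lambda>x. b x *\<^sub>R (\<alpha> (\<psi> x) o\<^sub>L T x))"
    have \<beta>: "\<beta> \<in> one_forms M" unfolding \<beta>_def using liftf \<alpha> by blast
    have relX: "T x (X' x) = X (\<psi> x)" and relY: "T x (Y x) = ?Z (\<psi> x)" and rel\<beta>: "\<beta> x = \<alpha> (\<psi> x) o\<^sub>L T x"
      if "x \<in> U" for x using X'(2) Y(2) UM[OF that] U(3) that by (auto simp: \<beta>_def)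
    have relrX: "T x (apply_tensor r X' x) = apply_tensor r' X (\<psi> x)" if "x \<in> U" for x
      using rT[OF UM[OF that]] relX[OF that] by (simp add: apply_tensor_def)
    have relr\<beta>: "dual_tensor r \<beta> x = dual_tensor r' \<alpha> (\<psi> x) o\<^sub>L T x" if "x \<in> U" for x
      using rT[OF UM[OF that]] rel\<beta>[OF that] by (intro blinfun_eqI) (simp add: dual_tensor_def)
    \<comment> \<open>A section is required on all of \<open>M\<close>, also where the cutoff is not
      1. As both components carry the factor \<open>b x\<close>, the pair still differs from a
      multiple of an element of \<open>L x\<close> by a vertical vector.\<close>
    have "(Y x, \<beta> x) \<in> L x" if x: "x \<in> carrier M" for x
    proof -
      obtain v where v: "(v, \<alpha> (\<psi> x) o\<^sub>L T x) \<in> L x" "T x v = ?Z (\<psi> x)" using sharp_exists[OF x] by blast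
      have "T x (Y x - b x *\<^sub>R v) = 0" using Y(2)[OF x] v(2) by (simp add: blinfun.diff_right blinfun.scaleR_right)
      then have "(Y x - b x *\<^sub>R v, 0) \<in> L x" using K_kernel[OF x] by (simp add: null_distribution_def)
      from L_add[OF x this L_scaleR[OF x v(1), of "b x"]] show ?thesis by (simp add: \<beta>_def)
    qed
    then have "(Y, \<beta>) \<in> sections M L" using Y(1) \<beta> by (simp add: sections_def)
    from D_section[OF X'(1) this] have inL: "(D_vec M r X' Y x0, D_form M r X' \<beta> x0) \<in> L x0"
      using x0(1) by (simp add: sections_def)
    note vf = apply_tensor_vector_field[OF M r X'(1)] apply_tensor_vector_field[OF Q r' X]
    have f1: "lie_form M X' (dual_tensor r \<beta>) x0 = lie_form Q X (dual_tensor r' \<alpha>) (\<psi> x0) o\<^sub>L T x0"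
      by (rule related_lie_form[OF M Q smooth_\<psi> X'(1) dual_tensor_one_form[OF M r \<beta>] X
            dual_tensor_one_form[OF Q r' \<alpha>] U(1,2) relX relr\<beta>])
    have f2: "lie_form M (apply_tensor r X') \<beta> x0 = lie_form Q (apply_tensor r' X) \<alpha> (\<psi> x0) o\<^sub>L T x0"
      by (rule related_lie_form[OF M Q smooth_\<psi> vf(1) \<beta> vf(2) \<alpha> U(1,2) relrX rel\<beta>])
    \<comment> \<open>The covector part is pulled back from \<open>Q\<close>, so the forward Dirac
      condition determines the projection of the vector part.\<close>
    have "D_form M r X' \<beta> x0 = (lie_form Q X (dual_tensor r' \<alpha>) q - lie_form Q (apply_tensor r' X) \<alpha> q) o\<^sub>L T x0"
      unfolding D_form_def f1 f2 x0(2) by (rule blinfun_eqI) (simp add: blinfun.diff_left)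
    then have S: "T x0 (D_vec M r X' Y x0) = sharp \<pi> q (lie_form Q X (dual_tensor r' \<alpha>) q - lie_form Q (apply_tensor r' X) \<alpha> q)"
      using sharp_unique[OF x0(1)] inL x0(2) by metis
    have g1: "T x0 (lie_bracket M Y (apply_tensor r X') x0) = lie_bracket Q ?Z (apply_tensor r' X) (\<psi> x0)"
      by (rule related_lie_bracket[OF M Q smooth_\<psi> Y(1) vf(1) Z vf(2) U(1,2) relY relrX])
    have g2: "T x0 (lie_bracket M Y X' x0) = lie_bracket Q ?Z X (\<psi> x0)"
      by (rule related_lie_bracket[OF M Q smooth_\<psi> Y(1) X'(1) Z X U(1,2) relY relX])
    have "T x0 (D_vec M r X' Y x0) = lie_tensor Q ?Z r' X q"
      by (simp add: D_vec_def lie_tensor_def blinfun.diff_right rT[OF x0(1)] g1 g2 x0(2))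
    then show ?thesis using S by simp
  qed
  show ?thesis unfolding poisson_compatible_def using part1 part2 by blast
qed

end

theorem corollary4p5:
  fixes M :: "('p, 'e::finite_dim_inner) manifold"
    and L :: "('p, 'e) subbundle"
    and r :: "('p, 'e) tensor11"
    and \<K> :: "('p, 'g::finite_dim_inner) manifold set"
    and Q :: "('p set, 'f::finite_dim_inner) manifold"
    and \<pi>\<^sub>Q :: "('p set, 'f) bivector"
  assumes "smooth_manifold M"
    and "dirac M L"
    and "foliation_of M (null_distribution L) \<K>"
    and "simple_with_leaf_space M \<K> Q"
    and "poisson Q \<pi>\<^sub>Q"
    and "forward_dirac M L Q (graph_sharp \<pi>\<^sub>Q) (leaf_map \<K>)"
    and "r \<in> tensor_fields M"
    and "dirac_compatible M L r"
  shows "(\<exists>r\<^sub>Q. descends_to M Q (leaf_map \<K>) r r\<^sub>Q) \<and>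
    (\<forall>r\<^sub>Q. descends_to M Q (leaf_map \<K>) r r\<^sub>Q \<longrightarrow>
       poisson_compatible Q \<pi>\<^sub>Q r\<^sub>Q \<and>
       (dirac_nijenhuis M L r \<longrightarrow> poisson_nijenhuis Q \<pi>\<^sub>Q r\<^sub>Q))"
proof -
  have part: "partition_on (carrier M) (leaves \<K>)" using assms(3) by (simp add: foliation_of_def)
  have leaf: "leaf_map \<K> x = carrier N" if "N \<in> \<K>" "x \<in> carrier N" for x N
    unfolding leaf_map_def
  proof (rule the_equality)
    show "S = carrier N" if "S \<in> leaves \<K> \<and> x \<in> S" for S
      using disjointD[OF partition_onD2[OF part], of S "carrier N"] that \<open>N \<in> \<K>\<close> \<open>x \<in> carrier N\<close> by blast
  qed (use that in blast)
  have leaf_ex: "\<exists>N\<in>\<K>. x \<in> carrier N" if "x \<in> carrier M" for x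
    using that partition_onD1[OF part] by blast
  interpret compatible_quotient M Q "leaf_map \<K>" L \<K> r
  proof
    fix x y assume x: "x \<in> carrier M" and y: "y \<in> carrier M"
    \<comment> \<open>Disjointness of the leaves makes equality under \<open>leaf_map\<close> the
      same as lying on a common leaf.\<close>
    show "leaf_map \<K> x = leaf_map \<K> y \<longleftrightarrow> (\<exists>N\<in>\<K>. x \<in> carrier N \<and> y \<in> carrier N)"
      using leaf leaf_ex[OF x] leaf_ex[OF y] by metis
  qed (use assms in \<open>simp_all add: simple_with_leaf_space_def\<close>)
  have "\<pi>\<^sub>Q \<in> bivector_fields Q" using assms(5) by (simp add: poisson_def)
  note compatible = descends_poisson_compatible[OF this assms(6)]
  have "poisson_nijenhuis Q \<pi>\<^sub>Q r\<^sub>Q" if "descends_to M Q (leaf_map \<K>) r r\<^sub>Q" "dirac_nijenhuis M L r" for r\<^sub>Q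
    using that compatible[OF that(1)] descends_nijenhuis[OF that(1)] assms(5)
    by (simp add: poisson_nijenhuis_def dirac_nijenhuis_def descends_to_def)
  then show ?thesis using descends compatible by blast
qed

end
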